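(* Let $a<b$ be real numbers and $\mathbb{I}=[a,b]$. For any $d\in\mathbb{N}$ and $s\in\mathbb{N}$, the following limit exists and has the stated value: $$\lim_{n\to\infty} a_n\left(H^s_{\rm mix}(\mathbb{I}^d)\hookrightarrow L_2(\mathbb{I}^d)\right)\cdot n^s(\log n)^{-s(d-1)}=\left(\frac{(b-a)^d}{\pi^d\,(d-1)!}\right)^s.$$
   Context: $\mathbb{N}=\{1,2,\dots\}$. For a compact linear operator $T:X\to Y$ between Hilbert spaces, $a_n(T)=\inf\{\|T-A\| : A:X\to Y\text{ bounded linear},\ \operatorname{rank}(A)<n\}$. The space $$H^s_{\rm mix}(\mathbb{I}^d)=\{f\in L_2(\mathbb{I}^d) : D^\alpha f\in L_2(\mathbb{I}^d)\text{ for each }\alpha\in\{0,\dots,s\}^d\}$$ (weak derivatives) is a Hilbert space with the scalar product $\langle f,g\rangle_s=\sum_{\alpha\in\{0,\dots,s\}^d}\int_{[a,b]^d}D^\alpha f(x)\,\overline{D^\alpha g(x)}\,dx$; it is the $d$th Hilbert space tensor power of the univariate Sobolev space $H^s(\mathbb{I})$ with norm $\|f\|_s^2=\sum_{l=0}^s\|f^{(l)}\|_{L_2}^2$. $L_2(\mathbb{I}^d)$ carries its usual scalar product, and $\hookrightarrow$ denotes the (compact) embedding operator. *)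

theory Defs
  imports "HOL-Analysis.Analysis"
begin

section \<open>Operators between seminormed spaces of functions\<close>

text \<open>
  A function space whose elements are only determined up to almost everywhere equality is given
  by a linear space \<open>X\<close> of representatives and the seminorm \<open>p\<close> on \<open>X\<close> induced by its norm; two
  representatives denote the same element iff their difference is a null vector of the seminorm.
  Accordingly linearity and rank are taken modulo null vectors. The bound in
  \<open>bounded_linear_op\<close> makes an operator compatible with this identification, so the
  notions below are those of the quotient spaces.
\<close>

definition bounded_linear_op ::
    "('a \<Rightarrow> complex) set \<Rightarrow> (('a \<Rightarrow> complex) \<Rightarrow> real) \<Rightarrow>
     ('b \<Rightarrow> complex) set \<Rightarrow> (('b \<Rightarrow> complex) \<Rightarrow> real) \<Rightarrow>
     (('a \<Rightarrow> complex) \<Rightarrow> ('b \<Rightarrow> complex)) \<Rightarrow> bool" where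
  "bounded_linear_op X p Y q A \<longleftrightarrow>
     (\<forall>f\<in>X. A f \<in> Y) \<and>
     (\<forall>f\<in>X. \<forall>g\<in>X. q (\<lambda>y. A (\<lambda>x. f x + g x) y - (A f y + A g y)) = 0) \<and>
     (\<forall>c. \<forall>f\<in>X. q (\<lambda>y. A (\<lambda>x. c * f x) y - c * A f y) = 0) \<and>
     (\<exists>C. \<forall>f\<in>X. q (A f) \<le> C * p f)"

definition rank_less ::
    "('a \<Rightarrow> complex) set \<Rightarrow> (('b \<Rightarrow> complex) \<Rightarrow> real) \<Rightarrow>
     (('a \<Rightarrow> complex) \<Rightarrow> ('b \<Rightarrow> complex)) \<Rightarrow> nat \<Rightarrow> bool" where
  "rank_less X q A n \<longleftrightarrow>
     (\<exists>B. B \<subseteq> A ` X \<and> finite B \<and> card B < n \<and>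
        (\<forall>f\<in>X. \<exists>c. q (\<lambda>y. A f y - (\<Sum>g\<in>B. c g * g y)) = 0))"

definition operator_norm ::
    "('a \<Rightarrow> complex) set \<Rightarrow> (('a \<Rightarrow> complex) \<Rightarrow> real) \<Rightarrow> (('b \<Rightarrow> complex) \<Rightarrow> real) \<Rightarrow>
     (('a \<Rightarrow> complex) \<Rightarrow> ('b \<Rightarrow> complex)) \<Rightarrow> real" where
  "operator_norm X p q T = (SUP f\<in>{f \<in> X. p f \<le> 1}. q (T f))"

definition approx_number ::
    "('a \<Rightarrow> complex) set \<Rightarrow> (('a \<Rightarrow> complex) \<Rightarrow> real) \<Rightarrow>
     ('b \<Rightarrow> complex) set \<Rightarrow> (('b \<Rightarrow> complex) \<Rightarrow> real) \<Rightarrow>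
     (('a \<Rightarrow> complex) \<Rightarrow> ('b \<Rightarrow> complex)) \<Rightarrow> nat \<Rightarrow> real" where
  "approx_number X p Y q T n =
     Inf {operator_norm X p q (\<lambda>f y. T f y - A f y) | A.
            bounded_linear_op X p Y q A \<and> rank_less X q A n}"


section \<open>Square integrable functions\<close>

definition L2_space :: "'a measure \<Rightarrow> ('a \<Rightarrow> complex) set" where
  "L2_space M = {f \<in> borel_measurable M. integrable M (\<lambda>x. (norm (f x))\<^sup>2)}"

definition L2_inner :: "'a measure \<Rightarrow> ('a \<Rightarrow> complex) \<Rightarrow> ('a \<Rightarrow> complex) \<Rightarrow> complex" where
  "L2_inner M f g = (LINT x|M. f x * cnj (g x))"

definition L2_norm :: "'a measure \<Rightarrow> ('a \<Rightarrow> complex) \<Rightarrow> real" where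
  "L2_norm M f = sqrt (Re (L2_inner M f f))"


section \<open>Weak derivatives\<close>

definition partial_deriv :: "'n::finite \<Rightarrow> (real^'n \<Rightarrow> complex) \<Rightarrow> (real^'n \<Rightarrow> complex)" where
  "partial_deriv i \<phi> = (\<lambda>x. vector_derivative (\<lambda>t. \<phi> (x + t *\<^sub>R axis i 1)) (at 0))"

primrec C_k :: "nat \<Rightarrow> (real^'n::finite \<Rightarrow> complex) \<Rightarrow> bool" where
  "C_k 0 \<phi> \<longleftrightarrow> continuous_on UNIV \<phi>"
| "C_k (Suc k) \<phi> \<longleftrightarrow> (\<forall>x. \<phi> differentiable (at x)) \<and> (\<forall>i. C_k k (partial_deriv i \<phi>))"

definition test_functions :: "(real^'n::finite) set \<Rightarrow> (real^'n \<Rightarrow> complex) set" where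
  "test_functions \<Omega> =
     {\<phi>. (\<forall>k. C_k k \<phi>) \<and> compact (closure {x. \<phi> x \<noteq> 0}) \<and> closure {x. \<phi> x \<noteq> 0} \<subseteq> \<Omega>}"

text \<open>
  The classical derivative \<open>D\<^sup>\<alpha> \<phi>\<close>, applying the partial derivative in direction \<open>i\<close> exactly \<open>\<alpha> i\<close>
  times. The index type carries no order, so an order of differentiation is chosen arbitrarily;
  for smooth \<open>\<phi>\<close> the result does not depend on it.
\<close>
definition multi_deriv ::
    "('n::finite \<Rightarrow> nat) \<Rightarrow> (real^'n \<Rightarrow> complex) \<Rightarrow> (real^'n \<Rightarrow> complex)" where
  "multi_deriv \<alpha> \<phi> = foldr partial_deriv (SOME is. \<forall>i. count_list is i = \<alpha> i) \<phi>"

definition locally_integrable_on :: "(real^'n::finite \<Rightarrow> complex) \<Rightarrow> (real^'n) set \<Rightarrow> bool" where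
  "locally_integrable_on f \<Omega> \<longleftrightarrow>
     (\<forall>K. compact K \<and> K \<subseteq> \<Omega> \<longrightarrow> f absolutely_integrable_on K)"

definition has_weak_deriv ::
    "(real^'n::finite) set \<Rightarrow> ('n \<Rightarrow> nat) \<Rightarrow> (real^'n \<Rightarrow> complex) \<Rightarrow> (real^'n \<Rightarrow> complex) \<Rightarrow> bool" where
  "has_weak_deriv \<Omega> \<alpha> f g \<longleftrightarrow>
     locally_integrable_on f \<Omega> \<and> locally_integrable_on g \<Omega> \<and>
     (\<forall>\<phi>\<in>test_functions \<Omega>.
        (LINT x|lebesgue_on \<Omega>. f x * multi_deriv \<alpha> \<phi> x) =
        (-1) ^ (\<Sum>i\<in>UNIV. \<alpha> i) * (LINT x|lebesgue_on \<Omega>. g x * \<phi> x))"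


section \<open>The Sobolev space of dominating mixed smoothness on a cube\<close>

definition cube :: "real \<Rightarrow> real \<Rightarrow> (real^'n::finite) set" where
  "cube a b = cbox (vec a) (vec b)"

definition L2_cube :: "real \<Rightarrow> real \<Rightarrow> (real^'n::finite \<Rightarrow> complex) set" where
  "L2_cube a b = L2_space (lebesgue_on (cube a b))"

definition L2_cube_norm :: "real \<Rightarrow> real \<Rightarrow> (real^'n::finite \<Rightarrow> complex) \<Rightarrow> real" where
  "L2_cube_norm a b = L2_norm (lebesgue_on (cube a b))"

definition multi_indices :: "nat \<Rightarrow> ('n::finite \<Rightarrow> nat) set" where
  "multi_indices s = {\<alpha>. \<forall>i. \<alpha> i \<in> {0..s}}"

definition is_L2_weak_deriv ::
    "real \<Rightarrow> real \<Rightarrow> ('n::finite \<Rightarrow> nat) \<Rightarrow> (real^'n \<Rightarrow> complex) \<Rightarrow> (real^'n \<Rightarrow> complex) \<Rightarrow> bool" where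
  "is_L2_weak_deriv a b \<alpha> f g \<longleftrightarrow>
     g \<in> L2_cube a b \<and> has_weak_deriv (interior (cube a b)) \<alpha> f g"

text \<open>Weak derivatives are unique up to null sets; a representative is chosen.\<close>
definition weak_deriv ::
    "real \<Rightarrow> real \<Rightarrow> ('n::finite \<Rightarrow> nat) \<Rightarrow> (real^'n \<Rightarrow> complex) \<Rightarrow> (real^'n \<Rightarrow> complex)" where
  "weak_deriv a b \<alpha> f = (SOME g. is_L2_weak_deriv a b \<alpha> f g)"

definition H_mix :: "real \<Rightarrow> real \<Rightarrow> nat \<Rightarrow> (real^'n::finite \<Rightarrow> complex) set" where
  "H_mix a b s = {f \<in> L2_cube a b. \<forall>\<alpha>\<in>multi_indices s. \<exists>g. is_L2_weak_deriv a b \<alpha> f g}"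

definition H_mix_inner ::
    "real \<Rightarrow> real \<Rightarrow> nat \<Rightarrow> (real^'n::finite \<Rightarrow> complex) \<Rightarrow> (real^'n \<Rightarrow> complex) \<Rightarrow> complex" where
  "H_mix_inner a b s f g =
     (\<Sum>\<alpha>\<in>multi_indices s.
        L2_inner (lebesgue_on (cube a b)) (weak_deriv a b \<alpha> f) (weak_deriv a b \<alpha> g))"

definition H_mix_norm :: "real \<Rightarrow> real \<Rightarrow> nat \<Rightarrow> (real^'n::finite \<Rightarrow> complex) \<Rightarrow> real" where
  "H_mix_norm a b s f = sqrt (Re (H_mix_inner a b s f f))"

text \<open>The embedding of \<open>H_mix\<close> into \<open>L\<^sub>2\<close> is the identity on representatives. The dimension is
  passed through the index type \<open>'n\<close>.\<close>
definition embedding_approx_number ::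
    "'n::finite itself \<Rightarrow> real \<Rightarrow> real \<Rightarrow> nat \<Rightarrow> nat \<Rightarrow> real" where
  "embedding_approx_number TYPE('n) a b s n =
     approx_number (H_mix a b s :: (real^'n \<Rightarrow> complex) set) (H_mix_norm a b s)
       (L2_cube a b :: (real^'n \<Rightarrow> complex) set) (L2_cube_norm a b) (\<lambda>f. f) n"

end

theory Submission
  imports Defs
begin

text \<open>
  Expand functions on the cube in the exponentials \<open>E\<^sub>k\<close>, \<open>k \<in> \<int>\<^sup>d\<close>, with frequencies \<open>\<theta> k\<close>, where
  \<open>\<theta> = 2 \<pi> / (b - a)\<close>. They are orthogonal in \<open>L\<^sub>2\<close> and in \<open>H\<^sup>s\<close>, so the span of those
  with \<open>|k\<^sub>1 \<cdots> k\<^sub>d| \<le> N\<close> and all \<open>|k\<^sub>i|\<close> large is a subspace on which the inverse of the embedding has norm at most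
  \<open>(1 + o(1)) (\<theta>\<^sup>d N)\<^sup>s\<close>; this is the lower bound. They are complete in \<open>L\<^sub>2\<close> but not in \<open>H\<^sup>s\<close>, because
  a function in \<open>H\<^sup>s\<close> need not be periodic. In one variable, integrating by parts \<open>s\<close> times
  writes the coefficient of \<open>f\<close> at \<open>k \<noteq> 0\<close> as \<open>(i \<theta> k)\<^sup>-\<^sup>s\<close> times that of \<open>f\<^sup>(\<^sup>s\<^sup>)\<close>, plus boundary
  terms which only involve \<open>s\<close> functionals of \<open>f\<close>. In \<open>d\<close> variables each coordinate carries either the main
  term or a boundary term. Truncating the pure main term to the hyperbolic cross \<open>|k\<^sub>1 \<cdots> k\<^sub>d| \<le> N\<close> has
  error \<open>(\<theta>\<^sup>d N)\<^sup>-\<^sup>s\<close>; the other terms live on crosses of lower dimension, where a much finer truncation costs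
  only \<open>o(N (ln N)\<^sup>d\<^sup>-\<^sup>1)\<close> additional rank. Finally the cross contains \<open>\<sim> 2\<^sup>d N (ln N)\<^sup>d\<^sup>-\<^sup>1 / (d - 1)!\<close>
  frequencies.
\<close>

section \<open>Iterated divisor sums and their leading asymptotics\<close>

section \<open>Counting lattice points in hyperbolic crosses\<close>

text \<open>The limit is sharp, so no constant may be lost in the leading term, while functions in
  \<open>H_mix\<close> are not periodic. The way out is to count rank through functionals rather
  than frequencies. Each pair of a type map \<open>t\<close> and a frequency \<open>\<kappa>\<close>
  contributes one functional, a Fourier coefficient of a mixed derivative, and hence rank one,
  however many exponentials its output function contains. A boundary coordinate uses only frequency
  zero in the functional, and its coefficients O(1/|k|) are square summable, so the output can be
  cut to a finite sum with arbitrarily small error at no cost in rank. The one type with d main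
  coordinates has no boundary factor and gives the exact constant \<open>\<theta>^(-s d)\<close>;
  every other type has at most d - 1 main coordinates, and enlarging its cross by a fixed factor
  \<open>B\<close> only affects a count of lower logarithmic order. The 2^d sign patterns of a
  frequency explain the final constant: inverting the count turns \<open>\<theta>^(-s d)\<close>
  into \<open>(2 / \<theta>)^(s d) / fact (d - 1)^s\<close>, and 2 / \<theta> = (b - a) /
  \<pi>.\<close>

fun div_count :: "nat \<Rightarrow> real \<Rightarrow> real" where
  "div_count 0 x = (if x \<ge> 1 then 1 else 0)"
| "div_count (Suc d) x = (\<Sum>m=1..nat \<lfloor>x\<rfloor>. div_count d (x / real m))"

text \<open>Comparison with the integral of the decreasing function
  \<open>ln (x / u) ^ j / u\<close>, whose antiderivative is \<open>F\<close>; the mean value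
  theorem on short intervals stands in for the integral. The gap \<open>ln x ^ j\<close> between the
  two bounds is one logarithm below the main term.\<close>

lemma sum_ln_power_bounds:
  fixes x :: real
  assumes x: "x \<ge> 1"
  shows "ln x ^ Suc j / real (Suc j) \<le> (\<Sum>m=1..nat \<lfloor>x\<rfloor>. ln (x / real m) ^ j / real m)"
    and "(\<Sum>m=1..nat \<lfloor>x\<rfloor>. ln (x / real m) ^ j / real m) \<le> ln x ^ j + ln x ^ Suc j / real (Suc j)"
proof -
  define g where "g = (\<lambda>u. ln (x / u) ^ j / u)"
  define F where "F = (\<lambda>u. - (ln (x / u) ^ Suc j / real (Suc j)))"
  have F': "(F has_real_derivative g u) (at u)" if "u > 0" for u
  proof -
    have "((\<lambda>u. - ((ln x - ln u) ^ Suc j / real (Suc j))) has_real_derivative (ln x - ln u) ^ j / u) (at u)"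
      using that by (auto intro!: derivative_eq_intros simp del: power_Suc of_nat_Suc)
    moreover have "\<forall>\<^sub>F v in nhds u. - ((ln x - ln v) ^ Suc j / real (Suc j)) = F v"
    proof (rule eventually_mono)
      show "\<forall>\<^sub>F v in nhds u. v \<in> {0<..}" using that by (intro eventually_nhds_in_open) auto
    qed (use x in \<open>simp add: F_def ln_div\<close>)
    ultimately show ?thesis
      using that x by (simp add: g_def ln_div DERIV_cong_ev[OF refl])
  qed
  have anti: "g v \<le> g u" if "1 \<le> u" "u \<le> v" "v \<le> x" for u v
    unfolding g_def using that by (intro frac_le power_mono) (auto simp: field_simps)
  have mvt: "(v - u) * g v \<le> F v - F u" "F v - F u \<le> (v - u) * g u"
    if uv: "1 \<le> u" "u \<le> v" "v \<le> x" for u v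
  proof -
    have "(v - u) * g v \<le> F v - F u \<and> F v - F u \<le> (v - u) * g u"
    proof (cases "u = v")
      case False
      with uv have "u < v" by simp
      then obtain z where z: "z > u" "z < v" "F v - F u = (v - u) * g z"
        using MVT2[of u v F g] F' uv by force
      have "g v \<le> g z" "g z \<le> g u" using anti z uv by auto
      then show ?thesis using z uv by (auto intro!: mult_left_mono)
    qed simp
    then show "(v - u) * g v \<le> F v - F u" "F v - F u \<le> (v - u) * g u" by auto
  qed
  \<comment> \<open>The lower bound carries the surplus \<open>g (real n)\<close>, which later
    absorbs the piece of the integral between n and x.\<close>
  have step: "F (real n) - F 1 + g (real n) \<le> (\<Sum>m=1..n. g (real m)) \<and>
     (\<Sum>m=1..n. g (real m)) \<le> g 1 + F (real n) - F 1" if "1 \<le> n" "real n \<le> x" for n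
    using that
  proof (induction n rule: dec_induct)
    case base then show ?case by simp
  next
    case (step n)
    have "g (real (Suc n)) \<le> F (real (Suc n)) - F (real n)"
         "F (real (Suc n)) - F (real n) \<le> g (real n)"
      using mvt[of "real n" "real (Suc n)"] step by auto
    then show ?case using step by auto
  qed
  define n where "n = nat \<lfloor>x\<rfloor>"
  have n: "1 \<le> n" "real n \<le> x" "x \<le> real n + 1"
    unfolding n_def using x by linarith+
  note st = step[OF n(1,2)]
  have gn: "0 \<le> g (real n)" unfolding g_def using n by (auto intro!: divide_nonneg_nonneg)
  have "F x - F (real n) \<le> (x - real n) * g (real n)" using mvt(2)[of "real n" x] n by auto
  also have "\<dots> \<le> g (real n)" using gn n mult_right_mono[of "x - real n" 1 "g (real n)"] by simp
  finally have a: "F x \<le> F (real n) + g (real n)" by simp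
  have Fx: "F x = 0" "F 1 = - (ln x ^ Suc j / real (Suc j))" "g 1 = ln x ^ j"
    using x by (auto simp: F_def g_def)
  have Fn: "F (real n) \<le> 0" unfolding F_def using n by simp
  show "ln x ^ Suc j / real (Suc j) \<le> (\<Sum>m=1..nat \<lfloor>x\<rfloor>. ln (x / real m) ^ j / real m)"
    "(\<Sum>m=1..nat \<lfloor>x\<rfloor>. ln (x / real m) ^ j / real m) \<le> ln x ^ j + ln x ^ Suc j / real (Suc j)"
    using st a Fx Fn unfolding n_def[symmetric] by (auto simp: g_def)
qed

text \<open>Beyond \<open>X\<close>, where \<open>\<epsilon> * ln x\<close> reaches
  \<open>K\<close>, one extra logarithm beats the factor \<open>K\<close>; below it the left side is
  at most its value at \<open>X\<close>. Terms of lower logarithmic order are swallowed in this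
  way.\<close>

lemma power_absorb:
  fixes K \<epsilon> :: real
  assumes "\<epsilon> > 0" "K \<ge> 0"
  shows "\<exists>C\<ge>0. \<forall>x\<ge>1. K * x * (1 + ln x) ^ d \<le> \<epsilon> * x * (1 + ln x) ^ Suc d + C"
proof -
  define X where "X = exp (K / \<epsilon>)"
  define C where "C = K * X * (1 + ln X) ^ d"
  have X: "X \<ge> 1" "ln X = K / \<epsilon>" using assms by (auto simp: X_def)
  have "C \<ge> 0" unfolding C_def using X assms by (auto intro!: mult_nonneg_nonneg zero_le_power)
  moreover have "K * x * (1 + ln x) ^ d \<le> \<epsilon> * x * (1 + ln x) ^ Suc d + C" if "x \<ge> 1" for x
  proof (cases "x \<le> X")
    case True
    have "K * x * (1 + ln x) ^ d \<le> C"
      unfolding C_def using True that assms X(1) by (intro mult_mono power_mono add_left_mono ln_mono) (auto intro: ln_ge_zero)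
    moreover have "0 \<le> \<epsilon> * x * (1 + ln x) ^ Suc d" using that assms by simp
    ultimately show ?thesis by linarith
  next
    case False
    then have "K / \<epsilon> \<le> ln x" using X that by (metis ln_mono nle_le order_less_le_trans zero_less_one)
    then have "K \<le> \<epsilon> * (1 + ln x)" using assms by (simp add: field_simps)
    then have "K * (x * (1 + ln x) ^ d) \<le> \<epsilon> * (1 + ln x) * (x * (1 + ln x) ^ d)"
      using that by (intro mult_right_mono) auto
    then show ?thesis using \<open>C \<ge> 0\<close> by (simp add: algebra_simps)
  qed
  ultimately show ?thesis by blast
qed

text \<open>\<open>div_count (Suc d) x\<close> counts the (d + 1)-tuples of positive integers with
  product at most x. Summing over one factor m, the main terms at x/m add up to the next main term
  by \<open>sum_ln_power_bounds\<close>, and the errors add up harmonically. An error of \<epsilon>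
  times the leading order plus a constant, with 1 + ln x in place of ln x, makes sense at x = 1 and
  is reproduced by the summation.\<close>

lemma div_count_approx:
  assumes "\<epsilon> > 0"
  shows "\<exists>C\<ge>0. \<forall>x\<ge>1. \<bar>div_count (Suc d) x - x * ln x ^ d / fact d\<bar> \<le> \<epsilon> * x * (1 + ln x) ^ d + C"
  using assms
proof (induction d arbitrary: \<epsilon>)
  case 0
  have "\<bar>div_count (Suc 0) x - x\<bar> \<le> \<epsilon> * x + 1" if "x \<ge> 1" for x
  proof -
    have "div_count (Suc 0) x = (\<Sum>m=1..nat \<lfloor>x\<rfloor>. 1)"
      unfolding div_count.simps by (intro sum.cong) (use that in \<open>auto simp: le_nat_iff le_floor_iff\<close>)
    also have "\<dots> = real (nat \<lfloor>x\<rfloor>)" by simp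
    finally have "\<bar>div_count (Suc 0) x - x\<bar> \<le> 1" using that by linarith
    moreover have "0 \<le> \<epsilon> * x" using 0 that by simp
    ultimately show ?thesis by linarith
  qed
  then show ?case by (intro exI[of _ 1]) auto
next
  case (Suc d)
  \<comment> \<open>Half of \<epsilon> pays for the summed inductive errors, half for a lower order
    term with factor \<open>C + 1\<close>: \<open>C\<close> from at most x constant errors, 1 from
    replacing a sum by an integral.\<close>
  define e where "e = \<epsilon> / 2"
  have e: "e > 0" using Suc.prems by (simp add: e_def)
  obtain C where C: "C \<ge> 0" and
    IH: "\<And>x. x \<ge> 1 \<Longrightarrow> \<bar>div_count (Suc d) x - x * ln x ^ d / fact d\<bar> \<le> e * x * (1 + ln x) ^ d + C"
    using Suc.IH[OF e] by blast
  obtain C' where C': "C' \<ge> 0" and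
    ab: "\<And>x. x \<ge> 1 \<Longrightarrow> (C + 1) * x * (1 + ln x) ^ d \<le> e * x * (1 + ln x) ^ Suc d + C'"
    using power_absorb[of e "C + 1" d] e C by force
  have "\<bar>div_count (Suc (Suc d)) x - x * ln x ^ Suc d / fact (Suc d)\<bar> \<le> \<epsilon> * x * (1 + ln x) ^ Suc d + C'"
    if x: "x \<ge> 1" for x
  proof -
    let ?n = "nat \<lfloor>x\<rfloor>"
    define L where "L = ln x"
    have L: "L \<ge> 0" using x by (simp add: L_def)
    have pow1: "1 \<le> (1 + L) ^ d" using L by (simp add: one_le_power)
    define T where "T = (\<Sum>m=1..?n. x / real m * ln (x / real m) ^ d / fact d)"
    have nx: "real ?n \<le> x" using x by linarith
    have harm: "(\<Sum>m=1..?n. 1 / real m) \<le> 1 + L"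
      using sum_ln_power_bounds(2)[OF x, of 0] by (simp add: L_def)
    have "\<bar>div_count (Suc (Suc d)) x - T\<bar> =
        \<bar>\<Sum>m=1..?n. div_count (Suc d) (x / real m) - x / real m * ln (x / real m) ^ d / fact d\<bar>"
      unfolding T_def by (simp add: sum_subtractf)
    also have "\<dots> \<le> (\<Sum>m=1..?n. \<bar>div_count (Suc d) (x / real m) - x / real m * ln (x / real m) ^ d / fact d\<bar>)"
      by (rule sum_abs)
    also have "\<dots> \<le> (\<Sum>m=1..?n. e * x * (1 + L) ^ d * (1 / real m) + C)"
    proof (rule sum_mono)
      fix m assume "m \<in> {1..?n}"
      then have m: "1 \<le> m" "real m \<le> x" using nx by auto
      have "\<bar>div_count (Suc d) (x / real m) - x / real m * ln (x / real m) ^ d / fact d\<bar>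
         \<le> e * (x / real m) * (1 + ln (x / real m)) ^ d + C"
        using m by (intro IH) auto
      also have "\<dots> \<le> e * (x / real m) * (1 + L) ^ d + C"
        using m e x by (intro add_right_mono mult_left_mono power_mono) (auto simp: L_def ln_div)
      finally show "\<bar>div_count (Suc d) (x / real m) - x / real m * ln (x / real m) ^ d / fact d\<bar>
         \<le> e * x * (1 + L) ^ d * (1 / real m) + C" by (simp add: mult_ac)
    qed
    also have "\<dots> = e * x * (1 + L) ^ d * (\<Sum>m=1..?n. 1 / real m) + real ?n * C"
      by (simp add: sum.distrib sum_distrib_left)
    also have "\<dots> \<le> e * x * (1 + L) ^ d * (1 + L) + x * C"
      using harm nx C e x L by (intro add_mono mult_left_mono mult_right_mono) auto
    finally have 1: "\<bar>div_count (Suc (Suc d)) x - T\<bar> \<le> e * x * (1 + L) ^ Suc d + x * C"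
      by (simp add: mult_ac)
    have T: "T = x / fact d * (\<Sum>m=1..?n. ln (x / real m) ^ d / real m)"
      unfolding T_def by (simp add: sum_distrib_left mult_ac)
    have f: "x * L ^ Suc d / fact (Suc d) = x / fact d * (L ^ Suc d / real (Suc d))"
      by (simp add: field_simps)
    have "\<bar>T - x * L ^ Suc d / fact (Suc d)\<bar> =
       x / fact d * \<bar>(\<Sum>m=1..?n. ln (x / real m) ^ d / real m) - L ^ Suc d / real (Suc d)\<bar>"
      unfolding T f right_diff_distrib[symmetric] abs_mult using x by simp
    also have "\<dots> \<le> x / fact d * L ^ d"
      using sum_ln_power_bounds[OF x, of d] x by (intro mult_left_mono) (auto simp: L_def)
    also have "\<dots> \<le> x / 1 * (1 + L) ^ d"
      using x L by (intro mult_mono divide_left_mono power_mono) (auto simp: fact_ge_1)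
    finally have 2: "\<bar>T - x * L ^ Suc d / fact (Suc d)\<bar> \<le> x * (1 + L) ^ d" by simp
    have 3: "x * C \<le> C * x * (1 + L) ^ d" using pow1 C x
      by (metis mult.commute mult.right_neutral mult_left_mono mult_nonneg_nonneg order_trans zero_le_one)
    have "\<bar>div_count (Suc (Suc d)) x - x * L ^ Suc d / fact (Suc d)\<bar> \<le>
      e * x * (1 + L) ^ Suc d + (C + 1) * x * (1 + L) ^ d"
      using 1 2 3 by (simp add: algebra_simps)
    also have "\<dots> \<le> e * x * (1 + L) ^ Suc d + (e * x * (1 + L) ^ Suc d + C')"
      using ab[OF x] by (simp add: L_def)
    also have "\<dots> = \<epsilon> * x * (1 + L) ^ Suc d + C'" by (simp add: e_def field_simps)
    finally show ?thesis by (simp add: L_def)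
  qed
  then show ?case using C' by blast
qed

lemma div_count_asymptotic:
  "((\<lambda>x. div_count (Suc d) x / (x * ln x ^ d)) \<longlongrightarrow> 1 / fact d) at_top"
proof (rule tendstoI)
  fix e :: real assume e: "e > 0"
  \<comment> \<open>Replacing \<open>1 + ln x\<close> by \<open>2 * ln x\<close> for x \<ge> e costs
    a factor 2^d, compensated here in advance.\<close>
  define \<epsilon> where "\<epsilon> = e / 2 / 2 ^ d"
  have "\<epsilon> > 0" using e by (simp add: \<epsilon>_def)
  then obtain C where C: "C \<ge> 0" and
    ap: "\<And>x. x \<ge> 1 \<Longrightarrow> \<bar>div_count (Suc d) x - x * ln x ^ d / fact d\<bar> \<le> \<epsilon> * x * (1 + ln x) ^ d + C"
    using div_count_approx by blast
  have "\<forall>\<^sub>F x in at_top. x > max 3 (2 * C / e) \<and> x \<ge> exp 1"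
    by (intro eventually_conj eventually_gt_at_top eventually_ge_at_top)
  then show "\<forall>\<^sub>F x in at_top. dist (div_count (Suc d) x / (x * ln x ^ d)) (1 / fact d) < e"
  proof eventually_elim
    case (elim x)
    then have x: "x > 3" "x > 2 * C / e" and L: "ln x \<ge> 1"
      by (auto simp: ln_ge_iff)
    have Ld: "1 \<le> ln x ^ d" using L by (rule one_le_power)
    have pos: "0 < x * ln x ^ d" using x Ld by auto
    have "dist (div_count (Suc d) x / (x * ln x ^ d)) (1 / fact d) =
       \<bar>div_count (Suc d) x - x * ln x ^ d / fact d\<bar> / (x * ln x ^ d)"
    proof -
      have "div_count (Suc d) x / (x * ln x ^ d) - 1 / fact d =
        (div_count (Suc d) x - x * ln x ^ d / fact d) / (x * ln x ^ d)"
      proof -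
        have "x * ln x ^ d / fact d / (x * ln x ^ d) = 1 / fact d" using pos by (metis divide_divide_eq_left' divide_self less_irrefl divide_divide_eq_left)
        then show ?thesis by (simp only: diff_divide_distrib)
      qed
      then show ?thesis using pos by (simp add: dist_real_def abs_divide del: div_count.simps)
    qed
    also have "\<dots> \<le> (\<epsilon> * x * (2 * ln x) ^ d + C) / (x * ln x ^ d)"
    proof (rule divide_right_mono)
      have "\<bar>div_count (Suc d) x - x * ln x ^ d / fact d\<bar> \<le> \<epsilon> * x * (1 + ln x) ^ d + C"
        using ap x by simp
      also have "\<dots> \<le> \<epsilon> * x * (2 * ln x) ^ d + C"
        using \<open>\<epsilon> > 0\<close> x L by (intro add_right_mono mult_left_mono power_mono) auto
      finally show "\<bar>div_count (Suc d) x - x * ln x ^ d / fact d\<bar> \<le> \<epsilon> * x * (2 * ln x) ^ d + C" .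
    qed (use pos in auto)
    also have "\<dots> = e / 2 + C / (x * ln x ^ d)"
    proof -
      have "\<epsilon> * x * (2 * ln x) ^ d = e / 2 * (x * ln x ^ d)"
        by (simp add: \<epsilon>_def power_mult_distrib)
      then have "\<epsilon> * x * (2 * ln x) ^ d / (x * ln x ^ d) = e / 2"
        using pos by (metis less_irrefl nonzero_mult_div_cancel_right)
      then show ?thesis by (simp only: add_divide_distrib)
    qed
    also have "C / (x * ln x ^ d) \<le> C / x"
      using C Ld x pos by (intro divide_left_mono) auto
    also have "C / x < e / 2" using x e by (simp add: field_simps)
    finally show ?case by simp
  qed
qed

lemma div_count_nonneg: "0 \<le> div_count d x"
  by (induction d arbitrary: x) (auto intro: sum_nonneg)

lemma div_count_Suc_ge: "div_count d x \<le> div_count (Suc d) x"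
proof (cases "x \<ge> 1")
  case True
  then have "1 \<in> {1..nat \<lfloor>x\<rfloor>}" by (auto simp: le_nat_floor)
  then have "div_count d (x / real 1) \<le> (\<Sum>m=1..nat \<lfloor>x\<rfloor>. div_count d (x / real m))"
    by (intro member_le_sum) (auto simp: div_count_nonneg)
  then show ?thesis by simp
next
  case False
  then have "div_count d x = 0" by (cases d) auto
  then show ?thesis using div_count_nonneg by metis
qed

lemma div_count_mono: "d \<le> e \<Longrightarrow> div_count d x \<le> div_count e x"
  by (induction rule: dec_induct) (auto intro: order_trans[OF _ div_count_Suc_ge] simp del: div_count.simps)

text \<open>The true order is \<open>x * ln x ^ (d - 1)\<close> for d > 0, one logarithm less than
  the normalisation, and a constant for d = 0. Crosses of lower dimension are negligible for this
  reason.\<close>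

lemma div_count_lower_order:
  "((\<lambda>x. div_count d x / (x * ln x ^ d)) \<longlongrightarrow> 0) at_top"
proof (cases d)
  case 0
  have "((\<lambda>x::real. 1 / x) \<longlongrightarrow> 0) at_top"
    by (intro tendsto_divide_0[OF tendsto_const] filterlim_at_top_imp_at_infinity filterlim_ident)
  moreover have "\<forall>\<^sub>F x in at_top. 1 / x = div_count d x / (x * ln x ^ d)"
    using eventually_ge_at_top[of 1] by eventually_elim (simp add: 0)
  ultimately show ?thesis using tendsto_cong by fastforce
next
  case (Suc c)
  have "((\<lambda>x. div_count (Suc c) x / (x * ln x ^ c) * (1 / ln x)) \<longlongrightarrow> 1 / fact c * 0) at_top"
    by (intro tendsto_mult div_count_asymptotic tendsto_divide_0[OF tendsto_const]
          filterlim_at_top_imp_at_infinity ln_at_top)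
  then show ?thesis by (simp add: Suc mult_ac del: div_count.simps)
qed

section \<open>Hyperbolic crosses and their cardinality\<close>

definition hyp_cross :: "'n set \<Rightarrow> real \<Rightarrow> ('n \<Rightarrow> int) set" where
  "hyp_cross S x = {k. (\<forall>i\<in>S. k i \<noteq> 0) \<and> (\<forall>i. i \<notin> S \<longrightarrow> k i = 0) \<and> (\<Prod>i\<in>S. real_of_int \<bar>k i\<bar>) \<le> x}"

text \<open>Coordinates outside \<open>S\<close> are fixed to 0, so crosses of all dimensions live
  in one type and a slice is an update at \<open>j\<close>.\<close>

lemma hyp_cross_insert:
  assumes "finite S" "j \<notin> S"
  shows "hyp_cross (insert j S) x =
    (\<Union>m\<in>{m::int. m \<noteq> 0 \<and> \<bar>m\<bar> \<le> \<lfloor>x\<rfloor>}. (\<lambda>k. k(j := m)) ` hyp_cross S (x / real_of_int \<bar>m\<bar>))"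
proof (intro equalityI subsetI)
  fix k assume k: "k \<in> hyp_cross (insert j S) x"
  define m where "m = k j"
  define k' where "k' = k(j := 0)"
  have m0: "m \<noteq> 0" and nz: "\<And>i. i \<in> S \<Longrightarrow> k i \<noteq> 0" using k by (auto simp: hyp_cross_def m_def)
  have pr: "(\<Prod>i\<in>S. real_of_int \<bar>k' i\<bar>) = (\<Prod>i\<in>S. real_of_int \<bar>k i\<bar>)"
    using assms by (intro prod.cong) (auto simp: k'_def)
  have le: "real_of_int \<bar>m\<bar> * (\<Prod>i\<in>S. real_of_int \<bar>k i\<bar>) \<le> x"
    using k assms by (auto simp: hyp_cross_def m_def)
  \<comment> \<open>Nonzero integers have modulus at least 1, so the remaining product cannot
    compensate a large \<open>m\<close>.\<close>
  have ge1: "1 \<le> (\<Prod>i\<in>S. real_of_int \<bar>k i\<bar>)"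
    using nz by (intro prod_ge_1) force
  have "real_of_int \<bar>m\<bar> * 1 \<le> real_of_int \<bar>m\<bar> * (\<Prod>i\<in>S. real_of_int \<bar>k i\<bar>)"
    using ge1 by (intro mult_left_mono) auto
  then have "real_of_int \<bar>m\<bar> \<le> x" using le by linarith
  then have ml: "\<bar>m\<bar> \<le> \<lfloor>x\<rfloor>" by (simp add: le_floor_iff)
  have "k' \<in> hyp_cross S (x / real_of_int \<bar>m\<bar>)"
  proof -
    have "(\<Prod>i\<in>S. real_of_int \<bar>k' i\<bar>) \<le> x / real_of_int \<bar>m\<bar>"
      unfolding pr using le m0 by (simp add: field_simps)
    moreover have "\<forall>i\<in>S. k' i \<noteq> 0" "\<forall>i. i \<notin> S \<longrightarrow> k' i = 0"
      using k assms by (auto simp: hyp_cross_def k'_def)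
    ultimately show ?thesis by (simp add: hyp_cross_def)
  qed
  moreover have "k = k'(j := m)" by (auto simp: k'_def m_def)
  ultimately show "k \<in> (\<Union>m\<in>{m::int. m \<noteq> 0 \<and> \<bar>m\<bar> \<le> \<lfloor>x\<rfloor>}. (\<lambda>k. k(j := m)) ` hyp_cross S (x / real_of_int \<bar>m\<bar>))"
    using m0 ml by blast
next
  fix k assume "k \<in> (\<Union>m\<in>{m::int. m \<noteq> 0 \<and> \<bar>m\<bar> \<le> \<lfloor>x\<rfloor>}. (\<lambda>k. k(j := m)) ` hyp_cross S (x / real_of_int \<bar>m\<bar>))"
  then obtain m k' where m: "m \<noteq> 0" "\<bar>m\<bar> \<le> \<lfloor>x\<rfloor>" and k': "k' \<in> hyp_cross S (x / real_of_int \<bar>m\<bar>)"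
    and k: "k = k'(j := m)" by blast
  have pr: "(\<Prod>i\<in>S. real_of_int \<bar>k i\<bar>) = (\<Prod>i\<in>S. real_of_int \<bar>k' i\<bar>)"
    using assms by (intro prod.cong) (auto simp: k)
  have "(\<Prod>i\<in>S. real_of_int \<bar>k' i\<bar>) \<le> x / real_of_int \<bar>m\<bar>" using k' by (auto simp: hyp_cross_def)
  then have "real_of_int \<bar>m\<bar> * (\<Prod>i\<in>S. real_of_int \<bar>k' i\<bar>) \<le> x" using m by (simp add: field_simps)
  moreover have "(\<Prod>i\<in>insert j S. real_of_int \<bar>k i\<bar>) = real_of_int \<bar>m\<bar> * (\<Prod>i\<in>S. real_of_int \<bar>k' i\<bar>)"
    using assms by (simp only: prod.insert[OF assms] pr) (simp add: k)
  ultimately have "(\<Prod>i\<in>insert j S. real_of_int \<bar>k i\<bar>) \<le> x" by simp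
  then show "k \<in> hyp_cross (insert j S) x"
    using k' m unfolding hyp_cross_def k by auto
qed

text \<open>Slicing along one coordinate reproduces the recursion of \<open>div_count\<close>; each
  modulus |m| occurs with two signs, which gives the power of 2.\<close>

lemma hyp_cross_card:
  fixes S :: "'n set"
  assumes "finite S"
  shows "finite (hyp_cross S x) \<and> real (card (hyp_cross S x)) = 2 ^ card S * div_count (card S) x"
  using assms
proof (induction S arbitrary: x rule: finite_induct)
  case empty
  have "hyp_cross ({} :: 'n set) x = (if x \<ge> 1 then {\<lambda>_. 0} else {})"
    by (auto simp: hyp_cross_def)
  then show ?case by (cases "x \<ge> 1") simp_all
next
  case (insert j S)
  define M where "M = {m::int. m \<noteq> 0 \<and> \<bar>m\<bar> \<le> \<lfloor>x\<rfloor>}"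
  define n where "n = nat \<lfloor>x\<rfloor>"
  have M: "M = int ` {1..n} \<union> (\<lambda>i. - int i) ` {1..n}"
  proof (intro equalityI subsetI)
    fix m assume m: "m \<in> M"
    then have "nat \<bar>m\<bar> \<in> {1..n}" by (auto simp: M_def n_def)
    moreover have "m = int (nat \<bar>m\<bar>) \<or> m = - int (nat \<bar>m\<bar>)" by auto
    ultimately show "m \<in> int ` {1..n} \<union> (\<lambda>i. - int i) ` {1..n}" by blast
  qed (auto simp: M_def n_def)
  have finM: "finite M" unfolding M by simp
  have inj: "inj_on (\<lambda>k. k(j := m)) (hyp_cross S y)" for m y
  proof (rule inj_onI)
    fix k k' assume kk: "k \<in> hyp_cross S y" "k' \<in> hyp_cross S y" "k(j := m) = k'(j := m)"
    have "k j = 0" "k' j = 0" using kk insert.hyps by (auto simp: hyp_cross_def)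
    then show "k = k'" using kk(3) by (metis fun_upd_triv fun_upd_upd)
  qed
  have un: "hyp_cross (insert j S) x =
    (\<Union>m\<in>M. (\<lambda>k. k(j := m)) ` hyp_cross S (x / real_of_int \<bar>m\<bar>))"
    unfolding M_def using insert.hyps by (rule hyp_cross_insert)
  have fin: "finite (hyp_cross (insert j S) x)"
    unfolding un using finM insert.IH by blast
  have "card (hyp_cross (insert j S) x) = (\<Sum>m\<in>M. card ((\<lambda>k. k(j := m)) ` hyp_cross S (x / real_of_int \<bar>m\<bar>)))"
    unfolding un
  proof (rule card_UN_disjoint)
    show "\<forall>m\<in>M. \<forall>m'\<in>M. m \<noteq> m' \<longrightarrow> (\<lambda>k. k(j := m)) ` hyp_cross S (x / real_of_int \<bar>m\<bar>) \<inter>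
       (\<lambda>k. k(j := m')) ` hyp_cross S (x / real_of_int \<bar>m'\<bar>) = {}"
      by (auto dest: fun_cong[where x = j])
  qed (use finM insert.IH in auto)
  then have "real (card (hyp_cross (insert j S) x)) = (\<Sum>m\<in>M. real (card (hyp_cross S (x / real_of_int \<bar>m\<bar>))))"
    by (simp add: card_image[OF inj])
  also have "\<dots> = (\<Sum>m\<in>M. 2 ^ card S * div_count (card S) (x / real_of_int \<bar>m\<bar>))"
    using insert.IH by simp
  also have "\<dots> = 2 ^ card S * (\<Sum>m\<in>M. div_count (card S) (x / real_of_int \<bar>m\<bar>))"
    by (simp add: sum_distrib_left)
  also have "(\<Sum>m\<in>M. div_count (card S) (x / real_of_int \<bar>m\<bar>)) =
     (\<Sum>m\<in>int ` {1..n}. div_count (card S) (x / real_of_int \<bar>m\<bar>)) +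
     (\<Sum>m\<in>(\<lambda>i. - int i) ` {1..n}. div_count (card S) (x / real_of_int \<bar>m\<bar>))"
    unfolding M by (rule sum.union_disjoint) auto
  also have "\<dots> = 2 * (\<Sum>m=1..n. div_count (card S) (x / real m))"
    by (subst (1 2) sum.reindex) (auto simp: inj_on_def)
  finally show ?case using fin insert.hyps by (simp add: n_def)
qed

section \<open>Inverting the count along n / (ln n)^e\<close>

definition log_scale :: "nat \<Rightarrow> nat \<Rightarrow> real" where
  "log_scale e n = real n / ln (real n) ^ e"

lemma ln_real_at_top: "filterlim (\<lambda>n. ln (real n)) at_top sequentially"
  by (rule filterlim_compose[OF ln_at_top filterlim_real_sequentially])

lemma log_scale_pos: "n \<ge> 3 \<Longrightarrow> log_scale e n > 0"
  by (simp add: log_scale_def)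

text \<open>ln (ln n) is negligible against ln n, so passing from n to
  \<open>c * log_scale e n\<close> does not change the logarithm to first order. The inversion of
  the count rests on this.\<close>

lemma ln_log_scale_ratio:
  assumes c: "c > 0"
  shows "(\<lambda>n. ln (c * log_scale e n) / ln (real n)) \<longlonglongrightarrow> 1"
proof -
  have l0: "(\<lambda>n. K / ln (real n)) \<longlonglongrightarrow> 0" for K
    by (rule tendsto_divide_0[OF tendsto_const filterlim_at_top_imp_at_infinity[OF ln_real_at_top]])
  have ll: "(\<lambda>n. ln (ln (real n)) / ln (real n)) \<longlonglongrightarrow> 0"
    by (rule filterlim_compose[OF ln_x_over_x_tendsto_0 ln_real_at_top])
  have "(\<lambda>n. ln c / ln (real n) + 1 - real e * (ln (ln (real n)) / ln (real n))) \<longlonglongrightarrow> 0 + 1 - real e * 0"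
    by (intro tendsto_intros l0 ll)
  moreover have "\<forall>\<^sub>F n in sequentially. ln c / ln (real n) + 1 - real e * (ln (ln (real n)) / ln (real n)) =
     ln (c * log_scale e n) / ln (real n)"
    using eventually_ge_at_top[of 3]
  proof eventually_elim
    case (elim n)
    then have l: "ln (real n) > 0" by simp
    have "ln (c * log_scale e n) = ln c + (ln (real n) - real e * ln (ln (real n)))"
      using elim c l by (simp add: log_scale_def ln_mult ln_div ln_realpow)
    then show ?case using l by (simp add: add_divide_distrib diff_divide_distrib)
  qed
  ultimately show ?thesis using Lim_transform_eventually by force
qed

text \<open>Divergence is read off from the logarithm, which behaves like ln n.\<close>

lemma log_scale_at_top:
  assumes c: "c > 0"
  shows "filterlim (\<lambda>n. c * log_scale e n) at_top sequentially"
proof -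
  have "filterlim (\<lambda>n. ln (c * log_scale e n) / ln (real n) * ln (real n)) at_top sequentially"
    by (rule filterlim_tendsto_pos_mult_at_top[OF ln_log_scale_ratio[OF c] zero_less_one ln_real_at_top])
  then have "filterlim (\<lambda>n. exp (ln (c * log_scale e n) / ln (real n) * ln (real n))) at_top sequentially"
    by (rule filterlim_compose[OF exp_at_top])
  moreover have "\<forall>\<^sub>F n in sequentially. exp (ln (c * log_scale e n) / ln (real n) * ln (real n)) = c * log_scale e n"
    using eventually_ge_at_top[of 3]
  proof eventually_elim
    case (elim n)
    then have "ln (real n) > 0" by simp
    then show ?case using c log_scale_pos[OF elim, of e] by simp
  qed
  ultimately show ?thesis using filterlim_cong[OF refl refl] by force
qed

lemma log_scale_normalised:
  assumes c: "c > 0"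
  shows "(\<lambda>n. (c * log_scale e n) * ln (c * log_scale e n) ^ e / real n) \<longlonglongrightarrow> c"
proof -
  have "(\<lambda>n. c * (ln (c * log_scale e n) / ln (real n)) ^ e) \<longlonglongrightarrow> c * 1 ^ e"
    by (intro tendsto_intros ln_log_scale_ratio c)
  moreover have "\<forall>\<^sub>F n in sequentially. c * (ln (c * log_scale e n) / ln (real n)) ^ e =
    (c * log_scale e n) * ln (c * log_scale e n) ^ e / real n"
    using eventually_ge_at_top[of 3] by eventually_elim (simp add: log_scale_def power_divide)
  ultimately show ?thesis using Lim_transform_eventually by force
qed

text \<open>Transfers asymptotics in the size x of a cross to asymptotics in n by the substitution x
  = c n / (ln n)^e.\<close>

lemma count_along_log_scale:
  assumes c: "c > 0" and g: "((\<lambda>x. g x / (x * ln x ^ e)) \<longlongrightarrow> l) at_top"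
  shows "(\<lambda>n. g (c * log_scale e n) / real n) \<longlonglongrightarrow> l * c"
proof -
  let ?N = "\<lambda>n. c * log_scale e n"
  have "(\<lambda>n. g (?N n) / (?N n * ln (?N n) ^ e) * (?N n * ln (?N n) ^ e / real n)) \<longlonglongrightarrow> l * c"
    by (intro tendsto_mult log_scale_normalised c filterlim_compose[OF g log_scale_at_top])
  moreover have "\<forall>\<^sub>F n in sequentially. g (?N n) / (?N n * ln (?N n) ^ e) * (?N n * ln (?N n) ^ e / real n) = g (?N n) / real n"
  proof -
    have "\<forall>\<^sub>F n in sequentially. ?N n > 1"
      using log_scale_at_top[OF c, of e] by (rule filterlim_at_top_dense[THEN iffD1, rule_format])
    then show ?thesis
    proof eventually_elim
      case (elim n)
      then have "?N n > 0" by linarith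
      moreover have "ln (?N n) ^ e > 0" by (intro zero_less_power ln_gt_zero elim)
      ultimately have nz: "?N n * ln (?N n) ^ e \<noteq> 0" by (metis mult_pos_pos less_irrefl)
      have "x / y * (y / z) = x / z" if "y \<noteq> 0" for x y z :: real using that by simp
      from this[OF nz] show ?case .
    qed
  qed
  ultimately show ?thesis by (rule Lim_transform_eventually)
qed

text \<open>Inverts the counting asymptotics with \<open>e = d - 1\<close>: the cross of \<open>n\<close> frequencies has size
  \<open>N \<sim> (d - 1)! n / (2\<^sup>d (ln n)\<^sup>d\<^sup>-\<^sup>1)\<close>.\<close>

lemma limit_from_counting_bounds:
  fixes A :: "nat \<Rightarrow> real"
  assumes G: "G > 0"
    and upper: "\<And>\<epsilon>. \<epsilon> > 0 \<Longrightarrow> \<exists>B\<ge>1. \<exists>C. \<forall>N>0. \<forall>n.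
      2 ^ Suc e * div_count (Suc e) N + C * div_count e (B * N) < real n \<longrightarrow> A n \<le> (G + \<epsilon>) / N ^ s"
    and lower: "\<And>\<eta>. \<eta> > 0 \<Longrightarrow> \<exists>C. \<forall>N>0. \<forall>n\<ge>1.
      real n \<le> 2 ^ Suc e * div_count (Suc e) N - C * div_count e N \<longrightarrow> G / ((1 + \<eta>) ^ Suc e * N ^ s) \<le> A n"
  shows "(\<lambda>n. A n * log_scale e n ^ s) \<longlonglongrightarrow> G * (2 ^ Suc e / fact e) ^ s"
proof -
  \<comment> \<open>With \<open>N = c0 * log_scale e n\<close> the full cross has asymptotically n
    elements.\<close>
  define c0 where "c0 = fact e / (2::real) ^ Suc e"
  have c0: "c0 > 0" by (simp add: c0_def)
  have V: "G * (2 ^ Suc e / fact e) ^ s = G / c0 ^ s" by (simp add: c0_def power_divide)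
  have cnt: "(\<lambda>n. 2 ^ Suc e * (div_count (Suc e) (c * log_scale e n) / real n)) \<longlonglongrightarrow> c / c0" if "c > 0" for c
  proof -
    have "(\<lambda>n. 2 ^ Suc e * (div_count (Suc e) (c * log_scale e n) / real n)) \<longlonglongrightarrow> 2 ^ Suc e * (1 / fact e * c)"
      by (intro tendsto_mult tendsto_const count_along_log_scale that div_count_asymptotic)
    moreover have "2 ^ Suc e * (1 / fact e * c) = c / c0" by (simp add: c0_def)
    ultimately show ?thesis by (simp only:)
  qed
  have low: "(\<lambda>n. C * (div_count e (c * log_scale e n) / real n)) \<longlonglongrightarrow> 0" if "c > 0" for c C
    using tendsto_mult[OF tendsto_const count_along_log_scale[OF that div_count_lower_order]] by force
  show ?thesis
  proof (rule order_tendstoI)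
    fix u assume u: "G * (2 ^ Suc e / fact e) ^ s < u"
    \<comment> \<open>One \<delta> serves both as the additive tolerance and as the relative
      shrinking of the cross; letting it tend to 0 recovers the target.\<close>
    have "((\<lambda>\<delta>. (G + \<delta>) / ((1 - \<delta>) * c0) ^ s) \<longlongrightarrow> (G + 0) / ((1 - 0) * c0) ^ s) (at_right 0)"
      using c0 by (intro tendsto_intros) auto
    then have "\<forall>\<^sub>F \<delta> in at_right 0. (G + \<delta>) / ((1 - \<delta>) * c0) ^ s < u"
      using u unfolding V by (intro order_tendstoD) auto
    moreover have "\<forall>\<^sub>F \<delta> in at_right 0. (0::real) < \<delta> \<and> \<delta> < 1"
      by (auto simp: eventually_at_right_field intro!: exI[of _ 1])
    ultimately have "\<forall>\<^sub>F \<delta> in at_right 0. (G + \<delta>) / ((1 - \<delta>) * c0) ^ s < u \<and> 0 < \<delta> \<and> \<delta> < 1"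
      by eventually_elim simp
    then obtain \<delta> where \<delta>: "(G + \<delta>) / ((1 - \<delta>) * c0) ^ s < u" "0 < \<delta>" "\<delta> < 1"
      using eventually_happens[of _ "at_right (0::real)"] by (auto simp: trivial_limit_at_right_real)
    obtain B C where B: "B \<ge> 1" and BC: "\<And>N n. N > 0 \<Longrightarrow>
      2 ^ Suc e * div_count (Suc e) N + C * div_count e (B * N) < real n \<Longrightarrow> A n \<le> (G + \<delta>) / N ^ s"
      using upper[OF \<delta>(2)] by blast
    \<comment> \<open>The cross fills the proportion 1 - \<delta> of n; the lower order count
      vanishes relative to n, so the rank condition holds eventually.\<close>
    define c where "c = (1 - \<delta>) * c0"
    have c: "c > 0" using \<delta> c0 by (simp add: c_def)
    have "(\<lambda>n. 2 ^ Suc e * (div_count (Suc e) (c * log_scale e n) / real n) + C * (div_count e ((B * c) * log_scale e n) / real n)) \<longlonglongrightarrow> c / c0 + 0"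
      using c B by (intro tendsto_add cnt low) auto
    moreover have "c / c0 + 0 < 1" using c0 \<delta> by (simp add: c_def)
    ultimately have "\<forall>\<^sub>F n in sequentially. 2 ^ Suc e * (div_count (Suc e) (c * log_scale e n) / real n) + C * (div_count e ((B * c) * log_scale e n) / real n) < 1"
      by (rule order_tendstoD)
    then show "\<forall>\<^sub>F n in sequentially. A n * log_scale e n ^ s < u"
      using eventually_ge_at_top[of 3]
    proof eventually_elim
      case (elim n)
      have n0: "real n > 0" and sc: "log_scale e n > 0" using elim log_scale_pos by auto
      have "(2 ^ Suc e * div_count (Suc e) (c * log_scale e n) + C * div_count e (B * (c * log_scale e n))) / real n < 1"
        using elim(1) by (simp only: add_divide_distrib times_divide_eq_right mult.assoc)
      then have "2 ^ Suc e * div_count (Suc e) (c * log_scale e n) + C * div_count e (B * (c * log_scale e n)) < real n"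
        using pos_divide_less_eq[OF n0, THEN iffD1] by (metis mult_1)
      then have "A n \<le> (G + \<delta>) / (c * log_scale e n) ^ s" using c sc by (intro BC) auto
      then have "A n * log_scale e n ^ s \<le> (G + \<delta>) / (c * log_scale e n) ^ s * log_scale e n ^ s"
        using sc by (intro mult_right_mono) auto
      also have "\<dots> = (G + \<delta>) / c ^ s" using sc by (simp add: power_mult_distrib)
      also have "\<dots> < u" using \<delta>(1) by (simp only: c_def)
      finally show ?case .
    qed
  next
    fix u assume u: "u < G * (2 ^ Suc e / fact e) ^ s"
    have "((\<lambda>\<delta>. G / ((1 + \<delta>) ^ Suc e * ((1 + \<delta>) * c0) ^ s)) \<longlongrightarrow> G / ((1 + 0) ^ Suc e * ((1 + 0) * c0) ^ s)) (at_right 0)"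
      using c0 by (intro tendsto_intros) auto
    then have "\<forall>\<^sub>F \<delta> in at_right 0. u < G / ((1 + \<delta>) ^ Suc e * ((1 + \<delta>) * c0) ^ s)"
      using u unfolding V by (intro order_tendstoD) auto
    moreover have "\<forall>\<^sub>F \<delta> in at_right 0. (0::real) < \<delta>"
      by (auto simp: eventually_at_right_field intro!: exI[of _ 1])
    ultimately have "\<forall>\<^sub>F \<delta> in at_right 0. u < G / ((1 + \<delta>) ^ Suc e * ((1 + \<delta>) * c0) ^ s) \<and> 0 < \<delta>"
      by eventually_elim simp
    then obtain \<delta> where \<delta>: "u < G / ((1 + \<delta>) ^ Suc e * ((1 + \<delta>) * c0) ^ s)" "0 < \<delta>"
      using eventually_happens[of _ "at_right (0::real)"] by (auto simp: trivial_limit_at_right_real)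
    obtain C where C: "\<And>N n. N > 0 \<Longrightarrow> n \<ge> 1 \<Longrightarrow>
      real n \<le> 2 ^ Suc e * div_count (Suc e) N - C * div_count e N \<Longrightarrow> G / ((1 + \<delta>) ^ Suc e * N ^ s) \<le> A n"
      using lower[OF \<delta>(2)] by blast
    \<comment> \<open>The cross is enlarged to the proportion 1 + \<delta>, so that it still has n
      elements after the removal of a lower order number.\<close>
    define c where "c = (1 + \<delta>) * c0"
    have c: "c > 0" using \<delta> c0 by (simp add: c_def)
    have "(\<lambda>n. 2 ^ Suc e * (div_count (Suc e) (c * log_scale e n) / real n) - C * (div_count e (c * log_scale e n) / real n)) \<longlonglongrightarrow> c / c0 - 0"
      using c by (intro tendsto_diff cnt low) auto
    moreover have "1 < c / c0 - 0" using c0 \<delta> by (simp add: c_def)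
    ultimately have "\<forall>\<^sub>F n in sequentially. 1 < 2 ^ Suc e * (div_count (Suc e) (c * log_scale e n) / real n) - C * (div_count e (c * log_scale e n) / real n)"
      by (rule order_tendstoD)
    then show "\<forall>\<^sub>F n in sequentially. u < A n * log_scale e n ^ s"
      using eventually_ge_at_top[of 3]
    proof eventually_elim
      case (elim n)
      have n0: "real n > 0" and sc: "log_scale e n > 0" using elim log_scale_pos by auto
      have "1 < (2 ^ Suc e * div_count (Suc e) (c * log_scale e n) - C * div_count e (c * log_scale e n)) / real n"
        using elim(1) by (simp only: diff_divide_distrib times_divide_eq_right)
      then have "real n \<le> 2 ^ Suc e * div_count (Suc e) (c * log_scale e n) - C * div_count e (c * log_scale e n)"
        using pos_less_divide_eq[OF n0, THEN iffD1] by (metis less_imp_le mult_1)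
      then have "G / ((1 + \<delta>) ^ Suc e * (c * log_scale e n) ^ s) \<le> A n" using c sc elim by (intro C) auto
      then have "G / ((1 + \<delta>) ^ Suc e * (c * log_scale e n) ^ s) * log_scale e n ^ s \<le> A n * log_scale e n ^ s"
        using sc by (intro mult_right_mono) auto
      moreover have "G / ((1 + \<delta>) ^ Suc e * (c * log_scale e n) ^ s) * log_scale e n ^ s = G / ((1 + \<delta>) ^ Suc e * c ^ s)"
        using sc by (simp add: power_mult_distrib)
      ultimately show ?case using \<delta>(1) by (simp only: c_def)
    qed
  qed
qed

section \<open>Geometry of L2: Cauchy-Schwarz, orthonormal expansions, Bessel\<close>

section \<open>Square integrable functions\<close>

lemma borel_measurable_cnj [measurable (raw)]:
  "f \<in> borel_measurable M \<Longrightarrow> (\<lambda>x. cnj (f x)) \<in> borel_measurable M"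
  by (rule borel_measurable_continuous_onI[THEN measurable_compose_rev, unfolded comp_def]) (auto intro: continuous_intros)

lemma L2_space_mult_integrable:
  assumes "f \<in> L2_space M" "g \<in> L2_space M"
  shows "integrable M (\<lambda>x. f x * g x)"
proof (rule Bochner_Integration.integrable_bound)
  show "integrable M (\<lambda>x. (norm (f x))\<^sup>2 + (norm (g x))\<^sup>2)"
    using assms by (auto simp: L2_space_def)
  show "(\<lambda>x. f x * g x) \<in> borel_measurable M" using assms by (auto simp: L2_space_def)
  have "u * v \<le> u\<^sup>2 + v\<^sup>2" if "0 \<le> u" "0 \<le> v" for u v :: real
    using sum_squares_bound[of u v] mult_nonneg_nonneg[OF that] by linarith
  then show "AE x in M. norm (f x * g x) \<le> norm ((norm (f x))\<^sup>2 + (norm (g x))\<^sup>2)"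
    by (auto simp: norm_mult)
qed

lemma L2_space_cnj: "f \<in> L2_space M \<Longrightarrow> (\<lambda>x. cnj (f x)) \<in> L2_space M"
  by (auto simp: L2_space_def)

lemma L2_space_scale: "f \<in> L2_space M \<Longrightarrow> (\<lambda>x. c * f x) \<in> L2_space M"
  by (auto simp: L2_space_def norm_mult power_mult_distrib)

lemma L2_space_zero: "(\<lambda>x. 0) \<in> L2_space M"
  by (auto simp: L2_space_def)

lemma L2_space_add:
  assumes "f \<in> L2_space M" "g \<in> L2_space M"
  shows "(\<lambda>x. f x + g x) \<in> L2_space M"
proof -
  have "integrable M (\<lambda>x. (norm (f x + g x))\<^sup>2)"
  proof (rule Bochner_Integration.integrable_bound)
    show "integrable M (\<lambda>x. 2 * (norm (f x))\<^sup>2 + 2 * (norm (g x))\<^sup>2)"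
      using assms by (auto simp: L2_space_def)
    have "(norm (u + v))\<^sup>2 \<le> 2 * (norm u)\<^sup>2 + 2 * (norm v)\<^sup>2" for u v :: complex
    proof -
      have "(norm (u + v))\<^sup>2 \<le> (norm u + norm v)\<^sup>2" by (intro power_mono norm_triangle_ineq) auto
      also have "\<dots> \<le> 2 * (norm u)\<^sup>2 + 2 * (norm v)\<^sup>2"
        using sum_squares_bound[of "norm u" "norm v"] by (simp add: power2_sum)
      finally show ?thesis .
    qed
    then show "AE x in M. norm ((norm (f x + g x))\<^sup>2) \<le> norm (2 * (norm (f x))\<^sup>2 + 2 * (norm (g x))\<^sup>2)"
      by auto
  qed (use assms in \<open>auto simp: L2_space_def\<close>)
  then show ?thesis using assms by (auto simp: L2_space_def)
qed

lemma L2_space_diff: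
  assumes "f \<in> L2_space M" "g \<in> L2_space M"
  shows "(\<lambda>x. f x - g x) \<in> L2_space M"
  using L2_space_add[OF assms(1) L2_space_scale[OF assms(2), of "-1"]] by simp

lemma L2_space_sum: "(\<And>i. i \<in> I \<Longrightarrow> f i \<in> L2_space M) \<Longrightarrow> (\<lambda>x. \<Sum>i\<in>I. f i x) \<in> L2_space M"
  by (induction I rule: infinite_finite_induct) (auto simp: L2_space_zero L2_space_add)

lemma L2_norm_altdef: "L2_norm M f = sqrt (LINT x|M. (norm (f x))\<^sup>2)"
proof -
  have "L2_inner M f f = (LINT x|M. complex_of_real ((norm (f x))\<^sup>2))"
    unfolding L2_inner_def complex_norm_square ..
  also have "\<dots> = complex_of_real (LINT x|M. (norm (f x))\<^sup>2)" by (rule integral_complex_of_real)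
  finally show ?thesis by (simp add: L2_norm_def)
qed

lemma L2_norm_nonneg: "0 \<le> L2_norm M f"
  by (simp add: L2_norm_altdef)

lemma L2_norm_power2: "(L2_norm M f)\<^sup>2 = (LINT x|M. (norm (f x))\<^sup>2)"
  by (simp add: L2_norm_altdef)

lemma L2_inner_self: "L2_inner M f f = complex_of_real ((L2_norm M f)\<^sup>2)"
proof -
  have "L2_inner M f f = (LINT x|M. complex_of_real ((norm (f x))\<^sup>2))"
    unfolding L2_inner_def complex_norm_square ..
  also have "\<dots> = complex_of_real (LINT x|M. (norm (f x))\<^sup>2)" by (rule integral_complex_of_real)
  finally show ?thesis by (simp add: L2_norm_power2)
qed

lemma L2_inner_integrable:
  "f \<in> L2_space M \<Longrightarrow> g \<in> L2_space M \<Longrightarrow> integrable M (\<lambda>x. f x * cnj (g x))"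
  by (intro L2_space_mult_integrable L2_space_cnj)

lemma L2_inner_add_left:
  assumes "f \<in> L2_space M" "g \<in> L2_space M" "h \<in> L2_space M"
  shows "L2_inner M (\<lambda>x. f x + g x) h = L2_inner M f h + L2_inner M g h"
  using assms by (simp add: L2_inner_def L2_inner_integrable ring_distribs)

lemma L2_inner_diff_left:
  assumes "f \<in> L2_space M" "g \<in> L2_space M" "h \<in> L2_space M"
  shows "L2_inner M (\<lambda>x. f x - g x) h = L2_inner M f h - L2_inner M g h"
  using assms by (simp add: L2_inner_def L2_inner_integrable ring_distribs)

lemma L2_inner_scale_left: "L2_inner M (\<lambda>x. c * f x) h = c * L2_inner M f h"
  by (simp add: L2_inner_def mult.assoc)

lemma L2_inner_commute: "L2_inner M g f = cnj (L2_inner M f g)"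
proof -
  have "cnj (L2_inner M f g) = (LINT x|M. cnj (f x * cnj (g x)))"
    unfolding L2_inner_def by (subst Bochner_Integration.integral_cnj) (rule refl)
  then show ?thesis by (simp add: L2_inner_def mult.commute)
qed

lemma L2_inner_sum_left:
  assumes "\<And>i. i \<in> I \<Longrightarrow> f i \<in> L2_space M" "h \<in> L2_space M"
  shows "L2_inner M (\<lambda>x. \<Sum>i\<in>I. f i x) h = (\<Sum>i\<in>I. L2_inner M (f i) h)"
  unfolding L2_inner_def sum_distrib_right
  using assms by (intro Bochner_Integration.integral_sum L2_inner_integrable)

lemma L2_norm_diff_power2:
  assumes "f \<in> L2_space M" "g \<in> L2_space M"
  shows "(L2_norm M (\<lambda>x. f x - g x))\<^sup>2 = (L2_norm M f)\<^sup>2 - 2 * Re (L2_inner M f g) + (L2_norm M g)\<^sup>2"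
proof -
  let ?h = "\<lambda>x. f x - g x"
  have h: "?h \<in> L2_space M" using assms by (rule L2_space_diff)
  have "L2_inner M ?h ?h = L2_inner M f ?h - L2_inner M g ?h"
    using assms h by (simp add: L2_inner_diff_left)
  also have "L2_inner M f ?h = cnj (L2_inner M ?h f)" by (rule L2_inner_commute)
  also have "L2_inner M ?h f = L2_inner M f f - L2_inner M g f"
    using assms by (simp add: L2_inner_diff_left)
  also have "L2_inner M g ?h = cnj (L2_inner M ?h g)" by (rule L2_inner_commute)
  also have "L2_inner M ?h g = L2_inner M f g - L2_inner M g g"
    using assms by (simp add: L2_inner_diff_left)
  also have "L2_inner M g f = cnj (L2_inner M f g)" by (rule L2_inner_commute)
  finally have "Re (L2_inner M ?h ?h) = Re (L2_inner M f f) - 2 * Re (L2_inner M f g) + Re (L2_inner M g g)"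
    by simp
  then show ?thesis by (simp add: L2_inner_self)
qed

lemma L2_norm_scale: "L2_norm M (\<lambda>x. c * f x) = norm c * L2_norm M f"
  by (simp add: L2_norm_altdef norm_mult power_mult_distrib real_sqrt_mult)

lemma L2_norm_zero: "L2_norm M (\<lambda>x. 0) = 0"
  by (simp add: L2_norm_altdef)

lemma L2_norm_eq_0_AE:
  assumes "f \<in> L2_space M" "L2_norm M f = 0"
  shows "AE x in M. f x = 0"
proof -
  have "(LINT x|M. (norm (f x))\<^sup>2) = 0" using assms by (simp add: L2_norm_altdef)
  then have "AE x in M. (norm (f x))\<^sup>2 = 0"
    using assms by (subst (asm) integral_nonneg_eq_0_iff_AE) (auto simp: L2_space_def)
  then show ?thesis by simp
qed

lemma L2_Cauchy_Schwarz:
  assumes f: "f \<in> L2_space M" and g: "g \<in> L2_space M"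
  shows "norm (L2_inner M f g) \<le> L2_norm M f * L2_norm M g"
proof (cases "L2_norm M g = 0")
  case True
  have ae: "AE x in M. g x = 0" using L2_norm_eq_0_AE[OF g True] .
  have "L2_inner M f g = (LINT x|M. 0)"
    unfolding L2_inner_def using f g ae by (intro integral_cong_AE) (auto simp: L2_space_def)
  then show ?thesis by (simp add: True)
next
  case False
  define B where "B = (L2_norm M g)\<^sup>2"
  define w where "w = L2_inner M f g"
  \<comment> \<open>The coefficient of the orthogonal projection of f onto g; the inequality is the
    nonnegativity of the squared distance.\<close>
  define c where "c = w / of_real B"
  have B: "B > 0" using False by (simp add: B_def)
  have "0 \<le> (L2_norm M (\<lambda>x. f x - c * g x))\<^sup>2" by simp
  also have "\<dots> = (L2_norm M f)\<^sup>2 - 2 * Re (L2_inner M f (\<lambda>x. c * g x)) + (L2_norm M (\<lambda>x. c * g x))\<^sup>2"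
    by (intro L2_norm_diff_power2 f L2_space_scale g)
  also have "L2_inner M f (\<lambda>x. c * g x) = cnj c * w"
    by (subst L2_inner_commute) (simp add: L2_inner_scale_left w_def L2_inner_commute[of M g f])
  also have "\<dots> = of_real ((norm w)\<^sup>2 / B)"
    by (simp add: c_def complex_norm_square[symmetric] mult.commute flip: of_real_power)
  also have "(L2_norm M (\<lambda>x. c * g x))\<^sup>2 = (norm w)\<^sup>2 / B"
    using B by (simp only: L2_norm_scale power_mult_distrib c_def norm_divide power_divide flip: B_def)
      (simp add: power2_eq_square)
  finally have "(norm w)\<^sup>2 / B \<le> (L2_norm M f)\<^sup>2" by simp
  then have "(norm w)\<^sup>2 \<le> (L2_norm M f * L2_norm M g)\<^sup>2"
    using B by (simp add: field_simps power_mult_distrib flip: B_def)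
  then show ?thesis unfolding w_def
    by (rule power2_le_imp_le) (simp add: L2_norm_nonneg)
qed

lemma L2_norm_triangle:
  assumes f: "f \<in> L2_space M" and g: "g \<in> L2_space M"
  shows "L2_norm M (\<lambda>x. f x + g x) \<le> L2_norm M f + L2_norm M g"
proof -
  let ?h = "\<lambda>x. (-1) * g x"
  have h: "L2_norm M ?h = L2_norm M g" unfolding L2_norm_scale by simp
  have "(L2_norm M (\<lambda>x. f x - ?h x))\<^sup>2 = (L2_norm M f)\<^sup>2 - 2 * Re (L2_inner M f ?h) + (L2_norm M g)\<^sup>2"
    unfolding h[symmetric] by (intro L2_norm_diff_power2 f L2_space_scale g)
  moreover have "- Re (L2_inner M f ?h) \<le> L2_norm M f * L2_norm M g"
    using abs_Re_le_cmod[of "L2_inner M f ?h"] L2_Cauchy_Schwarz[OF f L2_space_scale[OF g, of "-1"]]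
    unfolding h by linarith
  ultimately have "(L2_norm M (\<lambda>x. f x + g x))\<^sup>2 \<le> (L2_norm M f + L2_norm M g)\<^sup>2"
    by (simp add: power2_sum)
  then show ?thesis by (rule power2_le_imp_le) (simp add: L2_norm_nonneg)
qed

lemma L2_norm_diff_triangle:
  assumes "f \<in> L2_space M" "g \<in> L2_space M" "h \<in> L2_space M"
  shows "L2_norm M (\<lambda>x. f x - h x) \<le> L2_norm M (\<lambda>x. f x - g x) + L2_norm M (\<lambda>x. g x - h x)"
  using L2_norm_triangle[OF L2_space_diff[OF assms(1,2)] L2_space_diff[OF assms(2,3)]] by simp

text \<open>Dominated convergence applied to the squared errors, in the form that the density
  arguments below consume.\<close>

lemma L2_approx_dominated:
  assumes s: "\<And>m. s m \<in> L2_space M" and f: "f \<in> L2_space M"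
    and w: "integrable M w" "\<And>m. AE x in M. (norm (f x - s m x))\<^sup>2 \<le> w x"
    and lim: "AE x in M. (\<lambda>m. s m x) \<longlonglongrightarrow> f x" and e: "\<epsilon> > 0"
  shows "\<exists>m. L2_norm M (\<lambda>x. f x - s m x) < \<epsilon>"
proof -
  have "(\<lambda>m. LINT x|M. (norm (f x - s m x))\<^sup>2) \<longlonglongrightarrow> (LINT x|M. 0)"
  proof (rule integral_dominated_convergence[where w = w])
    show "AE x in M. (\<lambda>m. (norm (f x - s m x))\<^sup>2) \<longlonglongrightarrow> 0"
      using lim
    proof eventually_elim
      case (elim x)
      have "(\<lambda>m. (norm (f x - s m x))\<^sup>2) \<longlonglongrightarrow> (norm (f x - f x))\<^sup>2"
        by (intro tendsto_intros elim)
      then show ?case by simp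
    qed
    show "(\<lambda>x. (norm (f x - s m x))\<^sup>2) \<in> borel_measurable M" for m
      using s[of m] f by (auto simp: L2_space_def)
  qed (use w in auto)
  then have "\<forall>\<^sub>F m in sequentially. (LINT x|M. (norm (f x - s m x))\<^sup>2) < \<epsilon>\<^sup>2"
    using e by (intro order_tendstoD) auto
  then obtain m where "(L2_norm M (\<lambda>x. f x - s m x))\<^sup>2 < \<epsilon>\<^sup>2"
    by (auto simp: eventually_sequentially L2_norm_power2)
  then show ?thesis using e power_less_imp_less_base by (metis less_imp_le)
qed

text \<open>The second part completes the square in the coefficients: for arbitrary c the error
  splits into the best error and the distance of c from the Fourier coefficients. Taking c to be the
  latter yields Bessel; taking c from any good approximation yields half of Parseval.\<close>

lemma L2_orthonormal_expansion:
  assumes K: "finite K" and e: "\<And>k. k \<in> K \<Longrightarrow> e k \<in> L2_space M" and f: "f \<in> L2_space M"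
    and on: "\<And>k l. k \<in> K \<Longrightarrow> l \<in> K \<Longrightarrow> L2_inner M (e k) (e l) = (if k = l then 1 else 0)"
  shows "(L2_norm M (\<lambda>x. \<Sum>k\<in>K. c k * e k x))\<^sup>2 = (\<Sum>k\<in>K. (norm (c k))\<^sup>2)" (is ?A)
    and "(L2_norm M (\<lambda>x. f x - (\<Sum>k\<in>K. c k * e k x)))\<^sup>2 =
      (L2_norm M f)\<^sup>2 - (\<Sum>k\<in>K. (norm (L2_inner M f (e k)))\<^sup>2) + (\<Sum>k\<in>K. (norm (L2_inner M f (e k) - c k))\<^sup>2)" (is ?B)
proof -
  let ?T = "\<lambda>x. \<Sum>k\<in>K. c k * e k x"
  have ce: "(\<lambda>x. c k * e k x) \<in> L2_space M" if "k \<in> K" for k using e[OF that] by (rule L2_space_scale)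
  have T: "?T \<in> L2_space M" by (intro L2_space_sum ce)
  have Te: "L2_inner M ?T h = (\<Sum>k\<in>K. c k * L2_inner M (e k) h)" if "h \<in> L2_space M" for h
    using L2_inner_sum_left[OF ce that] by (simp add: L2_inner_scale_left)
  have Tl: "L2_inner M ?T (e l) = c l" if "l \<in> K" for l
  proof -
    have "L2_inner M ?T (e l) = (\<Sum>k\<in>K. c k * (if k = l then 1 else 0))"
      using that e on by (subst Te) auto
    also have "\<dots> = (\<Sum>k\<in>K. if k = l then c l else 0)" by (intro sum.cong) auto
    finally show ?thesis using K that by simp
  qed
  have fT: "L2_inner M f ?T = (\<Sum>k\<in>K. cnj (c k) * L2_inner M f (e k))"
  proof -
    have "L2_inner M f ?T = cnj (\<Sum>k\<in>K. c k * L2_inner M (e k) f)"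
      unfolding Te[OF f, symmetric] by (rule L2_inner_commute)
    then show ?thesis by (simp add: L2_inner_commute[of M f])
  qed
  have "L2_inner M ?T ?T = (\<Sum>k\<in>K. c k * cnj (L2_inner M ?T (e k)))"
    by (subst Te[OF T]) (simp add: L2_inner_commute[of M _ ?T])
  also have "\<dots> = (\<Sum>k\<in>K. of_real ((norm (c k))\<^sup>2))"
    by (intro sum.cong refl) (simp only: Tl complex_norm_square)
  finally have "complex_of_real ((L2_norm M ?T)\<^sup>2) = complex_of_real (\<Sum>k\<in>K. (norm (c k))\<^sup>2)"
    by (simp only: L2_inner_self of_real_sum)
  then show A: ?A by (simp only: of_real_eq_iff)
  have id: "(norm (z - w))\<^sup>2 = (norm z)\<^sup>2 - 2 * Re (cnj w * z) + (norm w)\<^sup>2" for z w :: complex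
    unfolding cmod_power2 by (simp add: power2_eq_square algebra_simps)
  have "(\<Sum>k\<in>K. (norm (L2_inner M f (e k) - c k))\<^sup>2) = (\<Sum>k\<in>K. (norm (L2_inner M f (e k)))\<^sup>2)
     - 2 * Re (L2_inner M f ?T) + (L2_norm M ?T)\<^sup>2"
    unfolding id A fT by (simp add: sum.distrib sum_subtractf sum_distrib_left)
  then show ?B using L2_norm_diff_power2[OF f T] by simp
qed

lemma L2_Bessel:
  assumes K: "finite K" and e: "\<And>k. k \<in> K \<Longrightarrow> e k \<in> L2_space M" and f: "f \<in> L2_space M"
    and on: "\<And>k l. k \<in> K \<Longrightarrow> l \<in> K \<Longrightarrow> L2_inner M (e k) (e l) = (if k = l then 1 else 0)"
  shows "(\<Sum>k\<in>K. (norm (L2_inner M f (e k)))\<^sup>2) \<le> (L2_norm M f)\<^sup>2"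
proof -
  have "0 \<le> (L2_norm M (\<lambda>x. f x - (\<Sum>k\<in>K. L2_inner M f (e k) * e k x)))\<^sup>2" by simp
  also have "\<dots> = (L2_norm M f)\<^sup>2 - (\<Sum>k\<in>K. (norm (L2_inner M f (e k)))\<^sup>2)"
    by (subst L2_orthonormal_expansion(2)[OF assms]) simp_all
  finally show ?thesis by simp
qed

section \<open>Orthonormal exponentials on the cube\<close>

section \<open>Fourier series on the cube\<close>

abbreviation cube_measure :: "real \<Rightarrow> real \<Rightarrow> (real^'n::finite) measure" where
  "cube_measure a b \<equiv> lebesgue_on (cube a b)"

lemma mem_cube: "x \<in> cube a b \<longleftrightarrow> (\<forall>i. a \<le> x $ i \<and> x $ i \<le> b)"
  by (auto simp: cube_def mem_box_cart)

lemma cube_lebesgue [measurable]: "cube a b \<in> sets lebesgue"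
  by (simp add: cube_def)

lemma finite_measure_cube: "finite_measure (cube_measure a b :: (real^'n::finite) measure)"
proof (rule finite_measureI)
  show "emeasure (cube_measure a b) (space (cube_measure a b :: (real^'n) measure)) \<noteq> \<infinity>"
    using emeasure_lborel_cbox_finite[of "vec a :: real^'n" "vec b"]
    unfolding cube_def by (simp add: emeasure_restrict_space)
qed

lemma borel_measurable_cube_continuous:
  fixes f :: "real^'n \<Rightarrow> 'b::topological_space"
  assumes "continuous_on UNIV f"
  shows "f \<in> borel_measurable (cube_measure a b)"
proof (rule measurable_restrict_space1)
  show "f \<in> borel_measurable lebesgue"
    using borel_measurable_continuous_onI[OF assms] by (simp add: measurable_completion)
qed

lemma L2_cubeI_bounded:
  assumes f: "f \<in> borel_measurable (cube_measure a b)" and C: "\<And>x. x \<in> cube a b \<Longrightarrow> norm (f x) \<le> C"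
  shows "f \<in> L2_space (cube_measure a b)"
proof -
  interpret finite_measure "cube_measure a b" by (rule finite_measure_cube)
  have "integrable (cube_measure a b) (\<lambda>x. (norm (f x))\<^sup>2)"
  proof (rule integrable_const_bound[of _ "C\<^sup>2"])
    show "AE x in cube_measure a b. norm ((norm (f x))\<^sup>2) \<le> C\<^sup>2"
      using C by (intro AE_I2) (auto intro!: power_mono)
  qed (use f in simp)
  then show ?thesis using f by (simp add: L2_space_def)
qed

text \<open>Fubini: \<open>lborel\<close> on vectors is the image of a product measure over the
  basis, and \<open>ix\<close> converts a basis vector into its coordinate. The cube enters as a
  product of interval indicators.\<close>

lemma integral_cube_prod:
  fixes h :: "'n::finite \<Rightarrow> real \<Rightarrow> complex"
  assumes h: "\<And>i. continuous_on UNIV (h i)"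
  shows "(LINT x|cube_measure a b. (\<Prod>i\<in>UNIV. h i (x $ i))) =
    (\<Prod>i\<in>UNIV. LINT t|lborel. indicator {a..b} t *\<^sub>R h i t)"
proof -
  define g where "g i t = indicator {a..b} t *\<^sub>R h i t" for i t
  have g_int: "integrable lborel (g i)" for i
    unfolding g_def by (rule borel_integrable_compact) (auto intro: continuous_on_subset[OF h])
  have g_meas [measurable]: "g i \<in> borel_measurable borel" for i
    using borel_measurable_integrable[OF g_int[of i]] by simp
  define ix :: "real^'n \<Rightarrow> 'n" where "ix = the_inv (\<lambda>i. axis i 1)"
  have inj: "inj (\<lambda>i::'n. axis i (1::real))" by (auto simp: inj_on_def axis_eq_axis)
  have ix: "ix (axis i 1) = i" for i unfolding ix_def by (rule the_inv_f_f[OF inj])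
  have Basis: "(Basis :: (real^'n) set) = range (\<lambda>i. axis i 1)"
    by (auto simp: Basis_vec_def)
  have prodB: "(\<Prod>b\<in>(Basis :: (real^'n) set). G b) = (\<Prod>i\<in>UNIV. G (axis i 1))" for G :: "real^'n \<Rightarrow> complex"
    unfolding Basis by (subst prod.reindex[OF inj]) simp
  have comp: "(\<Sum>b\<in>(Basis :: (real^'n) set). y b *\<^sub>R b) $ i = y (axis i 1)" for y i
  proof -
    have "(\<Sum>b\<in>(Basis :: (real^'n) set). y b *\<^sub>R b) $ i = (\<Sum>j\<in>UNIV. y (axis j 1) * axis j (1::real) $ i)"
      unfolding Basis by (subst sum.reindex[OF inj]) simp
    also have "\<dots> = (\<Sum>j\<in>UNIV. if j = i then y (axis i 1) else 0)"
      by (intro sum.cong) (auto simp: axis_def)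
    finally show ?thesis by simp
  qed
  have "(LINT x|cube_measure a b. (\<Prod>i\<in>UNIV. h i (x $ i))) =
     (LINT x|lebesgue. indicator (cube a b) x *\<^sub>R (\<Prod>i\<in>UNIV. h i (x $ i)))"
    by (intro integral_restrict_space) auto
  also have "\<dots> = (LINT x|lebesgue. (\<Prod>i\<in>UNIV. g i (x $ i)))"
  proof (intro Bochner_Integration.integral_cong refl)
    fix x :: "real^'n"
    show "indicator (cube a b) x *\<^sub>R (\<Prod>i\<in>UNIV. h i (x $ i)) = (\<Prod>i\<in>UNIV. g i (x $ i))"
    proof (cases "x \<in> cube a b")
      case True
      then show ?thesis by (simp add: g_def mem_cube)
    next
      case False
      then obtain i where "\<not> (a \<le> x $ i \<and> x $ i \<le> b)" by (auto simp: mem_cube)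
      then have "g i (x $ i) = 0" by (simp add: g_def)
      then have "(\<Prod>i\<in>UNIV. g i (x $ i)) = 0" by (auto intro: prod_zero)
      then show ?thesis using False by simp
    qed
  qed
  also have "\<dots> = (LINT x|lborel. (\<Prod>i\<in>UNIV. g i (x $ i)))"
    by (intro integral_completion) measurable
  also have "\<dots> = (LINT y|(\<Pi>\<^sub>M b\<in>Basis. lborel). (\<Prod>i\<in>UNIV. g i ((\<Sum>b\<in>(Basis::(real^'n) set). y b *\<^sub>R b) $ i)))"
    by (subst lborel_eq, subst integral_distr) measurable
  also have "\<dots> = (LINT y|(\<Pi>\<^sub>M b\<in>Basis. lborel). (\<Prod>b\<in>(Basis::(real^'n) set). g (ix b) (y b)))"
    unfolding comp prodB by (simp add: ix)
  also have "\<dots> = (\<Prod>b\<in>(Basis::(real^'n) set). LINT t|lborel. g (ix b) t)"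
  proof -
    interpret product_sigma_finite "\<lambda>b::real^'n. lborel :: real measure" by standard
    show ?thesis by (intro product_integral_prod g_int) auto
  qed
  also have "\<dots> = (\<Prod>i\<in>UNIV. LINT t|lborel. g i t)"
    unfolding prodB by (simp add: ix)
  finally show ?thesis by (simp add: g_def)
qed

text \<open>The eigenvalue of differentiation on the exponential with k periods on [a, b].\<close>

definition wave :: "real \<Rightarrow> real \<Rightarrow> int \<Rightarrow> complex" where
  "wave a b k = 2 * of_real pi * \<i> * of_int k / of_real (b - a)"

definition character :: "real \<Rightarrow> real \<Rightarrow> ('n::finite \<Rightarrow> int) \<Rightarrow> real^'n \<Rightarrow> complex" where
  "character a b k x = exp (\<Sum>i\<in>UNIV. wave a b (k i) * of_real (x $ i - a))"

definition trig :: "real \<Rightarrow> real \<Rightarrow> ('n::finite \<Rightarrow> int) \<Rightarrow> real^'n \<Rightarrow> complex" where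
  "trig a b k x = character a b k x / of_real (sqrt (b - a) ^ CARD('n))"

lemma wave_add: "wave a b (k + l) = wave a b k + wave a b l"
  by (simp add: wave_def field_simps add_divide_distrib)

lemma wave_uminus: "wave a b (- k) = - wave a b k"
  by (simp add: wave_def)

lemma wave_0 [simp]: "wave a b 0 = 0"
  by (simp add: wave_def)

lemma cnj_wave: "cnj (wave a b k) = - wave a b k"
  by (simp add: wave_def)

lemma norm_wave: "a < b \<Longrightarrow> norm (wave a b k) = 2 * pi / (b - a) * real_of_int \<bar>k\<bar>"
  by (simp add: wave_def norm_mult norm_divide del: of_real_diff)

lemma exp_wave_period: "a < b \<Longrightarrow> exp (wave a b k * of_real (b - a)) = 1"
proof -
  assume "a < b"
  then have "wave a b k * of_real (b - a) = (2 * of_int k * of_real pi) * \<i>"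
    by (simp add: wave_def)
  then show ?thesis using exp_integer_2pi[of "of_int k"] by simp
qed

lemma character_prod: "character a b k x = (\<Prod>i\<in>UNIV. exp (wave a b (k i) * of_real (x $ i - a)))"
  unfolding character_def by (rule exp_sum) simp

lemma norm_character [simp]: "norm (character a b k x) = 1"
proof -
  have "Re (wave a b j) = 0" for j by (simp add: wave_def del: of_real_diff)
  then show ?thesis by (simp add: character_def del: of_real_diff)
qed

lemma character_add: "character a b (\<lambda>i. k i + l i) x = character a b k x * character a b l x"
  by (simp add: character_def wave_add ring_distribs sum.distrib exp_add del: of_real_diff)

lemma character_zero [simp]: "character a b (\<lambda>i. 0) x = 1"
  by (simp add: character_def)

lemma cnj_character: "cnj (character a b k x) = character a b (\<lambda>i. - k i) x"
  by (simp add: character_def exp_cnj cnj_wave wave_uminus)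

lemma continuous_on_character: "continuous_on S (character a b k)"
  unfolding character_def by (intro continuous_intros)

lemma character_L2: "character a b k \<in> L2_space (cube_measure a b)"
  by (rule L2_cubeI_bounded[where C = 1]) (auto intro: borel_measurable_cube_continuous continuous_on_character)

lemma trig_L2: "trig a b k \<in> L2_space (cube_measure a b)"
  using L2_space_scale[OF character_L2, of "inverse (of_real (sqrt (b - a) ^ CARD('n)))" a b k]
  unfolding trig_def[abs_def] by (simp add: field_simps)

lemma integral_exp_wave:
  assumes "a < b"
  shows "(LINT t|lborel. indicator {a..b} t *\<^sub>R exp (wave a b k * of_real (t - a))) =
    (if k = 0 then of_real (b - a) else 0)"
proof (cases "k = 0")
  case True
  then show ?thesis using assms by (simp add: scaleR_conv_of_real)
next
  case False
  define F where "F t = exp (wave a b k * of_real (t - a)) / wave a b k" for t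
  have w: "wave a b k \<noteq> 0" using False assms by (simp add: wave_def)
  have "(LINT t|lborel. indicator {a..b} t *\<^sub>R exp (wave a b k * of_real (t - a))) = F b - F a"
  proof (rule integral_FTC_Icc)
    fix t :: real
    have "((\<lambda>z. exp (wave a b k * (z - of_real a)) / wave a b k) has_field_derivative
       exp (wave a b k * (of_real t - of_real a))) (at (of_real t))"
      using w by (auto intro!: derivative_eq_intros)
    from has_vector_derivative_real_field[OF this]
    have "(F has_vector_derivative exp (wave a b k * of_real (t - a))) (at t)"
      unfolding F_def[abs_def] of_real_diff .
    then show "(F has_vector_derivative exp (wave a b k * of_real (t - a))) (at t within {a..b})"
      by (rule has_vector_derivative_at_within)
  qed (use assms in \<open>auto intro!: continuous_intros\<close>)
  also have "F b - F a = 0"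
    using exp_wave_period[OF assms] by (simp add: F_def del: of_real_diff)
  finally show ?thesis using False by simp
qed

lemma trig_orthonormal:
  assumes "a < b"
  shows "L2_inner (cube_measure a b) (trig a b k) (trig a b l) = (if k = l then 1 else 0)"
proof -
  let ?c = "complex_of_real (sqrt (b - a) ^ CARD('a))"
  have cc: "?c * ?c = of_real (b - a) ^ CARD('a)"
    using assms by (simp flip: of_real_mult power_mult_distrib of_real_diff of_real_power)
  have "L2_inner (cube_measure a b) (trig a b k) (trig a b l) =
     (LINT x|cube_measure a b. character a b (\<lambda>i. k i - l i) x / (?c * ?c))"
    unfolding L2_inner_def trig_def
    by (intro Bochner_Integration.integral_cong refl)
       (simp add: cnj_character character_add[of a b k "\<lambda>i. - l i", simplified])
  also have "\<dots> = (LINT x|cube_measure a b. character a b (\<lambda>i. k i - l i) x) / (?c * ?c)"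
    by (rule integral_divide_zero)
  also have "(LINT x|cube_measure a b. character a b (\<lambda>i. k i - l i) x) =
     (\<Prod>i\<in>UNIV. if k i - l i = 0 then of_real (b - a) else 0)"
    unfolding character_prod
    by (subst integral_cube_prod) (auto simp only: integral_exp_wave[OF assms] intro!: continuous_intros)
  also have "\<dots> / (?c * ?c) = (if k = l then 1 else 0)"
  proof (cases "k = l")
    case True
    then show ?thesis using assms unfolding cc by simp
  next
    case False
    then obtain i where "k i \<noteq> l i" by auto
    then have "(\<Prod>i\<in>UNIV. if k i - l i = 0 then complex_of_real (b - a) else 0) = 0"
      by (intro prod_zero) auto
    then show ?thesis using False by simp
  qed
  finally show ?thesis .
qed

definition fourier :: "real \<Rightarrow> real \<Rightarrow> (real^'n::finite \<Rightarrow> complex) \<Rightarrow> ('n \<Rightarrow> int) \<Rightarrow> complex" where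
  "fourier a b f k = L2_inner (cube_measure a b) f (trig a b k)"

section \<open>Trigonometric polynomials and their bounded limits\<close>

definition trig_poly :: "real \<Rightarrow> real \<Rightarrow> (real^'n::finite \<Rightarrow> complex) \<Rightarrow> bool" where
  "trig_poly a b T \<longleftrightarrow> (\<exists>K c. finite K \<and> T = (\<lambda>x. \<Sum>k\<in>K. c k * character a b k x))"

lemma trig_poly_character: "trig_poly a b (\<lambda>x. c * character a b k x)"
  unfolding trig_poly_def by (intro exI[of _ "{k}"] exI[of _ "\<lambda>_. c"]) simp

lemma trig_poly_const: "trig_poly a b (\<lambda>x. c)"
  using trig_poly_character[of a b c "\<lambda>_. 0"] by simp

lemma trig_poly_add:
  assumes "trig_poly a b T" "trig_poly a b U"
  shows "trig_poly a b (\<lambda>x. T x + U x)"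
proof -
  obtain K c L d where K: "finite K" "T = (\<lambda>x. \<Sum>k\<in>K. c k * character a b k x)"
    and L: "finite L" "U = (\<lambda>x. \<Sum>k\<in>L. d k * character a b k x)"
    using assms unfolding trig_poly_def by blast
  have 1: "T x = (\<Sum>k\<in>K \<union> L. (if k \<in> K then c k else 0) * character a b k x)" for x
    unfolding K(2) by (rule sum.mono_neutral_cong_left) (use K L in auto)
  have 2: "U x = (\<Sum>k\<in>K \<union> L. (if k \<in> L then d k else 0) * character a b k x)" for x
    unfolding L(2) by (rule sum.mono_neutral_cong_left) (use K L in auto)
  have "(\<lambda>x. T x + U x) = (\<lambda>x. \<Sum>k\<in>K \<union> L. ((if k \<in> K then c k else 0) + (if k \<in> L then d k else 0)) * character a b k x)"
    unfolding 1 2 by (simp add: ring_distribs sum.distrib)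
  then show ?thesis unfolding trig_poly_def using K(1) L(1)
    by (intro exI[of _ "K \<union> L"] exI[of _ "\<lambda>k. (if k \<in> K then c k else 0) + (if k \<in> L then d k else 0)"]) simp
qed

lemma trig_poly_sum: "(\<And>i. i \<in> I \<Longrightarrow> trig_poly a b (T i)) \<Longrightarrow> trig_poly a b (\<lambda>x. \<Sum>i\<in>I. T i x)"
  by (induction I rule: infinite_finite_induct) (auto simp: trig_poly_const trig_poly_add)

lemma trig_poly_mult:
  assumes "trig_poly a b T" "trig_poly a b U"
  shows "trig_poly a b (\<lambda>x. T x * U x)"
proof -
  obtain K c L d where K: "T = (\<lambda>x. \<Sum>k\<in>K. c k * character a b k x)"
    and L: "U = (\<lambda>x. \<Sum>k\<in>L. d k * character a b k x)"
    using assms unfolding trig_poly_def by blast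
  have "(\<lambda>x. T x * U x) = (\<lambda>x. \<Sum>k\<in>K. \<Sum>l\<in>L. (c k * d l) * character a b (\<lambda>i. k i + l i) x)"
    unfolding K L sum_product character_add by (simp add: mult_ac)
  moreover have "trig_poly a b \<dots>" by (intro trig_poly_sum trig_poly_character)
  ultimately show ?thesis by simp
qed

lemma trig_poly_L2: "trig_poly a b T \<Longrightarrow> T \<in> L2_space (cube_measure a b)"
  unfolding trig_poly_def by (auto intro!: L2_space_sum L2_space_scale character_L2)

text \<open>A function that differs on opposite faces is no uniform limit of trigonometric
  polynomials on the closed cube. Bounded pointwise convergence on the open box is weak enough to
  reach the coordinate functions, is preserved by sums and products, and still implies approximation
  in L2.\<close>

definition trig_limit :: "real \<Rightarrow> real \<Rightarrow> (real^'n::finite \<Rightarrow> complex) \<Rightarrow> bool" where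
  "trig_limit a b f \<longleftrightarrow> (\<exists>T C. (\<forall>m. trig_poly a b (T m)) \<and> (\<forall>m x. norm (T m x) \<le> C) \<and>
     (\<forall>x\<in>box (vec a) (vec b). (\<lambda>m::nat. T m x) \<longlonglongrightarrow> f x))"

lemma trig_limit_const: "trig_limit a b (\<lambda>x. c)"
  unfolding trig_limit_def
  by (intro exI[of _ "\<lambda>m x. c"] exI[of _ "norm c"]) (simp add: trig_poly_const)

lemma trig_limit_add:
  assumes "trig_limit a b f" "trig_limit a b g"
  shows "trig_limit a b (\<lambda>x. f x + g x)"
proof -
  obtain T C U D where T: "\<And>m. trig_poly a b (T m)" "\<And>m x. norm (T m x) \<le> C"
      "\<And>x. x \<in> box (vec a) (vec b) \<Longrightarrow> (\<lambda>m::nat. T m x) \<longlonglongrightarrow> f x"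
    and U: "\<And>m. trig_poly a b (U m)" "\<And>m x. norm (U m x) \<le> D"
      "\<And>x. x \<in> box (vec a) (vec b) \<Longrightarrow> (\<lambda>m::nat. U m x) \<longlonglongrightarrow> g x"
    using assms unfolding trig_limit_def by metis
  show ?thesis unfolding trig_limit_def
    by (intro exI[of _ "\<lambda>m x. T m x + U m x"] exI[of _ "C + D"] conjI allI ballI trig_poly_add T U
        tendsto_add order_trans[OF norm_triangle_ineq] add_mono)
qed

lemma trig_limit_mult:
  assumes "trig_limit a b f" "trig_limit a b g"
  shows "trig_limit a b (\<lambda>x. f x * g x)"
proof -
  obtain T C U D where T: "\<And>m. trig_poly a b (T m)" "\<And>m x. norm (T m x) \<le> C"
      "\<And>x. x \<in> box (vec a) (vec b) \<Longrightarrow> (\<lambda>m::nat. T m x) \<longlonglongrightarrow> f x"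
    and U: "\<And>m. trig_poly a b (U m)" "\<And>m x. norm (U m x) \<le> D"
      "\<And>x. x \<in> box (vec a) (vec b) \<Longrightarrow> (\<lambda>m::nat. U m x) \<longlonglongrightarrow> g x"
    using assms unfolding trig_limit_def by metis
  have "C \<ge> 0" using T(2) norm_ge_zero order_trans by blast
  then have "norm (T m x * U m x) \<le> C * D" for m x
    unfolding norm_mult by (intro mult_mono T U) auto
  then show ?thesis unfolding trig_limit_def
    by (intro exI[of _ "\<lambda>m x. T m x * U m x"] exI[of _ "C * D"] conjI allI ballI trig_poly_mult T U
        tendsto_mult)
qed

lemma trig_limit_sum: "(\<And>i. i \<in> I \<Longrightarrow> trig_limit a b (T i)) \<Longrightarrow> trig_limit a b (\<lambda>x. \<Sum>i\<in>I. T i x)"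
  by (induction I rule: infinite_finite_induct) (auto simp: trig_limit_const trig_limit_add)

text \<open>Polar form: 1 - exp(i \<phi>) = 2 sin(\<phi>/2) exp(i (\<phi> - \<pi>)/2), with an angle
  inside (-\<pi>/2, \<pi>/2), so the principal logarithm is visible. The positive real part keeps
  the point off the branch cut, as the continuity of \<open>Ln\<close> in the Abel limit
  requires.\<close>

lemma Im_Ln_one_minus_cis:
  assumes "0 < \<phi>" "\<phi> < 2 * pi"
  shows "Im (Ln (1 - cis \<phi>)) = (\<phi> - pi) / 2" and "1 - cis \<phi> \<notin> \<real>\<^sub>\<le>\<^sub>0"
proof -
  have s: "sin (\<phi> / 2) > 0" using assms by (intro sin_gt_zero) auto
  have sh: "sin (\<phi> / 2 - pi / 2) = - cos (\<phi> / 2)" "cos (\<phi> / 2 - pi / 2) = sin (\<phi> / 2)"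
    by (simp_all add: sin_diff cos_diff)
  have c: "cos \<phi> = 1 - 2 * (sin (\<phi> / 2))\<^sup>2" "sin \<phi> = 2 * sin (\<phi> / 2) * cos (\<phi> / 2)"
    using cos_double_sin[of "\<phi> / 2"] sin_double[of "\<phi> / 2"] by simp_all
  have "exp (Complex (ln (2 * sin (\<phi> / 2))) ((\<phi> - pi) / 2)) = 1 - cis \<phi>"
    using s by (intro complex_eqI) (simp_all add: Re_exp Im_exp diff_divide_distrib sh c power2_eq_square)
  then have "Ln (1 - cis \<phi>) = Complex (ln (2 * sin (\<phi> / 2))) ((\<phi> - pi) / 2)"
    by (rule Ln_unique) (use assms in auto)
  then show "Im (Ln (1 - cis \<phi>)) = (\<phi> - pi) / 2" by simp
  have "Re (1 - cis \<phi>) > 0" using s c by simp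
  then show "1 - cis \<phi> \<notin> \<real>\<^sub>\<le>\<^sub>0" by (auto simp: complex_nonpos_Reals_iff)
qed

text \<open>On a disc of radius r < 1 the geometric series dominates. The summand at n = 0 is a
  division by zero and hence 0, so this is the usual logarithm series.\<close>

lemma Ln_partial_sums_uniform:
  assumes "0 \<le> r" "r < 1" "\<epsilon> > 0"
  shows "\<exists>N. \<forall>w. norm w \<le> r \<longrightarrow> norm ((\<Sum>n<N. - (w ^ n) / of_nat n) - Ln (1 - w)) < \<epsilon>"
proof -
  have "uniform_limit {w::complex. norm w \<le> r} (\<lambda>N w. \<Sum>n<N. - (w ^ n) / of_nat n)
     (\<lambda>w. \<Sum>n. - (w ^ n) / of_nat n) sequentially"
  proof (rule Weierstrass_m_test)
    fix n :: nat and w :: complex assume "w \<in> {w. norm w \<le> r}"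
    then have "norm w ^ n \<le> r ^ n" by (intro power_mono) auto
    moreover have "norm w ^ n / real n \<le> norm w ^ n"
      by (cases n) (auto simp: field_simps intro: mult_left_mono)
    ultimately show "norm (- (w ^ n) / of_nat n) \<le> r ^ n"
      by (simp add: norm_divide norm_power)
  qed (use assms in \<open>simp add: summable_geometric\<close>)
  then have "\<forall>\<^sub>F N in sequentially. \<forall>w\<in>{w::complex. norm w \<le> r}.
     dist (\<Sum>n<N. - (w ^ n) / of_nat n) (\<Sum>n. - (w ^ n) / of_nat n) < \<epsilon>"
    using assms(3) by (rule uniform_limitD)
  then obtain N where N: "\<And>w::complex. norm w \<le> r \<Longrightarrow>
     dist (\<Sum>n<N. - (w ^ n) / of_nat n) (\<Sum>n. - (w ^ n) / of_nat n) < \<epsilon>"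
    by (auto simp: eventually_sequentially)
  have "(\<Sum>n. - (w ^ n) / of_nat n) = Ln (1 - w)" if "norm w \<le> r" for w :: complex
    using Ln_series'[of "- w"] that assms by (simp add: sums_iff)
  then show ?thesis using N by (auto simp: dist_norm)
qed

text \<open>The coordinate functions are recovered from the sawtooth series
  \<open>Im (Ln (1 - r e\<^sup>i\<^sup>\<phi>)) = - (\<Sum>n. r\<^sup>n sin (n \<phi>) / n)\<close>, whose Abel means are uniformly bounded and
  converge to \<open>(\<phi> - \<pi>) / 2\<close>.\<close>

lemma trig_limit_coordinate:
  fixes i :: "'n::finite"
  assumes ab: "a < b"
  shows "trig_limit a b (\<lambda>x. complex_of_real (x $ i))"
proof -
  define ch where "ch n = character a b ((\<lambda>_. 0)(i := n))" for n
  define z where "z x = cis (2 * pi * (x $ i - a) / (b - a))" for x :: "real^'n"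
  \<comment> \<open>The Abel parameter, in [0, 1) and tending to 1.\<close>
  define r where "r m = 1 - 1 / (real m + 2)" for m :: nat
  have r: "0 \<le> r m" "r m < 1" for m by (auto simp: r_def)
  have ch: "ch n x = cis (real_of_int n * (2 * pi * (x $ i - a) / (b - a)))" for n x
  proof -
    have "(\<Sum>j\<in>UNIV. wave a b (((\<lambda>_. 0)(i := n)) j) * of_real (x $ j - a)) = wave a b n * of_real (x $ i - a)"
      by (subst sum.remove[of _ i]) (auto intro!: sum.neutral)
    also have "\<dots> = \<i> * of_real (real_of_int n * (2 * pi * (x $ i - a) / (b - a)))"
      by (simp add: wave_def mult_ac)
    finally show ?thesis by (simp add: ch_def character_def cis_conv_exp)
  qed
  have ch_pos: "ch (int n) x = z x ^ n" for n x
    by (simp only: ch z_def Complex.DeMoivre of_int_of_nat_eq)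
  have ch_neg: "ch (- int n) x = cnj (z x ^ n)" for n x
    by (simp only: ch z_def Complex.DeMoivre of_int_of_nat_eq of_int_minus mult_minus_left cis_cnj)
  have "\<forall>m. \<exists>N. \<forall>w. norm w \<le> r m \<longrightarrow> norm ((\<Sum>n<N. - (w ^ n) / of_nat n) - Ln (1 - w)) < 1 / (real m + 1)"
    using Ln_partial_sums_uniform r by (metis divide_pos_pos of_nat_0_le_iff add_nonneg_pos zero_less_one)
  \<comment> \<open>The number of terms depends on the radius \<open>r m\<close>, so a single index
    drives the Abel limit and the truncation together.\<close>
  then obtain N where N: "\<And>m w. norm w \<le> r m \<Longrightarrow>
    norm ((\<Sum>n<N m. - (w ^ n) / of_nat n) - Ln (1 - w)) < 1 / (real m + 1)" by metis
  define S where "S m x = (\<Sum>n<N m. - ((of_real (r m) * z x) ^ n) / of_nat n)" for m x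
  \<comment> \<open>Affine rescaling back to the coordinate: with \<phi> = (x_i - a) / c the limit
    of 2 Im S is \<phi> - \<pi>.\<close>
  define c where "c = (b - a) / (2 * pi)"
  define T where "T m x = complex_of_real (a + c * (pi + 2 * Im (S m x)))" for m x
  have nz: "norm (of_real (r m) * z x) \<le> r m" for m x using r by (simp add: z_def norm_mult)
  have near: "norm (S m x - Ln (1 - of_real (r m) * z x)) < 1 / (real m + 1)" for m x
    unfolding S_def by (rule N[OF nz])
  have c: "c > 0" using ab by (simp add: c_def)
  have poly: "trig_poly a b (T m)" for m
  proof -
    have im: "complex_of_real (Im w) = (w - cnj w) / (2 * \<i>)" for w
      by (simp add: complex_eq_iff complex_diff_cnj)
    have SS: "S m x - cnj (S m x) = (\<Sum>n<N m. - (of_real (r m) ^ n / of_nat n) * ch (int n) x +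
          (of_real (r m) ^ n / of_nat n) * ch (- int n) x)" for x
      unfolding S_def ch_pos ch_neg cnj_sum sum_subtractf[symmetric]
      by (intro sum.cong refl) (simp add: power_mult_distrib)
    have "T m = (\<lambda>x. of_real (a + c * pi) + of_real (2 * c) / (2 * \<i>) *
       (\<Sum>n<N m. - (of_real (r m) ^ n / of_nat n) * ch (int n) x + (of_real (r m) ^ n / of_nat n) * ch (- int n) x))"
      unfolding SS[symmetric] T_def by (intro ext) (simp add: im field_simps)
    moreover have "trig_poly a b \<dots>" unfolding ch_def
      by (intro trig_poly_add trig_poly_mult trig_poly_const trig_poly_sum trig_poly_character)
    ultimately show ?thesis by (simp only:)
  qed
  have bound: "norm (T m x) \<le> \<bar>a\<bar> + c * (pi + 2 * (1 + pi))" for m x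
  proof -
    have "norm (of_real (r m) * z x) < 1" using nz[of m x] r(2)[of m] by (rule le_less_trans)
    then have "1 - of_real (r m) * z x \<noteq> 0" by (metis norm_one less_irrefl eq_iff_diff_eq_0)
    then have "\<bar>Im (Ln (1 - of_real (r m) * z x))\<bar> \<le> pi"
      using mpi_less_Im_Ln Im_Ln_le_pi by (metis abs_le_iff less_imp_le minus_le_iff)
    moreover have "\<bar>Im (S m x - Ln (1 - of_real (r m) * z x))\<bar> \<le> 1"
    proof -
      have "1 / (real m + 1) \<le> 1" by simp
      then show ?thesis using near[of m x] abs_Im_le_cmod[of "S m x - Ln (1 - of_real (r m) * z x)"] by linarith
    qed
    ultimately have "\<bar>Im (S m x)\<bar> \<le> 1 + pi" by simp
    then have "\<bar>pi + 2 * Im (S m x)\<bar> \<le> pi + 2 * (1 + pi)"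
      using abs_triangle_ineq[of pi "2 * Im (S m x)"] by (simp only: abs_mult) simp
    then have "\<bar>c * (pi + 2 * Im (S m x))\<bar> \<le> c * (pi + 2 * (1 + pi))"
      using c by (simp only: abs_mult) (simp add: mult_left_mono)
    then show ?thesis unfolding T_def norm_of_real by linarith
  qed
  have lim: "(\<lambda>m. T m x) \<longlonglongrightarrow> of_real (x $ i)" if "x \<in> box (vec a) (vec b)" for x :: "real^'n"
  proof -
    define \<phi> where "\<phi> = 2 * pi * (x $ i - a) / (b - a)"
    have xi: "a < x $ i" "x $ i < b" using that by (auto simp: mem_box_cart)
    have ph: "0 < \<phi>" "\<phi> < 2 * pi" using xi ab by (auto simp: \<phi>_def field_simps)
    note LL = Im_Ln_one_minus_cis[OF ph]
    have zx: "z x = cis \<phi>" by (simp add: z_def \<phi>_def)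
    have "r \<longlonglongrightarrow> 1 - 0"
    proof -
      have "(\<lambda>m. 1 / (real m + 2)) \<longlonglongrightarrow> 0"
        using LIMSEQ_Suc[OF LIMSEQ_inverse_real_of_nat] by (simp add: inverse_eq_divide add.commute)
      then show ?thesis unfolding r_def by (intro tendsto_intros)
    qed
    then have "(\<lambda>m. 1 - of_real (r m) * z x) \<longlonglongrightarrow> 1 - of_real 1 * z x"
      by (intro tendsto_intros) simp
    then have L1: "(\<lambda>m. Ln (1 - of_real (r m) * z x)) \<longlonglongrightarrow> Ln (1 - z x)"
      using LL(2) by (intro tendsto_Ln) (auto simp: zx)
    have "(\<lambda>m. S m x - Ln (1 - of_real (r m) * z x)) \<longlonglongrightarrow> 0"
    proof (rule Lim_null_comparison)
      show "\<forall>\<^sub>F m in sequentially. norm (S m x - Ln (1 - of_real (r m) * z x)) \<le> 1 / (real m + 1)"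
        using near by (intro always_eventually allI less_imp_le)
      show "(\<lambda>m. 1 / (real m + 1)) \<longlonglongrightarrow> 0"
        using LIMSEQ_inverse_real_of_nat by (simp add: inverse_eq_divide add.commute)
    qed
    from tendsto_add[OF this L1] have "(\<lambda>m. S m x) \<longlonglongrightarrow> Ln (1 - z x)" by simp
    then have "(\<lambda>m. T m x) \<longlonglongrightarrow> of_real (a + c * (pi + 2 * Im (Ln (1 - z x))))"
      unfolding T_def by (intro tendsto_intros)
    also have "a + c * (pi + 2 * Im (Ln (1 - z x))) = x $ i"
    proof -
      have "c * \<phi> = x $ i - a" using ab by (simp add: c_def \<phi>_def)
      moreover have "pi + 2 * ((\<phi> - pi) / 2) = \<phi>" by (simp add: field_simps)
      ultimately show ?thesis unfolding zx LL(1) by simp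
    qed
    finally show ?thesis .
  qed
  show ?thesis unfolding trig_limit_def
    by (intro exI[of _ T] exI[of _ "\<bar>a\<bar> + c * (pi + 2 * (1 + pi))"]) (use poly bound lim in blast)
qed

text \<open>Linear functions are combinations of coordinates; the rest is closure under sums and
  products.\<close>

lemma trig_limit_polynomial:
  fixes p :: "real^'n::finite \<Rightarrow> real"
  assumes ab: "a < b" and "real_polynomial_function p"
  shows "trig_limit a b (\<lambda>x. complex_of_real (p x))"
  using assms(2)
proof induction
  case (linear f)
  interpret bounded_linear f by fact
  have lin: "f x = (\<Sum>i\<in>UNIV. x $ i * f (axis i 1))" for x
  proof -
    have "x = (\<Sum>i\<in>UNIV. x $ i *\<^sub>R axis i 1)"
      using basis_expansion[of x] by (simp add: scalar_mult_eq_scaleR)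
    then have "f x = f (\<Sum>i\<in>UNIV. x $ i *\<^sub>R axis i 1)" by simp
    then show ?thesis by (simp add: sum scaleR)
  qed
  have "(\<lambda>x. complex_of_real (f x)) = (\<lambda>x. \<Sum>i\<in>UNIV. of_real (x $ i) * of_real (f (axis i 1)))"
    by (intro ext, subst lin) simp
  then show ?case
    by (auto intro!: trig_limit_sum trig_limit_mult trig_limit_const trig_limit_coordinate[OF ab])
qed (auto intro: trig_limit_const trig_limit_add trig_limit_mult)

section \<open>Completeness of the exponentials in L2\<close>

definition L2_approx :: "real \<Rightarrow> real \<Rightarrow> (real^'n::finite \<Rightarrow> complex) \<Rightarrow> bool" where
  "L2_approx a b f \<longleftrightarrow> f \<in> L2_space (cube_measure a b) \<and>
     (\<forall>\<epsilon>>0. \<exists>T. trig_poly a b T \<and> L2_norm (cube_measure a b) (\<lambda>x. f x - T x) < \<epsilon>)"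

lemma AE_cube_box: "AE x in cube_measure a b. x \<in> box (vec a) (vec b :: real^'n::finite)"
proof -
  have "negligible (cube a b - box (vec a) (vec b) :: (real^'n) set)"
    unfolding cube_def by (metis frontier_cbox negligible_frontier_interval)
  then have "AE x in lebesgue. x \<notin> cube a b - (box (vec a) (vec b) :: (real^'n) set)"
    by (intro AE_not_in) (simp add: negligible_iff_null_sets)
  then have "AE x in lebesgue. x \<in> cube a b \<longrightarrow> x \<in> (box (vec a) (vec b) :: (real^'n) set)"
    by eventually_elim auto
  then show ?thesis by (simp add: AE_restrict_space_iff)
qed

lemma L2_approx_limit:
  assumes f: "f \<in> L2_space (cube_measure a b)"
    and g: "\<And>\<epsilon>. \<epsilon> > 0 \<Longrightarrow> \<exists>g. L2_approx a b g \<and> L2_norm (cube_measure a b) (\<lambda>x. f x - g x) < \<epsilon>"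
  shows "L2_approx a b f"
  unfolding L2_approx_def
proof (intro conjI allI impI f)
  fix \<epsilon> :: real assume "\<epsilon> > 0"
  then have h: "\<epsilon> / 2 > 0" by simp
  obtain g where g: "L2_approx a b g" "L2_norm (cube_measure a b) (\<lambda>x. f x - g x) < \<epsilon> / 2"
    using g[OF h] by blast
  obtain T where T: "trig_poly a b T" "L2_norm (cube_measure a b) (\<lambda>x. g x - T x) < \<epsilon> / 2"
    using g(1) h unfolding L2_approx_def by blast
  have "L2_norm (cube_measure a b) (\<lambda>x. f x - T x) \<le>
     L2_norm (cube_measure a b) (\<lambda>x. f x - g x) + L2_norm (cube_measure a b) (\<lambda>x. g x - T x)"
    using g(1) by (intro L2_norm_diff_triangle f trig_poly_L2[OF T(1)]) (simp add: L2_approx_def)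
  then show "\<exists>T. trig_poly a b T \<and> L2_norm (cube_measure a b) (\<lambda>x. f x - T x) < \<epsilon>"
    using g T by (intro exI[of _ T]) auto
qed

lemma L2_approx_trig_limit:
  fixes f :: "real^'n::finite \<Rightarrow> complex"
  assumes f: "trig_limit a b f" "f \<in> L2_space (cube_measure a b)"
  shows "L2_approx a b f"
  unfolding L2_approx_def
proof (intro conjI allI impI f)
  fix \<epsilon> :: real assume e: "\<epsilon> > 0"
  obtain T C where T: "\<And>m. trig_poly a b (T m)" "\<And>m x. norm (T m x) \<le> C"
      "\<And>x. x \<in> box (vec a) (vec b) \<Longrightarrow> (\<lambda>m::nat. T m x) \<longlonglongrightarrow> f x"
    using f(1) unfolding trig_limit_def by metis
  have fC: "norm (f x) \<le> C" if "x \<in> box (vec a) (vec b)" for x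
    using T(2) by (intro LIMSEQ_le_const2[OF tendsto_norm[OF T(3)[OF that]]]) auto
  interpret finite_measure "cube_measure a b :: (real^'n) measure" by (rule finite_measure_cube)
  have "\<exists>m. L2_norm (cube_measure a b) (\<lambda>x. f x - T m x) < \<epsilon>"
  proof (rule L2_approx_dominated[OF _ f(2)])
    show "integrable (cube_measure a b :: (real^'n) measure) (\<lambda>x. (C + C)\<^sup>2)" by (rule integrable_const)
    show "AE x in cube_measure a b. (norm (f x - T m x))\<^sup>2 \<le> (C + C)\<^sup>2" for m
      using AE_cube_box
      by eventually_elim (intro power_mono order_trans[OF norm_triangle_ineq4] add_mono fC T; simp)
    show "AE x in cube_measure a b. (\<lambda>m. T m x) \<longlonglongrightarrow> f x"
      using AE_cube_box by eventually_elim (rule T)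
    show "T m \<in> L2_space (cube_measure a b)" for m by (rule trig_poly_L2[OF T(1)])
  qed (rule e)
  then show "\<exists>T. trig_poly a b T \<and> L2_norm (cube_measure a b) (\<lambda>x. f x - T x) < \<epsilon>"
    using T by blast
qed

text \<open>Stone-Weierstrass is applied with algebraic polynomials, since f need not match on
  opposite faces; those are bounded limits of trigonometric ones. Real and imaginary parts are
  approximated separately.\<close>

lemma L2_approx_continuous:
  fixes f :: "real^'n::finite \<Rightarrow> complex"
  assumes ab: "a < b" and f: "continuous_on UNIV f"
  shows "L2_approx a b f"
proof (rule L2_approx_limit)
  let ?M = "cube_measure a b :: (real^'n) measure"
  have comp: "compact (cube a b :: (real^'n) set)" by (simp add: cube_def)
  have cf: "continuous_on (cube a b) f" using f continuous_on_subset by blast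
  obtain C where C: "\<And>x. x \<in> cube a b \<Longrightarrow> norm (f x) \<le> C"
    using compact_imp_bounded[OF compact_continuous_image[OF cf comp]] unfolding bounded_iff by auto
  show fL2: "f \<in> L2_space ?M"
    using C by (intro L2_cubeI_bounded borel_measurable_cube_continuous f)
  fix \<epsilon> :: real assume e: "\<epsilon> > 0"
  interpret finite_measure ?M by (rule finite_measure_cube)
  define V where "V = measure ?M (space ?M)"
  \<comment> \<open>A uniform error d on a set of measure \<open>V\<close> gives a squared L2 error
    of at most V d^2; \<open>V + 1\<close> keeps the denominator positive.\<close>
  define d where "d = \<epsilon> / (2 * sqrt (V + 1))"
  have V: "V \<ge> 0" by (simp add: V_def)
  then have d: "d > 0" using e by (simp add: d_def)
  obtain p where p: "real_polynomial_function p" "\<And>x. x \<in> cube a b \<Longrightarrow> \<bar>Re (f x) - p x\<bar> < d / 2"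
    using Stone_Weierstrass_real_polynomial_function[OF comp, of "\<lambda>x. Re (f x)" "d / 2"] d cf
    by (metis continuous_on_Re half_gt_zero)
  obtain q where q: "real_polynomial_function q" "\<And>x. x \<in> cube a b \<Longrightarrow> \<bar>Im (f x) - q x\<bar> < d / 2"
    using Stone_Weierstrass_real_polynomial_function[OF comp, of "\<lambda>x. Im (f x)" "d / 2"] d cf
    by (metis continuous_on_Im half_gt_zero)
  define g where "g x = complex_of_real (p x) + \<i> * complex_of_real (q x)" for x
  have cg: "continuous_on UNIV g" unfolding g_def
    using p q by (intro continuous_intros continuous_on_polymonial_function) (auto simp: real_polynomial_function_eq)
  obtain C' where C': "\<And>x. x \<in> cube a b \<Longrightarrow> norm (g x) \<le> C'"
    using compact_imp_bounded[OF compact_continuous_image[OF continuous_on_subset[OF cg] comp]] unfolding bounded_iff by auto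
  have gL2: "g \<in> L2_space ?M"
    using C' by (intro L2_cubeI_bounded borel_measurable_cube_continuous cg)
  have "trig_limit a b g" unfolding g_def
    by (intro trig_limit_add trig_limit_mult trig_limit_const trig_limit_polynomial ab p q)
  then have g: "L2_approx a b g" using gL2 by (rule L2_approx_trig_limit)
  have near: "norm (f x - g x) \<le> d" if "x \<in> cube a b" for x
  proof -
    have "norm (f x - g x) \<le> \<bar>Re (f x - g x)\<bar> + \<bar>Im (f x - g x)\<bar>" by (rule cmod_le)
    then show ?thesis using p(2)[OF that] q(2)[OF that] by (simp add: g_def)
  qed
  have "(LINT x|?M. (norm (f x - g x))\<^sup>2) \<le> (LINT x|?M. d\<^sup>2)"
    using near L2_space_diff[OF fL2 gL2]
    by (intro integral_mono) (auto simp: L2_space_def intro!: power_mono)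
  also have "\<dots> = V * d\<^sup>2" by (simp add: V_def)
  also have "\<dots> \<le> (V + 1) * d\<^sup>2" by (intro mult_right_mono) auto
  also have "\<dots> = (\<epsilon> / 2)\<^sup>2"
  proof -
    have "d\<^sup>2 = (\<epsilon> / 2)\<^sup>2 / (V + 1)" using V by (simp add: d_def power_divide power_mult_distrib)
    then show ?thesis using V by simp
  qed
  finally have "(L2_norm ?M (\<lambda>x. f x - g x))\<^sup>2 \<le> (\<epsilon> / 2)\<^sup>2" by (simp add: L2_norm_power2)
  then have "L2_norm ?M (\<lambda>x. f x - g x) \<le> \<epsilon> / 2"
    by (rule power2_le_imp_le) (use e in simp)
  then show "\<exists>g. L2_approx a b g \<and> L2_norm ?M (\<lambda>x. f x - g x) < \<epsilon>"
    using g e by (intro exI[of _ g]) auto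
qed

text \<open>\<open>measurable_on\<close> provides continuous functions converging almost everywhere;
  composing them with the radial projection \<open>cl\<close> onto the ball of radius
  \<open>R\<close> gives a common bound and leaves the limit unchanged.\<close>

lemma L2_approx_bounded:
  fixes f :: "real^'n::finite \<Rightarrow> complex"
  assumes ab: "a < b" and f: "f \<in> borel_measurable (cube_measure a b)" and R: "R > 0"
    and fR: "\<And>x. norm (f x) \<le> R"
  shows "L2_approx a b f"
proof (rule L2_approx_limit)
  let ?M = "cube_measure a b :: (real^'n) measure"
  show fL2: "f \<in> L2_space ?M" using f fR by (intro L2_cubeI_bounded)
  fix \<epsilon> :: real assume e: "\<epsilon> > 0"
  interpret finite_measure ?M by (rule finite_measure_cube)
  have "f measurable_on (cube a b)"
    using f by (simp add: measurable_on_iff_borel_measurable)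
  then obtain N g where N: "negligible N" and g: "\<And>n. continuous_on UNIV (g n)"
    and lim: "\<And>x. x \<notin> N \<Longrightarrow> (\<lambda>n::nat. g n x) \<longlonglongrightarrow> (if x \<in> cube a b then f x else 0)"
    unfolding measurable_on_def by blast
  define cl where "cl z = z * of_real (R / max R (norm z))" for z :: complex
  have cl_cont: "continuous_on UNIV cl"
    unfolding cl_def using R by (intro continuous_intros) (auto simp: max_def)
  have cl_le: "norm (cl z) \<le> R" for z
  proof -
    have "norm z * (R / max R (norm z)) \<le> R" using R by (auto simp: max_def field_simps)
    then show ?thesis using R by (simp only: cl_def norm_mult norm_of_real) simp
  qed
  have cl_id: "cl z = z" if "norm z \<le> R" for z using that R by (simp add: cl_def max_absorb1)
  define s where "s n x = cl (g n x)" for n x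
  have cs: "continuous_on UNIV (s n)" for n
    unfolding s_def by (rule continuous_on_compose2[OF cl_cont g]) auto
  have "\<exists>m. L2_norm ?M (\<lambda>x. f x - s m x) < \<epsilon>"
  proof (rule L2_approx_dominated[OF _ fL2])
    show "s m \<in> L2_space ?M" for m
      by (rule L2_cubeI_bounded[where C = R]) (auto intro: borel_measurable_cube_continuous cs simp: s_def cl_le)
    show "integrable ?M (\<lambda>x. (R + R)\<^sup>2)" by (rule integrable_const)
    show "AE x in ?M. (norm (f x - s m x))\<^sup>2 \<le> (R + R)\<^sup>2" for m
      by (intro AE_I2 power_mono order_trans[OF norm_triangle_ineq4] add_mono fR) (auto simp: s_def cl_le)
    have "AE x in lebesgue. x \<notin> N" using N by (simp add: negligible_iff_null_sets AE_not_in)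
    then have "AE x in lebesgue. x \<in> cube a b \<longrightarrow> (x \<in> cube a b \<longrightarrow> x \<notin> N)"
      by eventually_elim simp
    then have "AE x in ?M. x \<in> cube a b \<longrightarrow> x \<notin> N"
      by (simp add: AE_restrict_space_iff)
    moreover have "AE x in ?M. x \<in> cube a b" by (rule AE_I2) simp
    ultimately show "AE x in ?M. (\<lambda>m. s m x) \<longlonglongrightarrow> f x"
    proof eventually_elim
      case (elim x)
      then have "(\<lambda>n. g n x) \<longlonglongrightarrow> f x" using lim[of x] by simp
      then have "(\<lambda>n. cl (g n x)) \<longlonglongrightarrow> cl (f x)"
        using cl_cont by (intro isCont_tendsto_compose[of _ cl]) (auto simp: continuous_on_eq_continuous_at)
      then show ?case using cl_id fR by (simp add: s_def)
    qed
  qed (use e in auto)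
  then show "\<exists>g. L2_approx a b g \<and> L2_norm ?M (\<lambda>x. f x - g x) < \<epsilon>"
    using L2_approx_continuous[OF ab cs] by blast
qed

text \<open>Replacing f by 0 where its modulus exceeds m + 1 reduces to bounded functions; |f|^2
  dominates the squared errors.\<close>

lemma L2_approx_all:
  fixes f :: "real^'n::finite \<Rightarrow> complex"
  assumes ab: "a < b" and f: "f \<in> L2_space (cube_measure a b)"
  shows "L2_approx a b f"
proof (rule L2_approx_limit[OF f])
  let ?M = "cube_measure a b :: (real^'n) measure"
  fix \<epsilon> :: real assume e: "\<epsilon> > 0"
  define s where "s m x = (if norm (f x) \<le> real m + 1 then f x else 0)" for m :: nat and x
  have [measurable]: "f \<in> borel_measurable ?M" using f by (simp add: L2_space_def)
  have sm: "s m \<in> borel_measurable ?M" for m unfolding s_def by measurable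
  have sR: "norm (s m x) \<le> real m + 1" for m x by (simp add: s_def)
  have sA: "L2_approx a b (s m)" for m by (rule L2_approx_bounded[OF ab sm _ sR]) simp
  have "\<exists>m. L2_norm ?M (\<lambda>x. f x - s m x) < \<epsilon>"
  proof (rule L2_approx_dominated[OF _ f])
    show "s m \<in> L2_space ?M" for m using sA by (simp add: L2_approx_def)
    show "integrable ?M (\<lambda>x. (norm (f x))\<^sup>2)" using f by (simp add: L2_space_def)
    show "AE x in ?M. (norm (f x - s m x))\<^sup>2 \<le> (norm (f x))\<^sup>2" for m
      by (rule AE_I2) (simp add: s_def)
    show "AE x in ?M. (\<lambda>m. s m x) \<longlonglongrightarrow> f x"
    proof (rule AE_I2)
      fix x
      obtain m0 :: nat where "norm (f x) \<le> real m0" using real_arch_simple by blast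
      then have "\<forall>\<^sub>F m in sequentially. s m x = f x"
        by (auto simp: eventually_sequentially s_def intro!: exI[of _ m0])
      then show "(\<lambda>m. s m x) \<longlonglongrightarrow> f x" by (rule tendsto_eventually)
    qed
  qed (use e in auto)
  then show "\<exists>g. L2_approx a b g \<and> L2_norm ?M (\<lambda>x. f x - g x) < \<epsilon>" using sA by blast
qed

section \<open>Bessel and Parseval for Fourier coefficients\<close>

lemma fourier_Bessel:
  assumes ab: "a < b" and f: "f \<in> L2_space (cube_measure a b)" and K: "finite K"
  shows "(\<Sum>k\<in>K. (norm (fourier a b f k))\<^sup>2) \<le> (L2_norm (cube_measure a b) f)\<^sup>2"
  unfolding fourier_def
  by (rule L2_Bessel[OF K trig_L2 f]) (rule trig_orthonormal[OF ab])

text \<open>The converse half of Bessel: by the completed square, the Fourier coefficients do at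
  least as well as the coefficients of a close trigonometric polynomial.\<close>

lemma fourier_Parseval:
  fixes f :: "real^'n::finite \<Rightarrow> complex"
  assumes ab: "a < b" and f: "f \<in> L2_space (cube_measure a b)" and e: "\<epsilon> > 0"
  shows "\<exists>K. finite K \<and> (L2_norm (cube_measure a b) f)\<^sup>2 \<le> (\<Sum>k\<in>K. (norm (fourier a b f k))\<^sup>2) + \<epsilon>"
proof -
  have "\<exists>T. trig_poly a b T \<and> L2_norm (cube_measure a b) (\<lambda>x. f x - T x) < sqrt \<epsilon>"
    using L2_approx_all[OF ab f] e by (simp add: L2_approx_def)
  then obtain K c where K: "finite K"
    and lt: "L2_norm (cube_measure a b) (\<lambda>x. f x - (\<Sum>k\<in>K. c k * character a b k x)) < sqrt \<epsilon>"
    unfolding trig_poly_def by auto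
  define d where "d k = c k * of_real (sqrt (b - a) ^ CARD('n))" for k
  have "(\<Sum>k\<in>K. c k * character a b k x) = (\<Sum>k\<in>K. d k * trig a b k x)" for x
    using ab by (simp add: d_def trig_def)
  with lt have "L2_norm (cube_measure a b) (\<lambda>x. f x - (\<Sum>k\<in>K. d k * trig a b k x)) < sqrt \<epsilon>" by simp
  then have "(L2_norm (cube_measure a b) (\<lambda>x. f x - (\<Sum>k\<in>K. d k * trig a b k x)))\<^sup>2 \<le> (sqrt \<epsilon>)\<^sup>2"
    by (intro power_mono L2_norm_nonneg) simp
  moreover have "(L2_norm (cube_measure a b) (\<lambda>x. f x - (\<Sum>k\<in>K. d k * trig a b k x)))\<^sup>2 =
     (L2_norm (cube_measure a b) f)\<^sup>2 - (\<Sum>k\<in>K. (norm (fourier a b f k))\<^sup>2) + (\<Sum>k\<in>K. (norm (fourier a b f k - d k))\<^sup>2)"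
    unfolding fourier_def
    by (rule L2_orthonormal_expansion(2)[OF K trig_L2 f]) (rule trig_orthonormal[OF ab])
  moreover have "0 \<le> (\<Sum>k\<in>K. (norm (fourier a b f k - d k))\<^sup>2)" by (intro sum_nonneg) auto
  ultimately have "(L2_norm (cube_measure a b) f)\<^sup>2 \<le> (\<Sum>k\<in>K. (norm (fourier a b f k))\<^sup>2) + \<epsilon>"
    using e by simp
  then show ?thesis using K by blast
qed

text \<open>Turns a bound on all finite coefficient sums into a norm bound. Approximation errors and
  different representatives of a weak derivative are both handled through it.\<close>

lemma fourier_bounded_imp_norm_le:
  fixes f :: "real^'n::finite \<Rightarrow> complex"
  assumes ab: "a < b" and f: "f \<in> L2_space (cube_measure a b)"
    and B: "\<And>K. finite K \<Longrightarrow> (\<Sum>k\<in>K. (norm (fourier a b f k))\<^sup>2) \<le> B"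
  shows "(L2_norm (cube_measure a b) f)\<^sup>2 \<le> B"
proof (rule field_le_epsilon)
  fix e :: real assume "e > 0"
  then obtain K where "finite K" "(L2_norm (cube_measure a b) f)\<^sup>2 \<le> (\<Sum>k\<in>K. (norm (fourier a b f k))\<^sup>2) + e"
    using fourier_Parseval[OF ab f] by blast
  then show "(L2_norm (cube_measure a b) f)\<^sup>2 \<le> B + e" using B[of K] by linarith
qed

lemma fourier_eq_imp_norm_eq:
  fixes f :: "real^'n::finite \<Rightarrow> complex"
  assumes ab: "a < b" and f: "f \<in> L2_space (cube_measure a b)" and g: "g \<in> L2_space (cube_measure a b)"
    and eq: "\<And>k. fourier a b f k = fourier a b g k"
  shows "L2_norm (cube_measure a b) f = L2_norm (cube_measure a b) g"
    and "L2_norm (cube_measure a b) (\<lambda>x. f x - g x) = 0"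
proof -
  have "(L2_norm (cube_measure a b) f)\<^sup>2 \<le> (L2_norm (cube_measure a b) g)\<^sup>2"
    by (rule fourier_bounded_imp_norm_le[OF ab f]) (simp add: eq fourier_Bessel[OF ab g])
  moreover have "(L2_norm (cube_measure a b) g)\<^sup>2 \<le> (L2_norm (cube_measure a b) f)\<^sup>2"
    by (rule fourier_bounded_imp_norm_le[OF ab g]) (simp add: eq[symmetric] fourier_Bessel[OF ab f])
  ultimately show "L2_norm (cube_measure a b) f = L2_norm (cube_measure a b) g"
    by (simp add: L2_norm_nonneg power2_eq_iff_nonneg)
  have "(L2_norm (cube_measure a b) (\<lambda>x. f x - g x))\<^sup>2 \<le> 0"
  proof (rule fourier_bounded_imp_norm_le[OF ab L2_space_diff[OF f g]])
    fix K :: "('n \<Rightarrow> int) set"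
    have "fourier a b (\<lambda>x. f x - g x) k = 0" for k
      using eq[of k] f g by (simp add: fourier_def L2_inner_diff_left trig_L2)
    then show "(\<Sum>k\<in>K. (norm (fourier a b (\<lambda>x. f x - g x) k))\<^sup>2) \<le> 0" by simp
  qed
  then show "L2_norm (cube_measure a b) (\<lambda>x. f x - g x) = 0" by simp
qed

section \<open>Smooth functions of one variable and cutoffs\<close>

section \<open>Smooth cutoff functions\<close>

text \<open>The coinductive form makes smoothness a one-step check: any family of functions closed
  under differentiation consists of smooth functions.\<close>

coinductive smooth :: "(real \<Rightarrow> complex) \<Rightarrow> bool" where
  smoothI: "(\<And>t. (f has_vector_derivative g t) (at t)) \<Longrightarrow> smooth g \<Longrightarrow> smooth f"

definition vderiv :: "(real \<Rightarrow> complex) \<Rightarrow> real \<Rightarrow> complex" where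
  "vderiv f t = vector_derivative f (at t)"

lemma vderiv_eqI: "(\<And>t. (f has_vector_derivative g t) (at t)) \<Longrightarrow> vderiv f = g"
  by (auto simp: vderiv_def intro!: ext vector_derivative_at)

lemma smooth_vderiv:
  assumes "smooth f"
  shows "(f has_vector_derivative vderiv f t) (at t)" and "smooth (vderiv f)"
proof -
  obtain g where g: "\<And>t. (f has_vector_derivative g t) (at t)" "smooth g"
    using assms by (cases rule: smooth.cases) blast
  then have "vderiv f = g" by (intro vderiv_eqI)
  with g show "(f has_vector_derivative vderiv f t) (at t)" "smooth (vderiv f)" by simp_all
qed

lemma smooth_vderiv_funpow: "smooth f \<Longrightarrow> smooth ((vderiv ^^ n) f)"
  by (induction n) (auto intro: smooth_vderiv)

lemma smooth_continuous: "smooth f \<Longrightarrow> continuous_on S f"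
  by (intro continuous_at_imp_continuous_on ballI) (rule has_vector_derivative_continuous[OF smooth_vderiv(1)])

lemma smooth_coinduct_closed:
  assumes "X f" and "\<And>f. X f \<Longrightarrow> \<exists>g. (\<forall>t. (f has_vector_derivative g t) (at t)) \<and> X g"
  shows "smooth f"
  using assms(1)
proof (coinduction arbitrary: f rule: smooth.coinduct)
  case smooth
  then show ?case using assms(2) by blast
qed

text \<open>The derivative of a product is a sum of products, so a family of products alone is not
  closed under differentiation. The algebra generated by the smooth functions is, by the Leibniz
  rule.\<close>

inductive smooth_alg :: "(real \<Rightarrow> complex) \<Rightarrow> bool" where
  base: "smooth f \<Longrightarrow> smooth_alg f"
| add: "smooth_alg f \<Longrightarrow> smooth_alg g \<Longrightarrow> smooth_alg (\<lambda>t. f t + g t)"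
| mult: "smooth_alg f \<Longrightarrow> smooth_alg g \<Longrightarrow> smooth_alg (\<lambda>t. f t * g t)"

lemma smooth_algD: "smooth_alg f \<Longrightarrow> smooth f"
proof (rule smooth_coinduct_closed[where X = smooth_alg])
  fix f assume "smooth_alg f"
  then show "\<exists>g. (\<forall>t. (f has_vector_derivative g t) (at t)) \<and> smooth_alg g"
  proof induction
    case (base f)
    then show ?case using smooth_vderiv smooth_alg.base by blast
  next
    case (add f g)
    then obtain f' g' where "\<And>t. (f has_vector_derivative f' t) (at t)" "smooth_alg f'"
      "\<And>t. (g has_vector_derivative g' t) (at t)" "smooth_alg g'" by blast
    then show ?case
      by (intro exI[of _ "\<lambda>t. f' t + g' t"]) (auto intro!: smooth_alg.add has_vector_derivative_add)
  next
    case (mult f g)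
    then obtain f' g' where "\<And>t. (f has_vector_derivative f' t) (at t)" "smooth_alg f'"
      "\<And>t. (g has_vector_derivative g' t) (at t)" "smooth_alg g'" by blast
    then show ?case using mult.hyps
      by (intro exI[of _ "\<lambda>t. f t * g' t + f' t * g t"])
         (auto intro!: smooth_alg.add smooth_alg.mult has_vector_derivative_mult)
  qed
qed

lemma smooth_add: "smooth f \<Longrightarrow> smooth g \<Longrightarrow> smooth (\<lambda>t. f t + g t)"
  by (rule smooth_algD, rule smooth_alg.add) (rule smooth_alg.base, assumption)+

lemma smooth_mult: "smooth f \<Longrightarrow> smooth g \<Longrightarrow> smooth (\<lambda>t. f t * g t)"
  by (rule smooth_algD, rule smooth_alg.mult) (rule smooth_alg.base, assumption)+

lemma smooth_const: "smooth (\<lambda>t. c)"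
  by (rule smooth_coinduct_closed[where X = "\<lambda>f. \<exists>c. f = (\<lambda>t. c)"]) (auto intro!: exI[of _ "\<lambda>t. 0"])

lemma smooth_exp: "smooth (\<lambda>t. exp (w * of_real (t - a)))"
proof (rule smooth_coinduct_closed[where X = "\<lambda>f. \<exists>c. f = (\<lambda>t. c * exp (w * of_real (t - a)))"])
  fix f assume "\<exists>c. f = (\<lambda>t. c * exp (w * of_real (t - a)))"
  then obtain c where f: "f = (\<lambda>t. c * exp (w * of_real (t - a)))" by blast
  have "(f has_vector_derivative (c * w) * exp (w * of_real (t - a))) (at t)" for t
  proof -
    have "((\<lambda>z. c * exp (w * (z - of_real a))) has_field_derivative
       (c * w) * exp (w * (of_real t - of_real a))) (at (of_real t))"
      by (auto intro!: derivative_eq_intros)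
    from has_vector_derivative_real_field[OF this] show ?thesis unfolding f of_real_diff .
  qed
  then show "\<exists>g. (\<forall>t. (f has_vector_derivative g t) (at t)) \<and> (\<exists>c. g = (\<lambda>t. c * exp (w * of_real (t - a))))"
    by (intro exI[of _ "\<lambda>t. (c * w) * exp (w * of_real (t - a))"]) blast
qed (auto intro: exI[of _ 1])

lemma smooth_affine:
  assumes "smooth f"
  shows "smooth (\<lambda>t. f (c * t + d))"
\<comment> \<open>The constant \<open>C\<close> absorbs the factor \<open>c\<close> that each
  differentiation produces.\<close>
proof (rule smooth_coinduct_closed[where X = "\<lambda>g. \<exists>C h. smooth h \<and> g = (\<lambda>t. C * h (c * t + d))"])
  fix g assume "\<exists>C h. smooth h \<and> g = (\<lambda>t. C * h (c * t + d))"
  then obtain C h where h: "smooth h" and g: "g = (\<lambda>t. C * h (c * t + d))" by blast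
  have "(g has_vector_derivative (C * of_real c) * vderiv h (c * t + d)) (at t)" for t
  proof -
    have "((\<lambda>t. c * t + d) has_vector_derivative c) (at t)"
      by (auto intro!: derivative_eq_intros simp: has_real_derivative_iff_has_vector_derivative[symmetric])
    from vector_diff_chain_at[OF this smooth_vderiv(1)[OF h]]
    have "((\<lambda>t. h (c * t + d)) has_vector_derivative (c *\<^sub>R vderiv h (c * t + d))) (at t)"
      by (simp add: o_def)
    from has_vector_derivative_mult_right[OF this, of C] show ?thesis
      unfolding g by (simp add: scaleR_conv_of_real mult_ac)
  qed
  then show "\<exists>g'. (\<forall>t. (g has_vector_derivative g' t) (at t)) \<and> (\<exists>C h. smooth h \<and> g' = (\<lambda>t. C * h (c * t + d)))"
    using smooth_vderiv(2)[OF h] by (intro exI[of _ "\<lambda>t. (C * of_real c) * vderiv h (c * t + d)"]) blast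
next
  show "\<exists>C h. smooth h \<and> (\<lambda>t. f (c * t + d)) = (\<lambda>t. C * h (c * t + d))"
    using assms by (intro exI[of _ 1] exI[of _ f]) simp
qed

text \<open>The family p(1/t) exp(-1/t), closed under differentiation: the derivative belongs to the
  polynomial y^2 (p - p'). The classical exp(-1/t) is \<open>flat 1\<close>, with derivative
  \<open>flat (monom 1 2)\<close>.\<close>

definition flat :: "real poly \<Rightarrow> real \<Rightarrow> real" where
  "flat p t = (if t > 0 then poly p (1 / t) * exp (- (1 / t)) else 0)"

lemma flat_tendsto_0: "(flat p \<longlongrightarrow> 0) (at 0)"
proof (rule filterlim_split_at)
  show "(flat p \<longlongrightarrow> 0) (at_left 0)"
  proof (rule tendsto_eventually)
    show "\<forall>\<^sub>F t in at_left 0. flat p t = 0"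
      by (auto simp: flat_def eventually_at_left_field intro!: exI[of _ "-1"])
  qed
  have pow: "((\<lambda>y. poly p y * exp (- y)) \<longlongrightarrow> 0) at_top"
  proof -
    have "((\<lambda>y. \<Sum>i\<le>degree p. coeff p i * (y ^ i / exp y)) \<longlongrightarrow> (\<Sum>i\<le>degree p. coeff p i * 0)) at_top"
      by (intro tendsto_intros tendsto_power_div_exp_0)
    then show ?thesis by (simp add: poly_altdef sum_distrib_right exp_minus divide_inverse mult.assoc)
  qed
  have "((\<lambda>t. poly p (inverse t) * exp (- inverse t)) \<longlongrightarrow> 0) (at_right 0)"
    by (rule filterlim_compose[OF pow filterlim_inverse_at_top_right])
  then show "(flat p \<longlongrightarrow> 0) (at_right 0)"
  proof (rule Lim_transform_eventually)
    show "\<forall>\<^sub>F t in at_right 0. poly p (inverse t) * exp (- inverse t) = flat p t"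
      by (auto simp: flat_def eventually_at_right_field inverse_eq_divide intro!: exI[of _ 1])
  qed
qed

lemma flat_deriv: "(flat p has_real_derivative flat (monom 1 2 * (p - pderiv p)) t) (at t)"
proof -
  consider "t > 0" | "t < 0" | "t = 0" by linarith
  then show ?thesis
  proof cases
    case 1
    have "((\<lambda>t. poly p (1 / t) * exp (- (1 / t))) has_real_derivative
       flat (monom 1 2 * (p - pderiv p)) t) (at t)"
    proof -
      have inv: "((\<lambda>t. 1 / t) has_real_derivative - (1 / t\<^sup>2)) (at t)"
        using 1 by (auto intro!: derivative_eq_intros simp: power2_eq_square)
      have "((\<lambda>t. poly p (1 / t) * exp (- (1 / t))) has_real_derivative
         poly (pderiv p) (1 / t) * - (1 / t\<^sup>2) * exp (- (1 / t)) + exp (- (1 / t)) * - (- (1 / t\<^sup>2)) * poly p (1 / t)) (at t)"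
        by (intro DERIV_mult DERIV_chain2[OF poly_DERIV inv] DERIV_chain2[OF DERIV_exp DERIV_minus[OF inv]])
      moreover have "poly (pderiv p) (1 / t) * - (1 / t\<^sup>2) * exp (- (1 / t)) + exp (- (1 / t)) * - (- (1 / t\<^sup>2)) * poly p (1 / t)
         = flat (monom 1 2 * (p - pderiv p)) t"
        using 1 by (simp add: flat_def poly_monom power_one_over algebra_simps)
      ultimately show ?thesis by (simp only:)
    qed
    moreover have "\<forall>\<^sub>F u in nhds t. poly p (1 / u) * exp (- (1 / u)) = flat p u"
    proof (rule eventually_mono)
      show "\<forall>\<^sub>F u in nhds t. u \<in> {0<..}" using 1 by (intro eventually_nhds_in_open) auto
    qed (simp add: flat_def)
    ultimately show ?thesis by (rule DERIV_cong_ev[OF refl _ refl, THEN iffD1, rotated])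
  next
    case 2
    have "((\<lambda>t. 0) has_real_derivative flat (monom 1 2 * (p - pderiv p)) t) (at t)"
      using 2 by (simp add: flat_def)
    moreover have "\<forall>\<^sub>F u in nhds t. 0 = flat p u"
    proof (rule eventually_mono)
      show "\<forall>\<^sub>F u in nhds t. u \<in> {..<0}" using 2 by (intro eventually_nhds_in_open) auto
    qed (simp add: flat_def)
    ultimately show ?thesis by (rule DERIV_cong_ev[OF refl _ refl, THEN iffD1, rotated])
  next
    case 3
    \<comment> \<open>Dividing by h multiplies the polynomial in 1/h by its variable, so the
      difference quotient at 0 stays in the family.\<close>
    have "(\<lambda>h. (flat p (0 + h) - flat p 0) / h) = flat (pCons 0 p)"
      by (auto simp: flat_def)
    then show ?thesis using flat_tendsto_0[of "pCons 0 p"] 3 by (simp add: DERIV_def) (simp add: flat_def)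
  qed
qed

lemma smooth_flat: "smooth (\<lambda>t. of_real (flat p t))"
proof (rule smooth_coinduct_closed[where X = "\<lambda>f. \<exists>p. f = (\<lambda>t. of_real (flat p t))"])
  fix f :: "real \<Rightarrow> complex" assume "\<exists>p. f = (\<lambda>t. of_real (flat p t))"
  then obtain p where f: "f = (\<lambda>t. of_real (flat p t))" by blast
  have "(f has_vector_derivative of_real (flat (monom 1 2 * (p - pderiv p)) t)) (at t)" for t
    unfolding f using flat_deriv[of p t]
    by (intro bounded_linear.has_vector_derivative[OF bounded_linear_of_real])
       (simp add: has_real_derivative_iff_has_vector_derivative)
  then show "\<exists>g. (\<forall>t. (f has_vector_derivative g t) (at t)) \<and> (\<exists>p. g = (\<lambda>t. of_real (flat p t)))"
    by (intro exI[of _ "\<lambda>t. of_real (flat (monom 1 2 * (p - pderiv p)) t)"]) blast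
qed blast

lemma flat_1_bounds: "0 \<le> flat 1 t" "flat 1 t \<le> 1"
  by (auto simp: flat_def)

text \<open>With u = 1/t the second bound reads (u + u^2) exp(-u) \<le> 2. For t = m r - 1 the
  factor t + 1 is m times the distance r to an end point, which is the form in which the derivative
  of the cutoff is controlled.\<close>

lemma flat_2_bound: "0 \<le> flat (monom 1 2) t" "t > -1 \<Longrightarrow> (t + 1) * flat (monom 1 2) t \<le> 2"
proof -
  show "0 \<le> flat (monom 1 2) t" by (auto simp: flat_def poly_monom)
  show "(t + 1) * flat (monom 1 2) t \<le> 2" if "t > -1"
  proof (cases "t > 0")
    case True
    define u where "u = 1 / t"
    have u: "u > 0" "t = 1 / u" using True by (auto simp: u_def)
    have "1 + u + u\<^sup>2 / 2 \<le> exp u" using exp_lower_Taylor_quadratic[of u] u by simp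
    then have "(u + u\<^sup>2) \<le> 2 * exp u" using u by simp
    then have "(u + u\<^sup>2) * exp (- u) \<le> 2" by (simp add: exp_minus field_simps)
    moreover have "(t + 1) * flat (monom 1 2) t = (u + u\<^sup>2) * exp (- u)"
      using True unfolding flat_def u_def by (simp add: poly_monom field_simps power2_eq_square)
    ultimately show ?thesis by simp
  qed (simp add: flat_def)
qed

text \<open>The shift by 1 keeps the support, for m > 0, at distance 1/m from both end points, so
  products with smooth functions become admissible test functions.\<close>

definition cutoff :: "real \<Rightarrow> real \<Rightarrow> nat \<Rightarrow> real \<Rightarrow> real" where
  "cutoff a b m t = flat 1 (real m * (t - a) - 1) * flat 1 (real m * (b - t) - 1)"

definition cutoff' :: "real \<Rightarrow> real \<Rightarrow> nat \<Rightarrow> real \<Rightarrow> real" where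
  "cutoff' a b m t = real m * flat (monom 1 2) (real m * (t - a) - 1) * flat 1 (real m * (b - t) - 1)
     - real m * flat 1 (real m * (t - a) - 1) * flat (monom 1 2) (real m * (b - t) - 1)"

lemma cutoff_bounds: "0 \<le> cutoff a b m t" "cutoff a b m t \<le> 1"
  unfolding cutoff_def by (auto intro!: mult_nonneg_nonneg mult_le_one flat_1_bounds)

lemma cutoff_deriv: "(cutoff a b m has_real_derivative cutoff' a b m t) (at t)"
proof -
  have F: "(flat 1 has_real_derivative flat (monom 1 2) u) (at u)" for u
    using flat_deriv[of 1 u] by simp
  show ?thesis unfolding cutoff_def[abs_def] cutoff'_def
    by (rule derivative_eq_intros DERIV_chain'[OF _ F] refl | simp add: algebra_simps)+
qed

lemma smooth_cutoff: "smooth (\<lambda>t. of_real (cutoff a b m t))"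
proof -
  have "smooth (\<lambda>t. of_real (flat 1 (real m * t + (- real m * a - 1))) * of_real (flat 1 ((- real m) * t + (real m * b - 1))))"
    by (rule smooth_mult[OF smooth_affine[OF smooth_flat] smooth_affine[OF smooth_flat]])
  then show ?thesis by (simp add: cutoff_def algebra_simps)
qed

lemma flat_pos: "flat p t \<noteq> 0 \<Longrightarrow> t > 0"
  by (simp add: flat_def split: if_splits)

lemma cutoff_support:
  assumes "cutoff a b m t \<noteq> 0"
  shows "m > 0" "a + 1 / real m < t" "t < b - 1 / real m"
proof -
  have p: "real m * (t - a) - 1 > 0" "real m * (b - t) - 1 > 0"
    using flat_pos[of 1] assms unfolding cutoff_def mult_eq_0_iff by blast+
  then show m: "m > 0" by (cases "m = 0") auto
  have "1 / real m < t - a" "1 / real m < b - t" using p m by (simp_all add: field_simps)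
  then show "a + 1 / real m < t" "t < b - 1 / real m" by simp_all
qed

text \<open>At a fixed interior point the arguments of \<open>flat\<close> grow like m, while (y +
  1) / y^2 tends to 0, so even the derivative with its factor m vanishes in the limit.\<close>

lemma cutoff_lim:
  assumes "a < t" "t < b"
  shows "(\<lambda>m. cutoff a b m t) \<longlonglongrightarrow> 1" and "(\<lambda>m. cutoff' a b m t) \<longlonglongrightarrow> 0"
proof -
  have top: "filterlim (\<lambda>m. real m * c - 1) at_top sequentially" if "c > 0" for c :: real
  proof -
    have "filterlim (\<lambda>m. -1 + real m * c) at_top sequentially"
      by (rule filterlim_tendsto_add_at_top[OF tendsto_const
            filterlim_at_top_mult_tendsto_pos[OF tendsto_const that filterlim_real_sequentially]])
    then show ?thesis by simp
  qed
  have inv: "((\<lambda>y::real. 1 / y) \<longlongrightarrow> 0) at_top"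
    by (intro tendsto_divide_0[OF tendsto_const] filterlim_at_top_imp_at_infinity filterlim_ident)
  have f1: "(flat 1 \<longlongrightarrow> 1) at_top"
  proof (rule Lim_transform_eventually)
    show "((\<lambda>y::real. exp (- (1 / y))) \<longlongrightarrow> 1) at_top"
      using tendsto_exp[OF tendsto_minus[OF inv]] by simp
    show "\<forall>\<^sub>F y in at_top. exp (- (1 / y)) = flat 1 y"
      using eventually_gt_at_top[of 0] by eventually_elim (simp add: flat_def)
  qed
  have f2: "((\<lambda>y. (y + 1) * flat (monom 1 2) y) \<longlongrightarrow> 0) at_top"
  proof (rule Lim_transform_eventually)
    show "((\<lambda>y::real. ((1 / y) + (1 / y)\<^sup>2) * exp (- (1 / y))) \<longlongrightarrow> 0) at_top"
      using tendsto_mult[OF tendsto_add[OF inv tendsto_power[OF inv, of 2]] tendsto_exp[OF tendsto_minus[OF inv]]] by simp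
    show "\<forall>\<^sub>F y in at_top. ((1 / y) + (1 / y)\<^sup>2) * exp (- (1 / y)) = (y + 1) * flat (monom 1 2) y"
      using eventually_gt_at_top[of 0]
      by eventually_elim (simp add: flat_def poly_monom field_simps power2_eq_square)
  qed
  have l1: "(\<lambda>m. flat 1 (real m * c - 1)) \<longlonglongrightarrow> 1" if "c > 0" for c
    by (rule filterlim_compose[OF f1 top[OF that]])
  have l2: "(\<lambda>m. real m * flat (monom 1 2) (real m * c - 1)) \<longlonglongrightarrow> 0" if "c > 0" for c
  proof -
    have "(\<lambda>m. (real m * c - 1 + 1) * flat (monom 1 2) (real m * c - 1) / c) \<longlonglongrightarrow> 0 / c"
      using that by (intro tendsto_divide tendsto_const filterlim_compose[OF f2 top[OF that]]) auto
    then show ?thesis using that by (simp add: field_simps)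
  qed
  show "(\<lambda>m. cutoff a b m t) \<longlonglongrightarrow> 1"
    unfolding cutoff_def using tendsto_mult[OF l1[of "t - a"] l1[of "b - t"]] assms by simp
  have "(\<lambda>m. (real m * flat (monom 1 2) (real m * (t - a) - 1)) * flat 1 (real m * (b - t) - 1) -
     flat 1 (real m * (t - a) - 1) * (real m * flat (monom 1 2) (real m * (b - t) - 1))) \<longlonglongrightarrow> 0 * 1 - 1 * 0"
    using assms by (intro tendsto_diff tendsto_mult l1 l2) auto
  then show "(\<lambda>m. cutoff' a b m t) \<longlonglongrightarrow> 0"
    by (simp add: cutoff'_def mult_ac)
qed

text \<open>The derivative of the cutoff grows like m near the ends, but against a quantity
  \<open>c\<close> that vanishes linearly at both ends it stays bounded uniformly in m; each end
  contributes \<open>2 * L\<close>. This is the domination that allows removing the cutoff after an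
  integration by parts.\<close>

lemma cutoff'_bound:
  assumes "a < t" "t < b" "0 \<le> L" "c \<le> L * (t - a)" "c \<le> L * (b - t)" "0 \<le> c"
  shows "\<bar>cutoff' a b m t\<bar> * c \<le> 4 * L"
proof -
  have *: "real m * flat (monom 1 2) (real m * u - 1) * c \<le> 2 * L" if u: "0 < u" "c \<le> L * u" for u
  proof (cases "m = 0")
    case False
    have "real m * flat (monom 1 2) (real m * u - 1) * c \<le> real m * flat (monom 1 2) (real m * u - 1) * (L * u)"
      using u flat_2_bound(1) by (intro mult_left_mono) auto
    also have "\<dots> = L * ((real m * u - 1 + 1) * flat (monom 1 2) (real m * u - 1))" by simp
    also have "\<dots> \<le> L * 2" using u False assms by (intro mult_left_mono flat_2_bound(2)) auto
    finally show ?thesis by simp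
  qed (use assms in simp)
  let ?A = "real m * flat (monom 1 2) (real m * (t - a) - 1)"
  let ?B = "real m * flat (monom 1 2) (real m * (b - t) - 1)"
  have AB: "0 \<le> ?A" "0 \<le> ?B" by (simp_all add: flat_2_bound)
  have "\<bar>cutoff' a b m t\<bar> \<le> ?A * flat 1 (real m * (b - t) - 1) + ?B * flat 1 (real m * (t - a) - 1)"
    unfolding cutoff'_def using AB flat_1_bounds
    by (intro order_trans[OF abs_triangle_ineq4] add_mono) (auto simp: abs_mult mult_ac flat_2_bound)
  also have "\<dots> \<le> ?A + ?B"
    using AB flat_1_bounds by (intro add_mono) (auto intro: mult_left_le)
  finally have "\<bar>cutoff' a b m t\<bar> * c \<le> (?A + ?B) * c" using assms by (intro mult_right_mono) auto
  also have "\<dots> \<le> 4 * L" using *[of "t - a"] *[of "b - t"] assms by (simp add: ring_distribs)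
  finally show ?thesis .
qed

section \<open>Product test functions\<close>

section \<open>Weak derivatives and Fourier coefficients\<close>

definition tprod :: "('n::finite \<Rightarrow> real \<Rightarrow> complex) \<Rightarrow> real^'n \<Rightarrow> complex" where
  "tprod \<psi> x = (\<Prod>i\<in>UNIV. \<psi> i (x $ i))"

lemma tprod_remove: "tprod \<psi> x = \<psi> j (x $ j) * (\<Prod>i\<in>UNIV - {j}. \<psi> i (x $ i))"
  unfolding tprod_def by (rule prod.remove) auto

lemma partial_deriv_tprod:
  assumes "\<And>i. smooth (\<psi> i)"
  shows "partial_deriv j (tprod \<psi>) = tprod (\<psi>(j := vderiv (\<psi> j)))"
proof
  fix x :: "real^'a"
  let ?c = "\<Prod>i\<in>UNIV - {j}. \<psi> i (x $ i)"
  have "(\<psi> j has_vector_derivative vderiv (\<psi> j) (x $ j)) (at (x $ j + 0))"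
    using smooth_vderiv(1)[OF assms] by simp
  moreover have "((\<lambda>t. x $ j + t) has_vector_derivative 1) (at 0)"
    by (auto intro!: derivative_eq_intros simp: has_real_derivative_iff_has_vector_derivative[symmetric])
  ultimately have "((\<lambda>t. \<psi> j (x $ j + t)) has_vector_derivative vderiv (\<psi> j) (x $ j)) (at 0)"
    using vector_diff_chain_at[of "\<lambda>t. x $ j + t" 1 0 "\<psi> j" "vderiv (\<psi> j) (x $ j)"] by (simp add: o_def)
  then have d: "((\<lambda>t. \<psi> j (x $ j + t) * ?c) has_vector_derivative vderiv (\<psi> j) (x $ j) * ?c) (at 0)"
    by (rule has_vector_derivative_mult_left)
  have "(\<lambda>t. tprod \<psi> (x + t *\<^sub>R axis j 1)) = (\<lambda>t. \<psi> j (x $ j + t) * ?c)"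
  proof
    fix t
    have "(\<Prod>i\<in>UNIV - {j}. \<psi> i ((x + t *\<^sub>R axis j 1) $ i)) = ?c"
      by (intro prod.cong) (auto simp: axis_def)
    then show "tprod \<psi> (x + t *\<^sub>R axis j 1) = \<psi> j (x $ j + t) * ?c"
      unfolding tprod_remove[of \<psi> _ j] by simp
  qed
  with d have "partial_deriv j (tprod \<psi>) x = vderiv (\<psi> j) (x $ j) * ?c"
    unfolding partial_deriv_def by (simp add: vector_derivative_at)
  also have "?c = (\<Prod>i\<in>UNIV - {j}. (\<psi>(j := vderiv (\<psi> j))) i (x $ i))"
    by (intro prod.cong) auto
  finally show "partial_deriv j (tprod \<psi>) x = tprod (\<psi>(j := vderiv (\<psi> j))) x"
    unfolding tprod_remove[of _ _ j] by simp
qed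

lemma continuous_on_tprod: "(\<And>i. continuous_on UNIV (\<psi> i)) \<Longrightarrow> continuous_on S (tprod \<psi>)"
proof -
  assume c: "\<And>i. continuous_on UNIV (\<psi> i)"
  have "continuous_on S (\<lambda>x. \<psi> i (x $ i))" for i
    by (rule continuous_on_compose2[OF c]) (auto intro: continuous_intros)
  then show ?thesis unfolding tprod_def[abs_def] by (intro continuous_on_prod)
qed

lemma differentiable_tprod:
  fixes \<psi> :: "'n::finite \<Rightarrow> real \<Rightarrow> complex"
  assumes "\<And>i. smooth (\<psi> i)"
  shows "tprod \<psi> differentiable (at x)"
proof -
  have 1: "(\<lambda>x::real^'n. \<psi> i (x $ i)) differentiable (at x)" for i
  proof -
    have "\<psi> i differentiable (at (x $ i))"
      using smooth_vderiv(1)[OF assms, of i "x $ i"]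
      unfolding has_vector_derivative_def differentiable_def by blast
    moreover have "(\<lambda>x::real^'n. x $ i) differentiable (at x)"
      by (intro bounded_linear_imp_differentiable bounded_linear_vec_nth)
    ultimately show ?thesis using differentiable_chain_at[of "\<lambda>x. x $ i" x "\<psi> i"] by (simp add: o_def)
  qed
  have "finite J \<Longrightarrow> (\<lambda>x. \<Prod>i\<in>J. \<psi> i (x $ i)) differentiable (at x)" for J
    by (induction J rule: finite_induct) (auto intro!: differentiable_mult 1)
  then show ?thesis unfolding tprod_def[abs_def] by simp
qed

lemma C_k_tprod:
  assumes "\<And>i. smooth (\<psi> i)"
  shows "C_k k (tprod \<psi>)"
  using assms
proof (induction k arbitrary: \<psi>)
  case 0
  then show ?case by (simp add: continuous_on_tprod smooth_continuous)
next
  case (Suc k)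
  have "C_k k (partial_deriv i (tprod \<psi>))" for i
    unfolding partial_deriv_tprod[OF Suc.prems] by (rule Suc.IH) (auto simp: Suc.prems smooth_vderiv)
  moreover have "tprod \<psi> differentiable (at x)" for x by (rule differentiable_tprod) (rule Suc.prems)
  ultimately show ?case by simp
qed

lemma foldr_partial_deriv_tprod:
  assumes "\<And>i. smooth (\<psi> i)"
  shows "foldr partial_deriv is (tprod \<psi>) = tprod (\<lambda>i. (vderiv ^^ count_list is i) (\<psi> i))"
proof (induction "is")
  case (Cons j "is")
  have "foldr partial_deriv (j # is) (tprod \<psi>) = partial_deriv j (tprod (\<lambda>i. (vderiv ^^ count_list is i) (\<psi> i)))"
    using Cons.IH by simp
  also have "\<dots> = tprod ((\<lambda>i. (vderiv ^^ count_list is i) (\<psi> i))(j := vderiv ((vderiv ^^ count_list is j) (\<psi> j))))"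
    by (rule partial_deriv_tprod) (intro smooth_vderiv_funpow assms)
  also have "(\<lambda>i. (vderiv ^^ count_list is i) (\<psi> i))(j := vderiv ((vderiv ^^ count_list is j) (\<psi> j))) =
     (\<lambda>i. (vderiv ^^ count_list (j # is) i) (\<psi> i))" by auto
  finally show ?case .
qed simp

text \<open>A function into the naturals on a finite type is a multiset, and any enumeration of it
  is such a list.\<close>

lemma ex_count_list: "\<exists>is. \<forall>i. count_list is i = (\<alpha> i :: nat)" for \<alpha> :: "'n::finite \<Rightarrow> nat"
proof -
  have "count (Abs_multiset \<alpha>) = \<alpha>" by (rule Abs_multiset_inverse) simp
  moreover obtain "is" where "mset is = Abs_multiset \<alpha>" using ex_mset by blast
  ultimately show ?thesis by (metis count_mset)
qed

text \<open>The list picked by \<open>SOME\<close> depends on \<alpha> only, so a single list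
  computes \<open>multi_deriv\<close> for all \<phi>, and facts about it follow by induction along
  that list.\<close>

lemma multi_deriv_list: "\<exists>is. (\<forall>i. count_list is i = \<alpha> i) \<and> (\<forall>\<phi>. multi_deriv \<alpha> \<phi> = foldr partial_deriv is \<phi>)"
proof (intro exI conjI)
  show "\<forall>i. count_list (SOME is. \<forall>i. count_list is i = \<alpha> i) i = \<alpha> i"
    by (rule someI_ex[OF ex_count_list])
  show "\<forall>\<phi>. multi_deriv \<alpha> \<phi> = foldr partial_deriv (SOME is. \<forall>i. count_list is i = \<alpha> i) \<phi>"
    by (simp add: multi_deriv_def)
qed

lemma multi_deriv_tprod:
  assumes "\<And>i. smooth (\<psi> i)"
  shows "multi_deriv \<alpha> (tprod \<psi>) = tprod (\<lambda>i. (vderiv ^^ \<alpha> i) (\<psi> i))"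
proof -
  obtain "is" where "\<And>i. count_list is i = \<alpha> i" "multi_deriv \<alpha> (tprod \<psi>) = foldr partial_deriv is (tprod \<psi>)"
    using multi_deriv_list[of \<alpha>] by blast
  then show ?thesis by (simp add: foldr_partial_deriv_tprod[OF assms])
qed

lemma interior_cube: "interior (cube a b) = box (vec a) (vec b)"
  by (simp add: cube_def)

lemma test_function_tprod:
  fixes \<psi> :: "'n::finite \<Rightarrow> real \<Rightarrow> complex"
  assumes sm: "\<And>i. smooth (\<psi> i)" and supp: "\<And>i t. \<psi> i t \<noteq> 0 \<Longrightarrow> c \<le> t \<and> t \<le> d"
    and cd: "a < c" "d < b"
  shows "tprod \<psi> \<in> test_functions (interior (cube a b))"
proof -
  have "{x. tprod \<psi> x \<noteq> 0} \<subseteq> cbox (vec c) (vec d)"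
  proof
    fix x :: "real^'n" assume "x \<in> {x. tprod \<psi> x \<noteq> 0}"
    then have "\<psi> i (x $ i) \<noteq> 0" for i by (simp add: tprod_def)
    then have "c \<le> x $ i \<and> x $ i \<le> d" for i using supp by blast
    then show "x \<in> cbox (vec c) (vec d)" by (simp add: mem_box_cart)
  qed
  then have cl: "closure {x. tprod \<psi> x \<noteq> 0} \<subseteq> cbox (vec c) (vec d)"
    by (rule closure_minimal) (rule closed_cbox)
  moreover have "cbox (vec c) (vec d) \<subseteq> (interior (cube a b) :: (real^'n) set)"
  proof
    fix x :: "real^'n" assume "x \<in> cbox (vec c) (vec d)"
    then have "c \<le> x $ i" "x $ i \<le> d" for i by (simp_all add: mem_box_cart)
    then have "a < x $ i \<and> x $ i < b" for i using cd by (meson less_le_trans le_less_trans)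
    then show "x \<in> interior (cube a b)" by (simp add: interior_cube mem_box_cart)
  qed
  moreover have "compact (closure {x. tprod \<psi> x \<noteq> 0})"
    using bounded_subset[OF bounded_cbox cl] by (simp add: compact_eq_bounded_closed)
  moreover have "C_k k (tprod \<psi>)" for k by (rule C_k_tprod) (rule sm)
  ultimately show ?thesis unfolding test_functions_def by blast
qed

text \<open>Weak derivatives are tested on the open cube while the norms live on the closed one; the
  boundary is a null set.\<close>

lemma integral_interior_cube:
  fixes h :: "real^'n::finite \<Rightarrow> complex"
  assumes h: "h \<in> borel_measurable (cube_measure a b)"
  shows "(LINT x|lebesgue_on (interior (cube a b)). h x) = (LINT x|cube_measure a b. h x)"
proof -
  let ?B = "box (vec a) (vec b) :: (real^'n) set"
  have hm: "(\<lambda>x. indicator (cube a b) x *\<^sub>R h x) \<in> borel_measurable lebesgue"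
    using h by (subst (asm) borel_measurable_restrict_space_iff) (auto simp: scaleR_conv_of_real)
  have "(LINT x|lebesgue_on (interior (cube a b)). h x) = (LINT x|lebesgue. indicator ?B x *\<^sub>R h x)"
    unfolding interior_cube by (intro integral_restrict_space) auto
  also have "\<dots> = (LINT x|lebesgue. indicator (cube a b) x *\<^sub>R h x)"
  proof (rule integral_cong_AE)
    have "(\<lambda>x. indicator ?B x *\<^sub>R (indicator (cube a b) x *\<^sub>R h x)) \<in> borel_measurable lebesgue"
      by (intro borel_measurable_scaleR hm borel_measurable_indicator) auto
    moreover have "(\<lambda>x. indicator ?B x *\<^sub>R (indicator (cube a b) x *\<^sub>R h x)) = (\<lambda>x. indicator ?B x *\<^sub>R h x)"
      using box_subset_cbox[of "vec a :: real^'n" "vec b"]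
      by (intro ext) (auto simp: cube_def split: split_indicator)
    ultimately show "(\<lambda>x. indicator ?B x *\<^sub>R h x) \<in> borel_measurable lebesgue" by simp
    have "AE x in lebesgue. x \<in> cube a b \<longrightarrow> x \<in> ?B"
      using AE_cube_box[of a b] by (subst (asm) AE_restrict_space_iff) auto
    moreover have "?B \<subseteq> cube a b" using box_subset_cbox[of "vec a :: real^'n" "vec b"] by (simp add: cube_def)
    ultimately show "AE x in lebesgue. indicator ?B x *\<^sub>R h x = indicator (cube a b) x *\<^sub>R h x"
      by (elim eventually_mono) (auto split: split_indicator)
  qed (rule hm)
  also have "\<dots> = (LINT x|cube_measure a b. h x)"
    by (intro integral_restrict_space[symmetric]) auto
  finally show ?thesis .
qed

lemma const_L2_cube: "(\<lambda>x. c) \<in> L2_space (cube_measure a b)"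
  by (rule L2_cubeI_bounded[where C = "norm c"]) auto

lemma continuous_L2_cube:
  fixes f :: "real^'n::finite \<Rightarrow> complex"
  assumes "continuous_on UNIV f"
  shows "f \<in> L2_space (cube_measure a b)"
proof -
  have "continuous_on (cube a b) f" using assms continuous_on_subset by blast
  moreover have "compact (cube a b :: (real^'n) set)" by (simp add: cube_def)
  ultimately have "bounded (f ` cube a b)"
    by (intro compact_imp_bounded compact_continuous_image)
  then obtain C where "\<And>x. x \<in> cube a b \<Longrightarrow> norm (f x) \<le> C"
    unfolding bounded_iff by auto
  then show ?thesis by (intro L2_cubeI_bounded borel_measurable_cube_continuous assms)
qed

lemma L2_locally_integrable:
  fixes f :: "real^'n::finite \<Rightarrow> complex"
  assumes "f \<in> L2_space (cube_measure a b)"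
  shows "locally_integrable_on f (interior (cube a b))"
  unfolding locally_integrable_on_def
proof (intro allI impI)
  fix K :: "(real^'n) set" assume K: "compact K \<and> K \<subseteq> interior (cube a b)"
  have "integrable (cube_measure a b) (\<lambda>x. f x * 1)"
    using assms const_L2_cube by (rule L2_space_mult_integrable)
  then have "set_integrable lebesgue (cube a b) f"
    unfolding set_integrable_def by (subst (asm) integrable_restrict_space) auto
  moreover have "K \<in> sets lebesgue" using K by (simp add: compact_imp_closed lmeasurable_compact fmeasurableD)
  moreover have "K \<subseteq> cube a b" using K interior_subset by blast
  ultimately show "f absolutely_integrable_on K" by (rule set_integrable_subset)
qed

text \<open>Support in [c, d] makes the product admissible on the open cube; the sign changes sides
  because its square is 1.\<close>

lemma weak_deriv_tprod:
  fixes \<psi> :: "'n::finite \<Rightarrow> real \<Rightarrow> complex"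
  assumes f: "f \<in> L2_space (cube_measure a b)" and g: "is_L2_weak_deriv a b \<alpha> f g"
    and sm: "\<And>i. smooth (\<psi> i)" and supp: "\<And>i t. \<psi> i t \<noteq> 0 \<Longrightarrow> c \<le> t \<and> t \<le> d"
    and cd: "a < c" "d < b"
  shows "(LINT x|cube_measure a b. g x * tprod \<psi> x) =
    (-1) ^ (\<Sum>i\<in>UNIV. \<alpha> i) * (LINT x|cube_measure a b. f x * tprod (\<lambda>i. (vderiv ^^ \<alpha> i) (\<psi> i)) x)"
proof -
  have gL2: "g \<in> L2_space (cube_measure a b)" using g by (simp add: is_L2_weak_deriv_def L2_cube_def)
  have c1: "continuous_on UNIV (tprod \<psi>)" by (intro continuous_on_tprod smooth_continuous sm)
  have c2: "continuous_on UNIV (tprod (\<lambda>i. (vderiv ^^ \<alpha> i) (\<psi> i)))"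
    by (intro continuous_on_tprod smooth_continuous smooth_vderiv_funpow sm)
  have m: "(\<lambda>x. g x * tprod \<psi> x) \<in> borel_measurable (cube_measure a b)"
    "(\<lambda>x. f x * tprod (\<lambda>i. (vderiv ^^ \<alpha> i) (\<psi> i)) x) \<in> borel_measurable (cube_measure a b)"
    using f gL2 by (intro borel_measurable_times borel_measurable_cube_continuous[OF c1]
        borel_measurable_cube_continuous[OF c2]; simp add: L2_space_def)+
  have "(LINT x|lebesgue_on (interior (cube a b)). f x * multi_deriv \<alpha> (tprod \<psi>) x) =
    (-1) ^ (\<Sum>i\<in>UNIV. \<alpha> i) * (LINT x|lebesgue_on (interior (cube a b)). g x * tprod \<psi> x)"
  proof -
    have "tprod \<psi> \<in> test_functions (interior (cube a b))"
      by (rule test_function_tprod[where c = c and d = d]) (use sm supp cd in auto)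
    moreover have "\<forall>\<phi>\<in>test_functions (interior (cube a b)).
        (LINT x|lebesgue_on (interior (cube a b)). f x * multi_deriv \<alpha> \<phi> x) =
        (-1) ^ (\<Sum>i\<in>UNIV. \<alpha> i) * (LINT x|lebesgue_on (interior (cube a b)). g x * \<phi> x)"
      using g by (simp add: is_L2_weak_deriv_def has_weak_deriv_def)
    ultimately show ?thesis by (rule bspec[rotated])
  qed
  moreover have "multi_deriv \<alpha> (tprod \<psi>) = tprod (\<lambda>i. (vderiv ^^ \<alpha> i) (\<psi> i))"
    by (rule multi_deriv_tprod) (rule sm)
  ultimately show ?thesis
    using integral_interior_cube[OF m(1)] integral_interior_cube[OF m(2)]
    by (simp flip: power_mult_distrib mult.assoc)
qed

text \<open>Carries identities for compactly supported products over to exponentials, by letting the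
  cutoffs tend to 1 under the integral.\<close>

lemma integral_tprod_limit:
  fixes h :: "nat \<Rightarrow> 'n::finite \<Rightarrow> real \<Rightarrow> complex"
  assumes g: "g \<in> L2_space (cube_measure a b)"
    and h: "\<And>m i. continuous_on UNIV (h m i)" "\<And>m i t. a < t \<Longrightarrow> t < b \<Longrightarrow> norm (h m i t) \<le> C"
    and lim: "\<And>i t. a < t \<Longrightarrow> t < b \<Longrightarrow> (\<lambda>m. h m i t) \<longlonglongrightarrow> h' i t"
    and h': "\<And>i. continuous_on UNIV (h' i)"
  shows "(\<lambda>m. LINT x|cube_measure a b. g x * tprod (h m) x) \<longlonglongrightarrow> (LINT x|cube_measure a b. g x * tprod h' x)"
proof (rule integral_dominated_convergence)
  have gm: "g \<in> borel_measurable (cube_measure a b)" using g by (simp add: L2_space_def)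
  show "(\<lambda>x. g x * tprod h' x) \<in> borel_measurable (cube_measure a b)"
    by (intro borel_measurable_times[OF gm] borel_measurable_cube_continuous continuous_on_tprod h')
  show "(\<lambda>x. g x * tprod (h m) x) \<in> borel_measurable (cube_measure a b)" for m
    by (intro borel_measurable_times[OF gm] borel_measurable_cube_continuous continuous_on_tprod h)
  show "integrable (cube_measure a b) (\<lambda>x. norm (g x * of_real (\<bar>C\<bar> ^ CARD('n))))"
    by (intro integrable_norm L2_space_mult_integrable g const_L2_cube)
  show "AE x in cube_measure a b. norm (g x * tprod (h m) x) \<le> norm (g x * of_real (\<bar>C\<bar> ^ CARD('n)))" for m
    using AE_cube_box[of a b]
  proof eventually_elim
    case (elim x)
    have "norm (tprod (h m) x) \<le> (\<Prod>i\<in>(UNIV::'n set). \<bar>C\<bar>)"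
      unfolding tprod_def prod_norm[symmetric]
      using elim h(2) by (intro prod_mono) (auto simp: mem_box_cart intro: order_trans[OF _ abs_ge_self])
    then show ?case by (simp add: norm_mult norm_power mult_left_mono)
  qed
  show "AE x in cube_measure a b. (\<lambda>m. g x * tprod (h m) x) \<longlonglongrightarrow> g x * tprod h' x"
    using AE_cube_box[of a b]
  proof eventually_elim
    case (elim x)
    then show ?case unfolding tprod_def
      by (intro tendsto_intros lim) (auto simp: mem_box_cart)
  qed
qed

section \<open>Fourier coefficients of weak derivatives\<close>

definition cwave :: "real \<Rightarrow> real \<Rightarrow> int \<Rightarrow> real \<Rightarrow> complex" where
  "cwave a b k t = exp (- wave a b k * of_real (t - a))"

lemma smooth_cwave: "smooth (cwave a b k)"
  unfolding cwave_def[abs_def] by (rule smooth_exp)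

lemma cwave_0 [simp]: "cwave a b 0 t = 1"
  by (simp add: cwave_def)

lemma norm_cwave [simp]: "norm (cwave a b k t) = 1"
proof -
  have "Re (wave a b k) = 0" by (simp add: wave_def del: of_real_diff)
  then show ?thesis by (simp add: cwave_def del: of_real_diff)
qed

lemma cwave_deriv: "(cwave a b k has_vector_derivative - wave a b k * cwave a b k t) (at t)"
proof -
  have "((\<lambda>z. exp (- wave a b k * (z - of_real a))) has_field_derivative
     - wave a b k * exp (- wave a b k * (of_real t - of_real a))) (at (of_real t))"
    by (auto intro!: derivative_eq_intros)
  from has_vector_derivative_real_field[OF this] show ?thesis
    unfolding cwave_def[abs_def] of_real_diff .
qed

lemma fourier_tprod:
  fixes g :: "real^'n::finite \<Rightarrow> complex"
  shows "fourier a b g k = (LINT x|cube_measure a b. g x * tprod (\<lambda>i. cwave a b (k i)) x) / of_real (sqrt (b - a) ^ CARD('n))"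
proof -
  have "cnj (trig a b k x) = tprod (\<lambda>i. cwave a b (k i)) x / of_real (sqrt (b - a) ^ CARD('n))" for x :: "real^'n"
    unfolding trig_def complex_cnj_divide cnj_character
    unfolding character_prod tprod_def cwave_def wave_uminus by simp
  then show ?thesis unfolding fourier_def L2_inner_def by simp
qed

text \<open>From |exp(iu) - 1| \<le> |u|, measured from a and, by periodicity, from b.\<close>

lemma cwave_dist:
  assumes ab: "a < b" and t: "a < t" "t < b"
  shows "norm (cwave a b k t - 1) \<le> norm (wave a b k) * (t - a)"
    and "norm (cwave a b k t - 1) \<le> norm (wave a b k) * (b - t)"
proof -
  define \<theta> where "\<theta> = 2 * pi * real_of_int k / (b - a)"
  have w: "wave a b k = \<i> * of_real \<theta>" by (simp add: wave_def \<theta>_def)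
  have e: "norm (exp (\<i> * of_real u) - 1) \<le> \<bar>u\<bar>" for u
  proof -
    have "norm (exp (\<i> * of_real u) - 1) = 2 * \<bar>sin (u / 2)\<bar>"
      using dist_exp_i_1[of u] by simp
    also have "\<dots> \<le> 2 * \<bar>u / 2\<bar>" by (intro mult_left_mono abs_sin_x_le_abs_x) auto
    finally show ?thesis by simp
  qed
  have 1: "cwave a b k t = exp (\<i> * of_real (- \<theta> * (t - a)))"
    by (simp add: cwave_def w mult.assoc)
  show "norm (cwave a b k t - 1) \<le> norm (wave a b k) * (t - a)"
    unfolding 1 using e[of "- \<theta> * (t - a)"] t by (simp add: w norm_mult abs_mult del: of_real_diff of_real_mult)
  have "cwave a b k t = exp (\<i> * of_real (\<theta> * (b - t))) * inverse (exp (wave a b k * of_real (b - a)))"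
    unfolding cwave_def w exp_minus[symmetric] exp_add[symmetric] by (simp add: algebra_simps)
  then have 2: "cwave a b k t = exp (\<i> * of_real (\<theta> * (b - t)))"
    using exp_wave_period[OF ab, of k] by simp
  show "norm (cwave a b k t - 1) \<le> norm (wave a b k) * (b - t)"
    unfolding 2 using e[of "\<theta> * (b - t)"] t by (simp add: w norm_mult abs_mult del: of_real_diff of_real_mult)
qed

lemma cutoff_support_interval:
  assumes "a < b"
  obtains c d where "a < c" "d < b" "\<And>t. cutoff a b m t \<noteq> 0 \<Longrightarrow> c \<le> t \<and> t \<le> d"
proof (cases "m = 0")
  case True
  then have "cutoff a b m t = 0" for t using cutoff_support(1) by blast
  then show ?thesis using that[of b a] assms by blast
next
  case False
  then show ?thesis
    using that[of "a + 1 / real m" "b - 1 / real m"] cutoff_support[of a b m] by (auto intro: less_imp_le)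
qed

text \<open>Both derivatives give the same numbers on exponentials with a cutoff, and the cutoff
  tends to 1. Hence the arbitrary choice behind \<open>weak_deriv\<close> does not influence Fourier
  coefficients.\<close>

lemma fourier_weak_deriv_unique:
  fixes f :: "real^'n::finite \<Rightarrow> complex"
  assumes ab: "a < b" and f: "f \<in> L2_space (cube_measure a b)"
    and g: "is_L2_weak_deriv a b \<alpha> f g" and g': "is_L2_weak_deriv a b \<alpha> f g'"
  shows "fourier a b g k = fourier a b g' k"
proof -
  define \<psi> where "\<psi> m i t = cwave a b (k i) t * of_real (cutoff a b m t)" for m i t
  have sm: "smooth (\<psi> m i)" for m i
    unfolding \<psi>_def[abs_def] by (intro smooth_mult smooth_cwave smooth_cutoff)
  have lim: "(\<lambda>m. LINT x|cube_measure a b. u x * tprod (\<psi> m) x) \<longlonglongrightarrow>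
     (LINT x|cube_measure a b. u x * tprod (\<lambda>i. cwave a b (k i)) x)"
    if "u \<in> L2_space (cube_measure a b)" for u :: "real^'n \<Rightarrow> complex"
  proof (rule integral_tprod_limit[OF that])
    show "norm (\<psi> m i t) \<le> 1" for m i t
      by (simp add: \<psi>_def norm_mult cutoff_bounds)
    show "(\<lambda>m. \<psi> m i t) \<longlonglongrightarrow> cwave a b (k i) t" if "a < t" "t < b" for i t
      unfolding \<psi>_def using tendsto_mult[OF tendsto_const tendsto_of_real[OF cutoff_lim(1)[OF that]]] by fastforce
  qed (intro smooth_continuous sm smooth_cwave)+
  have eq: "(LINT x|cube_measure a b. g x * tprod (\<psi> m) x) = (LINT x|cube_measure a b. g' x * tprod (\<psi> m) x)" for m
  proof -
    obtain c d where cd: "a < c" "d < b" "\<And>t. cutoff a b m t \<noteq> 0 \<Longrightarrow> c \<le> t \<and> t \<le> d"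
      using cutoff_support_interval[OF ab] by blast
    have supp: "\<psi> m i t \<noteq> 0 \<Longrightarrow> c \<le> t \<and> t \<le> d" for i t using cd(3) by (auto simp: \<psi>_def)
    show ?thesis
      using weak_deriv_tprod[where \<psi> = "\<psi> m", OF f g sm supp cd(1,2)]
        weak_deriv_tprod[where \<psi> = "\<psi> m", OF f g' sm supp cd(1,2)] by simp
  qed
  have "g \<in> L2_space (cube_measure a b)" "g' \<in> L2_space (cube_measure a b)"
    using g g' by (simp_all add: is_L2_weak_deriv_def L2_cube_def)
  from LIMSEQ_unique[OF lim[OF this(1)] lim[OF this(2), folded eq]]
  show ?thesis unfolding fourier_tprod by simp
qed

text \<open>Since all characters agree at both end points, the boundary term of an integration by parts
  is the same for every frequency; taking frequency zero expresses it as a Fourier coefficient.\<close>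

lemma fourier_weak_deriv_step:
  fixes f :: "real^'n::finite \<Rightarrow> complex"
  assumes ab: "a < b" and f: "f \<in> L2_space (cube_measure a b)"
    and g: "is_L2_weak_deriv a b \<alpha> f g" and g': "is_L2_weak_deriv a b (\<alpha>(i := Suc (\<alpha> i))) f g'"
  shows "fourier a b g' k - fourier a b g' (k(i := 0)) = wave a b (k i) * fourier a b g k"
proof -
  have gL2: "g \<in> L2_space (cube_measure a b)" "g' \<in> L2_space (cube_measure a b)"
    using g g' by (simp_all add: is_L2_weak_deriv_def L2_cube_def)
  \<comment> \<open>Subtracting 1 makes this factor vanish at both end points, so the derivative of
    the cutoff meets a linear zero and disappears in the limit.\<close>
  define \<xi> where "\<xi> t = cwave a b (k i) t - 1" for t
  define \<psi> where "\<psi> m j t = (if j = i then \<xi> t else cwave a b (k j) t) * of_real (cutoff a b m t)" for m j t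
  define d\<psi> where "d\<psi> m t = \<xi> t * of_real (cutoff' a b m t) + - wave a b (k i) * cwave a b (k i) t * of_real (cutoff a b m t)" for m t
  have sm\<xi>: "smooth \<xi>"
    using smooth_add[OF smooth_cwave[of a b "k i"] smooth_const[of "-1"]] by (simp add: \<xi>_def[abs_def])
  have d\<xi>: "(\<xi> has_vector_derivative - wave a b (k i) * cwave a b (k i) t) (at t)" for t
    using has_vector_derivative_diff[OF cwave_deriv has_vector_derivative_const] by (fastforce simp: \<xi>_def[abs_def])
  have sm: "smooth (\<psi> m j)" for m j
    unfolding \<psi>_def[abs_def] by (cases "j = i") (auto intro!: smooth_mult smooth_cwave smooth_cutoff sm\<xi>)
  have vd: "vderiv (\<psi> m i) = d\<psi> m" for m
  proof (rule vderiv_eqI)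
    fix t
    have "((\<lambda>t. complex_of_real (cutoff a b m t)) has_vector_derivative of_real (cutoff' a b m t)) (at t)"
      using cutoff_deriv[of a b m t]
      by (intro bounded_linear.has_vector_derivative[OF bounded_linear_of_real])
         (simp add: has_real_derivative_iff_has_vector_derivative)
    from has_vector_derivative_mult[OF d\<xi> this]
    show "(\<psi> m i has_vector_derivative d\<psi> m t) (at t)"
      by (simp add: \<psi>_def[abs_def] d\<psi>_def)
  qed
  have smd: "smooth (d\<psi> m)" for m using smooth_vderiv(2)[OF sm, of m i] by (simp add: vd)
  \<comment> \<open>One derivative in direction \<open>i\<close> is carried out explicitly, so that
    \<open>g'\<close> tested on \<open>\<psi> m\<close> and \<open>g\<close> tested on
    \<open>\<psi>' m\<close> are the same integral of f up to sign.\<close>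
  define \<psi>' where "\<psi>' m = (\<psi> m)(i := d\<psi> m)" for m
  have sm': "smooth (\<psi>' m j)" for m j using sm smd by (simp add: \<psi>'_def)
  have parts: "(LINT x|cube_measure a b. g' x * tprod (\<psi> m) x) = - (LINT x|cube_measure a b. g x * tprod (\<psi>' m) x)" for m
  proof -
    obtain c d where cd: "a < c" "d < b" "\<And>t. cutoff a b m t \<noteq> 0 \<Longrightarrow> c \<le> t \<and> t \<le> d"
      using cutoff_support_interval[OF ab] by blast
    have supp: "\<psi> m j t \<noteq> 0 \<Longrightarrow> c \<le> t \<and> t \<le> d" for j t using cd(3) by (auto simp: \<psi>_def)
    \<comment> \<open>The product is zero on the open complement of [c, d], hence so is its
      derivative.\<close>
    have suppd: "d\<psi> m t \<noteq> 0 \<Longrightarrow> c \<le> t \<and> t \<le> d" for t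
    proof (rule ccontr)
      assume nz: "d\<psi> m t \<noteq> 0" and out: "\<not> (c \<le> t \<and> t \<le> d)"
      have "open (- {c..d})" by (intro open_Compl closed_atLeastAtMost)
      moreover have "t \<in> - {c..d}" using out by simp
      moreover have "(\<psi> m i has_vector_derivative d\<psi> m t) (at t)"
        using smooth_vderiv(1)[OF sm, of m i t] unfolding vd .
      moreover have "\<psi> m i u = 0" if "u \<in> - {c..d}" for u
        using supp[of i u] that by (metis ComplD atLeastAtMost_iff)
      ultimately have "((\<lambda>t. 0) has_vector_derivative d\<psi> m t) (at t)"
        by (metis has_vector_derivative_transform_within_open)
      then have "d\<psi> m t = 0" using vector_derivative_unique_at has_vector_derivative_const by blast
      with nz show False by simp
    qed
    have supp': "\<psi>' m j t \<noteq> 0 \<Longrightarrow> c \<le> t \<and> t \<le> d" for j t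
      using supp suppd by (auto simp: \<psi>'_def split: if_splits)
    have sumSuc: "(\<Sum>j\<in>UNIV. (\<alpha>(i := Suc (\<alpha> i))) j) = Suc (\<Sum>j\<in>UNIV. \<alpha> j)"
      by (subst (1 2) sum.remove[of UNIV i]) (auto intro!: sum.cong)
    have "(\<lambda>j. (vderiv ^^ (\<alpha>(i := Suc (\<alpha> i))) j) (\<psi> m j)) = (\<lambda>j. (vderiv ^^ \<alpha> j) (\<psi>' m j))"
      by (auto simp: \<psi>'_def vd[symmetric] funpow_swap1)
    then show ?thesis
      using weak_deriv_tprod[where \<psi> = "\<psi> m", OF f g' sm supp cd(1,2)]
        weak_deriv_tprod[where \<psi> = "\<psi>' m", OF f g sm' supp' cd(1,2)] sumSuc
      by simp
  qed
  define L where "L = norm (wave a b (k i))"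
  have \<xi>_le: "norm (\<xi> t) \<le> 2" for t
    unfolding \<xi>_def by (rule order_trans[OF norm_triangle_ineq4]) simp
  have lim1: "(\<lambda>m. LINT x|cube_measure a b. g' x * tprod (\<psi> m) x) \<longlonglongrightarrow>
     (LINT x|cube_measure a b. g' x * tprod ((\<lambda>j. cwave a b (k j))(i := \<xi>)) x)"
  proof (rule integral_tprod_limit[OF gL2(2)])
    show "norm (\<psi> m j t) \<le> 2" for m j t
    proof -
      have "norm (\<psi> m j t) \<le> 2 * 1"
        unfolding \<psi>_def norm_mult using cutoff_bounds \<xi>_le by (intro mult_mono) auto
      then show ?thesis by simp
    qed
    show "(\<lambda>m. \<psi> m j t) \<longlonglongrightarrow> ((\<lambda>j. cwave a b (k j))(i := \<xi>)) j t" if "a < t" "t < b" for j t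
    proof -
      have "(\<lambda>m. \<psi> m j t) \<longlonglongrightarrow> (if j = i then \<xi> t else cwave a b (k j) t) * of_real 1"
        unfolding \<psi>_def by (intro tendsto_intros cutoff_lim that)
      then show ?thesis by auto
    qed
    show "continuous_on UNIV (((\<lambda>j. cwave a b (k j))(i := \<xi>)) j)" for j
      by (auto intro: smooth_continuous smooth_cwave sm\<xi>)
  qed (intro smooth_continuous sm)
  have lim2: "(\<lambda>m. LINT x|cube_measure a b. g x * tprod (\<psi>' m) x) \<longlonglongrightarrow>
     (LINT x|cube_measure a b. g x * tprod ((\<lambda>j. cwave a b (k j))(i := (\<lambda>t. - wave a b (k i) * cwave a b (k i) t))) x)"
  proof (rule integral_tprod_limit[OF gL2(1)])
    \<comment> \<open>\<open>4 * L\<close> comes from the derivative of the cutoff, \<open>L\<close>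
      from that of the exponential, and 1 covers the other coordinates.\<close>
    show "norm (\<psi>' m j t) \<le> max 1 (4 * L + L)" if t: "a < t" "t < b" for m j t
    proof (cases "j = i")
      case True
      have "norm (d\<psi> m t) \<le> norm (\<xi> t) * \<bar>cutoff' a b m t\<bar> + L * \<bar>cutoff a b m t\<bar>"
        unfolding d\<psi>_def L_def by (rule order_trans[OF norm_triangle_ineq]) (simp add: norm_mult)
      also have "norm (\<xi> t) * \<bar>cutoff' a b m t\<bar> \<le> 4 * L"
        using cutoff'_bound[OF t, of L "norm (\<xi> t)" m] cwave_dist[OF ab t, of "k i"]
        by (simp add: L_def \<xi>_def mult.commute)
      also have "L * \<bar>cutoff a b m t\<bar> \<le> L * 1"
        using cutoff_bounds by (intro mult_left_mono) (auto simp: L_def)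
      finally show ?thesis using True by (simp add: \<psi>'_def)
    next
      case False
      then have "norm (\<psi>' m j t) \<le> 1"
        using cutoff_bounds by (simp add: \<psi>'_def \<psi>_def norm_mult)
      then show ?thesis by simp
    qed
    show "(\<lambda>m. \<psi>' m j t) \<longlonglongrightarrow> ((\<lambda>j. cwave a b (k j))(i := (\<lambda>t. - wave a b (k i) * cwave a b (k i) t))) j t"
      if t: "a < t" "t < b" for j t
    proof (cases "j = i")
      case True
      have "(\<lambda>m. d\<psi> m t) \<longlonglongrightarrow> \<xi> t * of_real 0 + - wave a b (k i) * cwave a b (k i) t * of_real 1"
        unfolding d\<psi>_def by (intro tendsto_intros cutoff_lim t)
      then show ?thesis using True by (simp add: \<psi>'_def)
    next
      case False
      have "(\<lambda>m. cwave a b (k j) t * complex_of_real (cutoff a b m t)) \<longlonglongrightarrow> cwave a b (k j) t * of_real 1"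
        by (intro tendsto_intros cutoff_lim t)
      then show ?thesis using False by (simp add: \<psi>'_def \<psi>_def)
    qed
    show "continuous_on UNIV (((\<lambda>j. cwave a b (k j))(i := (\<lambda>t. - wave a b (k i) * cwave a b (k i) t))) j)" for j
      by (auto intro!: continuous_on_minus continuous_on_mult continuous_on_const smooth_continuous[OF smooth_cwave])
  qed (intro smooth_continuous sm')
  \<comment> \<open>The subtracted 1 is the exponential of frequency zero in coordinate
    \<open>i\<close>; the coefficient at \<open>k(i := 0)\<close> originates here.\<close>
  have A: "tprod ((\<lambda>j. cwave a b (k j))(i := \<xi>)) x =
     tprod (\<lambda>j. cwave a b (k j)) x - tprod (\<lambda>j. cwave a b ((k(i := 0)) j)) x" for x
  proof -
    have "(\<Prod>j\<in>UNIV - {i}. ((\<lambda>j. cwave a b (k j))(i := \<xi>)) j (x $ j)) = (\<Prod>j\<in>UNIV - {i}. cwave a b (k j) (x $ j))"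
      "(\<Prod>j\<in>UNIV - {i}. cwave a b ((k(i := 0)) j) (x $ j)) = (\<Prod>j\<in>UNIV - {i}. cwave a b (k j) (x $ j))"
      by (auto intro!: prod.cong)
    then show ?thesis
      unfolding tprod_remove[of _ _ i] by (simp add: \<xi>_def algebra_simps)
  qed
  have B: "tprod ((\<lambda>j. cwave a b (k j))(i := (\<lambda>t. - wave a b (k i) * cwave a b (k i) t))) x =
     - wave a b (k i) * tprod (\<lambda>j. cwave a b (k j)) x" for x
  proof -
    have "(\<Prod>j\<in>UNIV - {i}. ((\<lambda>j. cwave a b (k j))(i := (\<lambda>t. - wave a b (k i) * cwave a b (k i) t))) j (x $ j)) =
       (\<Prod>j\<in>UNIV - {i}. cwave a b (k j) (x $ j))"
      by (auto intro!: prod.cong)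
    then show ?thesis unfolding tprod_remove[of _ _ i] by simp
  qed
  have int: "integrable (cube_measure a b) (\<lambda>x. g' x * tprod (\<lambda>j. cwave a b (l j)) x)" for l
    by (intro L2_space_mult_integrable gL2 continuous_L2_cube continuous_on_tprod smooth_continuous smooth_cwave)
  have "(LINT x|cube_measure a b. g' x * tprod ((\<lambda>j. cwave a b (k j))(i := \<xi>)) x) =
     - (LINT x|cube_measure a b. g x * tprod ((\<lambda>j. cwave a b (k j))(i := (\<lambda>t. - wave a b (k i) * cwave a b (k i) t))) x)"
    using LIMSEQ_unique[OF lim1[unfolded parts] tendsto_minus[OF lim2]] .
  then have "(LINT x|cube_measure a b. g' x * tprod (\<lambda>j. cwave a b (k j)) x) -
      (LINT x|cube_measure a b. g' x * tprod (\<lambda>j. cwave a b ((k(i := 0)) j)) x) =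
     wave a b (k i) * (LINT x|cube_measure a b. g x * tprod (\<lambda>j. cwave a b (k j)) x)"
  proof -
    let ?P = "tprod (\<lambda>j. cwave a b (k j)) :: real^'n \<Rightarrow> complex"
    have "(LINT x|cube_measure a b. g x * (- wave a b (k i) * ?P x)) =
       (LINT x|cube_measure a b. - wave a b (k i) * (g x * ?P x))"
      by (simp add: mult.left_commute)
    also have "\<dots> = - wave a b (k i) * (LINT x|cube_measure a b. g x * ?P x)"
      by (rule integral_mult_right_zero)
    finally have 1: "(LINT x|cube_measure a b. g x * (- wave a b (k i) * ?P x)) = \<dots>" .
    show ?thesis if "(LINT x|cube_measure a b. g' x * tprod ((\<lambda>j. cwave a b (k j))(i := \<xi>)) x) =
     - (LINT x|cube_measure a b. g x * tprod ((\<lambda>j. cwave a b (k j))(i := (\<lambda>t. - wave a b (k i) * cwave a b (k i) t))) x)"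
      using that int[of k] int[of "k(i := 0)"]
      unfolding A B right_diff_distrib 1 by (simp del: fun_upd_apply)
  qed
  then show ?thesis unfolding fourier_tprod by (simp only: diff_divide_distrib[symmetric] times_divide_eq_right)
qed

section \<open>Weak derivatives of exponentials against arbitrary test functions\<close>

lemma has_vector_derivative_quotient_seq:
  fixes F :: "real \<Rightarrow> complex"
  assumes F: "(F has_vector_derivative F') (at 0)"
  shows "(\<lambda>m. (F (1 / real (Suc m)) - F 0) / of_real (1 / real (Suc m))) \<longlonglongrightarrow> F'"
proof -
  define h where "h m = 1 / real (Suc m)" for m
  have h0: "h m > 0" for m by (simp add: h_def)
  have "h \<longlonglongrightarrow> 0" unfolding h_def using LIMSEQ_inverse_real_of_nat by (simp add: inverse_eq_divide)
  then have h: "filterlim h (at 0) sequentially"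
    using h0 by (intro filterlim_atI) (auto intro!: always_eventually simp: less_imp_neq[symmetric])
  have "((\<lambda>y. norm (F y - F 0 - y *\<^sub>R F') / norm y) \<longlongrightarrow> 0) (at 0)"
    using F by (simp add: has_vector_derivative_def has_derivative_iff_norm)
  from filterlim_compose[OF this h]
  have "(\<lambda>m. norm (F (h m) - F 0 - h m *\<^sub>R F') / norm (h m)) \<longlonglongrightarrow> 0" by (simp add: o_def)
  moreover have "norm (F (h m) - F 0 - h m *\<^sub>R F') / norm (h m) = norm ((F (h m) - F 0) / of_real (h m) - F')" for m
  proof -
    have "(F (h m) - F 0) / of_real (h m) - F' = (F (h m) - F 0 - h m *\<^sub>R F') / of_real (h m)"
      using h0[of m] by (simp add: field_simps scaleR_conv_of_real)
    then show ?thesis using h0[of m] by (simp add: norm_divide)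
  qed
  ultimately have "(\<lambda>m. norm ((F (h m) - F 0) / of_real (h m) - F')) \<longlonglongrightarrow> 0" by simp
  then show ?thesis unfolding h_def by (rule LIM_zero_cancel[OF tendsto_norm_zero_cancel])
qed

lemma test_function_C_k: "\<phi> \<in> test_functions \<Omega> \<Longrightarrow> C_k k \<phi>"
  by (simp add: test_functions_def)

lemma test_function_continuous: "\<phi> \<in> test_functions \<Omega> \<Longrightarrow> continuous_on S \<phi>"
  using test_function_C_k[of \<phi> \<Omega> 0] continuous_on_subset by auto

lemma test_function_support:
  assumes "\<phi> \<in> test_functions \<Omega>"
  obtains R where "\<And>x. \<phi> x \<noteq> 0 \<Longrightarrow> norm x \<le> R"
proof -
  have "bounded (closure {x. \<phi> x \<noteq> 0})" using assms by (auto simp: test_functions_def compact_imp_bounded)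
  then obtain R where "\<And>x. x \<in> closure {x. \<phi> x \<noteq> 0} \<Longrightarrow> norm x \<le> R" unfolding bounded_iff by blast
  then have "norm x \<le> R" if "\<phi> x \<noteq> 0" for x using that closure_subset[of "{x. \<phi> x \<noteq> 0}"] by auto
  then show ?thesis by (rule that)
qed

lemma test_function_bounded:
  assumes "\<phi> \<in> test_functions \<Omega>"
  obtains C where "\<And>x. norm (\<phi> x) \<le> C"
proof -
  obtain R where R: "\<And>x. \<phi> x \<noteq> 0 \<Longrightarrow> norm x \<le> R" using test_function_support[OF assms] by blast
  have "bounded (\<phi> ` cball 0 R)"
    by (intro compact_imp_bounded compact_continuous_image test_function_continuous[OF assms] compact_cball)
  then obtain C where "\<forall>y\<in>\<phi> ` cball 0 R. norm y \<le> C" unfolding bounded_iff by blast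
  then have C: "\<And>x. x \<in> cball 0 R \<Longrightarrow> norm (\<phi> x) \<le> C" by blast
  have "norm (\<phi> x) \<le> \<bar>C\<bar>" for x
  proof (cases "\<phi> x = 0")
    case False
    then show ?thesis using C[of x] R[of x] by simp
  qed simp
  then show ?thesis by (rule that)
qed

lemma test_function_line_deriv:
  assumes "\<phi> \<in> test_functions \<Omega>"
  shows "((\<lambda>t. \<phi> (x + t *\<^sub>R axis i 1)) has_vector_derivative partial_deriv i \<phi> (x + u *\<^sub>R axis i 1)) (at u)"
proof -
  have diff: "\<phi> differentiable (at y)" for y using test_function_C_k[OF assms, of "Suc 0"] by simp
  have at0: "((\<lambda>t. \<phi> (y + t *\<^sub>R axis i 1)) has_vector_derivative partial_deriv i \<phi> y) (at 0)" for y
  proof -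
    have "(\<lambda>t::real. y + t *\<^sub>R axis i 1) differentiable (at 0)"
      by (intro derivative_intros)
    then have "(\<phi> \<circ> (\<lambda>t::real. y + t *\<^sub>R axis i 1)) differentiable (at 0)"
      by (rule differentiable_chain_at) (rule diff)
    then show ?thesis unfolding partial_deriv_def o_def by (simp add: vector_derivative_works)
  qed
  have "((\<lambda>t. t - u) has_vector_derivative 1) (at u)"
    by (auto intro!: derivative_eq_intros simp: has_real_derivative_iff_has_vector_derivative[symmetric])
  moreover have "((\<lambda>t. \<phi> ((x + u *\<^sub>R axis i 1) + t *\<^sub>R axis i 1)) has_vector_derivative partial_deriv i \<phi> (x + u *\<^sub>R axis i 1)) (at (u - u))"
    using at0 by simp
  ultimately have "((\<lambda>t. \<phi> ((x + u *\<^sub>R axis i 1) + t *\<^sub>R axis i 1)) \<circ> (\<lambda>t. t - u) has_vector_derivative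
     1 *\<^sub>R partial_deriv i \<phi> (x + u *\<^sub>R axis i 1)) (at u)"
    by (rule vector_diff_chain_at)
  then show ?thesis by (simp add: o_def algebra_simps)
qed

lemma test_function_partial_deriv:
  assumes \<phi>: "\<phi> \<in> test_functions \<Omega>"
  shows "partial_deriv i \<phi> \<in> test_functions \<Omega>"
proof -
  have "C_k k (partial_deriv i \<phi>)" for k using test_function_C_k[OF \<phi>, of "Suc k"] by simp
  moreover have sub: "{x. partial_deriv i \<phi> x \<noteq> 0} \<subseteq> closure {x. \<phi> x \<noteq> 0}"
  proof (rule ccontr)
    assume "\<not> ?thesis"
    then obtain x where x: "partial_deriv i \<phi> x \<noteq> 0" "x \<notin> closure {x. \<phi> x \<noteq> 0}" by blast
    \<comment> \<open>The parameters at which the line avoids the closed support form an open set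
      around 0, on which \<phi> vanishes identically.\<close>
    define S where "S = (\<lambda>t::real. x + t *\<^sub>R axis i 1) -` (- closure {x. \<phi> x \<noteq> 0})"
    have "open S" unfolding S_def
      by (intro open_vimage open_Compl closed_closure continuous_intros)
    moreover have "0 \<in> S" using x by (simp add: S_def)
    moreover have "\<phi> (x + t *\<^sub>R axis i 1) = 0" if "t \<in> S" for t
      using that closure_subset[of "{x. \<phi> x \<noteq> 0}"] by (auto simp: S_def)
    moreover have "((\<lambda>t. \<phi> (x + t *\<^sub>R axis i 1)) has_vector_derivative partial_deriv i \<phi> x) (at 0)"
      using test_function_line_deriv[OF \<phi>, of x i 0] by simp
    ultimately have "((\<lambda>t::real. 0) has_vector_derivative partial_deriv i \<phi> x) (at 0)"
      using has_vector_derivative_transform_within_open[of "\<lambda>t. \<phi> (x + t *\<^sub>R axis i 1)" _ 0 S "\<lambda>t. 0"] by blast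
    then have "partial_deriv i \<phi> x = 0" using vector_derivative_unique_at has_vector_derivative_const by blast
    with x show False by simp
  qed
  moreover have cl: "closure {x. partial_deriv i \<phi> x \<noteq> 0} \<subseteq> closure {x. \<phi> x \<noteq> 0}"
    using sub by (rule closure_minimal) simp
  moreover have "compact (closure {x. partial_deriv i \<phi> x \<noteq> 0})"
    using cl \<phi> by (auto simp: test_functions_def compact_eq_bounded_closed intro: bounded_subset)
  ultimately show ?thesis using \<phi> unfolding test_functions_def by blast
qed

lemma lborel_integral_translate:
  fixes f :: "'a::euclidean_space \<Rightarrow> complex"
  assumes [measurable]: "f \<in> borel_measurable borel"
  shows "(LINT x|lborel. f (c + x)) = (LINT x|lborel. f x)"
proof -
  have "(LINT x|lborel. f x) = (LINT x|distr lborel borel ((+) c). f x)"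
    by (simp only: lborel_distr_plus)
  also have "\<dots> = (LINT x|lborel. f (c + x))" by (rule integral_distr) measurable
  finally show ?thesis ..
qed

lemma character_shift:
  "character a b k (t *\<^sub>R axis i 1 + x) = exp (wave a b (k i) * of_real t) * character a b k x"
proof -
  have "(\<Sum>j\<in>UNIV. wave a b (k j) * of_real ((t *\<^sub>R axis i 1 + x) $ j - a)) =
     (\<Sum>j\<in>UNIV. (if j = i then wave a b (k i) * of_real t else 0) + wave a b (k j) * of_real (x $ j - a))"
    by (intro sum.cong) (auto simp: axis_def algebra_simps)
  also have "\<dots> = wave a b (k i) * of_real t + (\<Sum>j\<in>UNIV. wave a b (k j) * of_real (x $ j - a))"
    by (simp add: sum.distrib)
  finally show ?thesis by (simp add: character_def exp_add)
qed

text \<open>Integration by parts against a character: translating the product of the two functions does not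
  change its integral, and a character is an eigenfunction of translations.\<close>

lemma integral_character_partial_deriv:
  fixes \<phi> :: "real^'n::finite \<Rightarrow> complex"
  assumes \<phi>: "\<phi> \<in> test_functions \<Omega>"
  shows "(LINT x|lborel. character a b k x * partial_deriv i \<phi> x) =
    - wave a b (k i) * (LINT x|lborel. character a b k x * \<phi> x)"
proof -
  define h where "h m = 1 / real (Suc m)" for m
  have h: "0 < h m" "h m \<le> 1" for m by (auto simp: h_def)
  define v where "v = axis i (1::real)"
  define w where "w = wave a b (k i)"
  let ?E = "character a b k"
  let ?D = "\<lambda>m x. ?E x * ((\<phi> (x + h m *\<^sub>R v) - \<phi> x) / of_real (h m))"
  have c: "continuous_on UNIV \<phi>" "continuous_on UNIV (partial_deriv i \<phi>)"
    using \<phi> test_function_continuous test_function_partial_deriv by blast+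
  have m [measurable]: "\<phi> \<in> borel_measurable borel" "partial_deriv i \<phi> \<in> borel_measurable borel" "?E \<in> borel_measurable borel"
    by (intro borel_measurable_continuous_onI c continuous_on_character)+
  obtain R where R: "\<And>x. \<phi> x \<noteq> 0 \<Longrightarrow> norm x \<le> R" using test_function_support[OF \<phi>] by blast
  obtain B where B: "\<And>x. norm (partial_deriv i \<phi> x) \<le> B"
    using test_function_bounded[OF test_function_partial_deriv[OF \<phi>]] by blast
  obtain C where C: "\<And>x. norm (\<phi> x) \<le> C" using test_function_bounded[OF \<phi>] by blast
  have B0: "0 \<le> B" using B norm_ge_zero order_trans by blast
  have cball_int: "integrable lborel (\<lambda>x::real^'n. indicator (cball 0 r) x * K)" for r K :: real
    using emeasure_lborel_cball_finite[of "0::real^'n" r] by (intro integrable_mult_left integrable_real_indicator) auto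
  have \<phi>_int: "integrable lborel (\<lambda>x. ?E x * \<phi> x)"
  proof (rule Bochner_Integration.integrable_bound[OF cball_int[of R C]])
    have "norm (?E x * \<phi> x) \<le> norm (indicator (cball 0 R) x * C)" for x
    proof (cases "\<phi> x = 0")
      case False
      then show ?thesis using R[of x] C[of x] by (simp add: norm_mult)
    qed simp
    then show "AE x in lborel. norm (?E x * \<phi> x) \<le> norm (indicator (cball 0 R) x * C)" by simp
  qed measurable
  have L1: "(\<lambda>m. LINT x|lborel. ?D m x) \<longlonglongrightarrow> (LINT x|lborel. ?E x * partial_deriv i \<phi> x)"
  \<comment> \<open>The radius is \<open>R + 1\<close> since the shift has length at most 1;
    \<open>3 * B\<close> is \<open>2 * B\<close> for the linearisation error plus \<open>B\<close>
    for the derivative itself.\<close>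
  proof (rule integral_dominated_convergence[OF _ _ cball_int[of "R + 1" "3 * B"]])
    show "AE x in lborel. (\<lambda>m. ?D m x) \<longlonglongrightarrow> ?E x * partial_deriv i \<phi> x"
    proof (rule AE_I2)
      fix x
      have "((\<lambda>t. \<phi> (x + t *\<^sub>R v)) has_vector_derivative partial_deriv i \<phi> x) (at 0)"
        using test_function_line_deriv[OF \<phi>, of x i 0] by (simp add: v_def)
      from has_vector_derivative_quotient_seq[OF this]
      have "(\<lambda>m. (\<phi> (x + h m *\<^sub>R v) - \<phi> x) / of_real (h m)) \<longlonglongrightarrow> partial_deriv i \<phi> x"
        by (simp add: h_def)
      then show "(\<lambda>m. ?D m x) \<longlonglongrightarrow> ?E x * partial_deriv i \<phi> x" by (intro tendsto_intros)
    qed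
    show "AE x in lborel. norm (?D m x) \<le> indicator (cball 0 (R + 1)) x * (3 * B)" for m
    proof (rule AE_I2)
      fix x
      show "norm (?D m x) \<le> indicator (cball 0 (R + 1)) x * (3 * B)"
      proof (cases "x \<in> cball 0 (R + 1)")
        case True
        have "norm (\<phi> (x + h m *\<^sub>R v) - \<phi> (x + 0 *\<^sub>R v) - (h m - 0) *\<^sub>R partial_deriv i \<phi> (x + 0 *\<^sub>R v)) \<le> norm (h m - 0) * (2 * B)"
        proof (rule vector_differentiable_bound_linearization[where S = UNIV and f = "\<lambda>t. \<phi> (x + t *\<^sub>R v)" and f' = "\<lambda>u. partial_deriv i \<phi> (x + u *\<^sub>R v)"])
          show "((\<lambda>t. \<phi> (x + t *\<^sub>R v)) has_vector_derivative partial_deriv i \<phi> (x + u *\<^sub>R v)) (at u within UNIV)" for u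
            using test_function_line_deriv[OF \<phi>] by (simp add: v_def)
          show "norm (partial_deriv i \<phi> (x + u *\<^sub>R v) - partial_deriv i \<phi> (x + 0 *\<^sub>R v)) \<le> 2 * B" for u
            using norm_triangle_ineq4[of "partial_deriv i \<phi> (x + u *\<^sub>R v)" "partial_deriv i \<phi> (x + 0 *\<^sub>R v)"]
              B[of "x + u *\<^sub>R v"] B[of "x + 0 *\<^sub>R v"] by linarith
        qed auto
        then have "norm (\<phi> (x + h m *\<^sub>R v) - \<phi> x - h m *\<^sub>R partial_deriv i \<phi> x) \<le> h m * (2 * B)"
          using h[of m] by simp
        moreover have "norm (h m *\<^sub>R partial_deriv i \<phi> x) \<le> h m * B"
          using h[of m] B[of x] by (simp add: mult_left_mono)
        moreover have "norm (\<phi> (x + h m *\<^sub>R v) - \<phi> x) \<le>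
           norm (\<phi> (x + h m *\<^sub>R v) - \<phi> x - h m *\<^sub>R partial_deriv i \<phi> x) + norm (h m *\<^sub>R partial_deriv i \<phi> x)"
          using norm_triangle_ineq[of "\<phi> (x + h m *\<^sub>R v) - \<phi> x - h m *\<^sub>R partial_deriv i \<phi> x" "h m *\<^sub>R partial_deriv i \<phi> x"] by simp
        ultimately have "norm (\<phi> (x + h m *\<^sub>R v) - \<phi> x) \<le> h m * (3 * B)" by (simp add: algebra_simps)
        then have "norm (\<phi> (x + h m *\<^sub>R v) - \<phi> x) / h m \<le> 3 * B"
          using h[of m] by (simp add: pos_divide_le_eq mult.commute)
        then show ?thesis using True h[of m] by (simp add: norm_mult norm_divide)
      next
        case False
        then have x: "norm x > R + 1" by simp
        have "norm x \<le> norm (x + h m *\<^sub>R v) + norm (h m *\<^sub>R v)"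
          using norm_triangle_ineq4[of "x + h m *\<^sub>R v" "h m *\<^sub>R v"] by simp
        also have "norm (h m *\<^sub>R v) \<le> 1" using h[of m] by (simp add: v_def)
        finally have "norm (x + h m *\<^sub>R v) > R" using x by simp
        then have "\<phi> (x + h m *\<^sub>R v) = 0" using R by (meson not_le)
        moreover have "\<phi> x = 0" using R[of x] x by force
        ultimately show ?thesis using False by simp
      qed
    qed
  qed measurable
  have eq: "(LINT x|lborel. ?D m x) = (exp (- w * of_real (h m)) - 1) / of_real (h m) * (LINT x|lborel. ?E x * \<phi> x)" for m
  proof -
    define G where "G y = ?E y * \<phi> y" for y
    have G [measurable]: "G \<in> borel_measurable borel" unfolding G_def by measurable
    have G_int: "integrable lborel G" using \<phi>_int unfolding G_def[abs_def] .
    have G_shift_int: "integrable lborel (\<lambda>x. G (h m *\<^sub>R v + x))"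
    proof -
      have "integrable (distr lborel borel ((+) (h m *\<^sub>R v))) G" using G_int by (simp only: lborel_distr_plus)
      then show ?thesis by (subst (asm) integrable_distr_eq) auto
    qed
    have E: "?E x = exp (- w * of_real (h m)) * ?E (h m *\<^sub>R v + x)" for x
      unfolding v_def w_def character_shift by (simp add: exp_minus)
    have "?D m x = (exp (- w * of_real (h m)) * G (h m *\<^sub>R v + x) - G x) / of_real (h m)" for x
    proof -
      have "?E x * \<phi> (x + h m *\<^sub>R v) = exp (- w * of_real (h m)) * G (h m *\<^sub>R v + x)"
        unfolding G_def by (subst E) (simp add: add.commute)
      then show ?thesis by (simp add: G_def right_diff_distrib)
    qed
    then have "(LINT x|lborel. ?D m x) = (LINT x|lborel. (exp (- w * of_real (h m)) * G (h m *\<^sub>R v + x) - G x) / of_real (h m))"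
      by (simp only:)
    also have "\<dots> = (exp (- w * of_real (h m)) * (LINT x|lborel. G (h m *\<^sub>R v + x)) - (LINT x|lborel. G x)) / of_real (h m)"
      using G_int G_shift_int by simp
    also have "\<dots> = (exp (- w * of_real (h m)) - 1) / of_real (h m) * (LINT x|lborel. G x)"
      by (simp add: lborel_integral_translate left_diff_distrib diff_divide_distrib)
    finally show ?thesis unfolding G_def .
  qed
  have L2: "(\<lambda>m. (exp (- w * of_real (h m)) - 1) / of_real (h m) * (LINT x|lborel. ?E x * \<phi> x)) \<longlonglongrightarrow>
     - w * (LINT x|lborel. ?E x * \<phi> x)"
  proof (intro tendsto_mult tendsto_const)
    have "((\<lambda>z. exp (- w * z)) has_field_derivative - w) (at (of_real 0))"
      by (auto intro!: derivative_eq_intros)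
    from has_vector_derivative_quotient_seq[OF has_vector_derivative_real_field[OF this]]
    show "(\<lambda>m. (exp (- w * of_real (h m)) - 1) / of_real (h m)) \<longlonglongrightarrow> - w" by (simp add: h_def)
  qed
  show ?thesis using LIMSEQ_unique[OF L1[unfolded eq] L2] unfolding w_def .
qed

lemma test_function_foldr: "\<phi> \<in> test_functions \<Omega> \<Longrightarrow> foldr partial_deriv is \<phi> \<in> test_functions \<Omega>"
  by (induction "is") (auto intro: test_function_partial_deriv)

lemma test_function_multi_deriv: "\<phi> \<in> test_functions \<Omega> \<Longrightarrow> multi_deriv \<alpha> \<phi> \<in> test_functions \<Omega>"
  unfolding multi_deriv_def by (rule test_function_foldr)

text \<open>The symbol of the derivative of order \<alpha>: its eigenvalue on an
  exponential.\<close>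

definition wave_power :: "real \<Rightarrow> real \<Rightarrow> ('n::finite \<Rightarrow> nat) \<Rightarrow> ('n \<Rightarrow> int) \<Rightarrow> complex" where
  "wave_power a b \<alpha> k = (\<Prod>i\<in>UNIV. wave a b (k i) ^ \<alpha> i)"

lemma integral_character_multi_deriv:
  fixes \<phi> :: "real^'n::finite \<Rightarrow> complex"
  assumes \<phi>: "\<phi> \<in> test_functions \<Omega>"
  shows "(LINT x|lborel. character a b k x * multi_deriv \<alpha> \<phi> x) =
    (-1) ^ (\<Sum>i\<in>UNIV. \<alpha> i) * wave_power a b \<alpha> k * (LINT x|lborel. character a b k x * \<phi> x)"
proof -
  obtain "is" where "is": "\<And>i. count_list is i = \<alpha> i" "multi_deriv \<alpha> \<phi> = foldr partial_deriv is \<phi>"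
    using multi_deriv_list[of \<alpha>] by blast
  have "(LINT x|lborel. character a b k x * foldr partial_deriv is \<phi> x) =
     (\<Prod>i\<in>UNIV. (- wave a b (k i)) ^ count_list is i) * (LINT x|lborel. character a b k x * \<phi> x)"
  proof (induction "is")
    case (Cons j "is")
    have "(\<Prod>i\<in>UNIV. (- wave a b (k i)) ^ count_list (j # is) i) =
       (\<Prod>i\<in>UNIV. (if i = j then - wave a b (k j) else 1) * (- wave a b (k i)) ^ count_list is i)"
      by (intro prod.cong) auto
    also have "\<dots> = - wave a b (k j) * (\<Prod>i\<in>UNIV. (- wave a b (k i)) ^ count_list is i)"
      by (simp add: prod.distrib)
    finally show ?case
      using integral_character_partial_deriv[OF test_function_foldr[OF \<phi>, of "is"], of a b k j] Cons.IH by simp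
  qed simp
  moreover have "(\<Prod>i\<in>UNIV. (- wave a b (k i)) ^ \<alpha> i) = (-1) ^ (\<Sum>i\<in>UNIV. \<alpha> i) * wave_power a b \<alpha> k"
  proof -
    have "(- wave a b (k i)) ^ \<alpha> i = (-1) ^ \<alpha> i * wave a b (k i) ^ \<alpha> i" for i
      by (metis mult_minus1 power_mult_distrib)
    then show ?thesis by (simp add: wave_power_def prod.distrib power_sum)
  qed
  ultimately show ?thesis by (simp add: "is")
qed

lemma integral_interior_cube_test:
  fixes \<phi> :: "real^'n::finite \<Rightarrow> complex"
  assumes \<phi>: "\<phi> \<in> test_functions (interior (cube a b))"
  shows "(LINT x|lebesgue_on (interior (cube a b)). character a b k x * \<phi> x) = (LINT x|lborel. character a b k x * \<phi> x)"
proof -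
  have supp: "\<phi> x = 0" if "x \<notin> interior (cube a b)" for x
    using \<phi> that closure_subset[of "{x. \<phi> x \<noteq> 0}"] by (auto simp: test_functions_def)
  have m: "(\<lambda>x. character a b k x * \<phi> x) \<in> borel_measurable borel"
    by (intro borel_measurable_continuous_onI continuous_on_mult continuous_on_character test_function_continuous[OF \<phi>])
  have "(LINT x|lebesgue_on (interior (cube a b)). character a b k x * \<phi> x) =
     (LINT x|lebesgue. indicator (interior (cube a b)) x *\<^sub>R (character a b k x * \<phi> x))"
    by (intro integral_restrict_space) (auto simp: interior_cube)
  also have "\<dots> = (LINT x|lebesgue. character a b k x * \<phi> x)"
    using supp by (intro Bochner_Integration.integral_cong) (auto split: split_indicator)
  also have "\<dots> = (LINT x|lborel. character a b k x * \<phi> x)"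
    using m by (intro integral_completion) simp
  finally show ?thesis .
qed

text \<open>A weak derivative is tested against all test functions and not only against products, so
  the integration by parts for general \<phi> enters here.\<close>

lemma trig_weak_deriv: "is_L2_weak_deriv a b \<alpha> (trig a b k) (\<lambda>x. wave_power a b \<alpha> k * trig a b k x)"
  unfolding is_L2_weak_deriv_def has_weak_deriv_def L2_cube_def
proof (intro conjI L2_space_scale L2_locally_integrable trig_L2 ballI)
  fix \<phi> :: "real^'a \<Rightarrow> complex" assume \<phi>: "\<phi> \<in> test_functions (interior (cube a b))"
  let ?N = "complex_of_real (sqrt (b - a) ^ CARD('a))"
  have "(LINT x|lebesgue_on (interior (cube a b)). trig a b k x * multi_deriv \<alpha> \<phi> x) =
     (LINT x|lebesgue_on (interior (cube a b)). character a b k x * multi_deriv \<alpha> \<phi> x) / ?N"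
    unfolding trig_def times_divide_eq_left by (rule integral_divide_zero)
  also have "\<dots> = (-1) ^ (\<Sum>i\<in>UNIV. \<alpha> i) * (wave_power a b \<alpha> k * ((LINT x|lebesgue_on (interior (cube a b)). character a b k x * \<phi> x) / ?N))"
    unfolding integral_interior_cube_test[OF \<phi>] integral_interior_cube_test[OF test_function_multi_deriv[OF \<phi>]]
      integral_character_multi_deriv[OF \<phi>] by simp
  also have "(LINT x|lebesgue_on (interior (cube a b)). character a b k x * \<phi> x) / ?N =
     (LINT x|lebesgue_on (interior (cube a b)). trig a b k x * \<phi> x)"
    unfolding trig_def times_divide_eq_left by (rule integral_divide_zero[symmetric])
  also have "wave_power a b \<alpha> k * \<dots> = (LINT x|lebesgue_on (interior (cube a b)). wave_power a b \<alpha> k * trig a b k x * \<phi> x)"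
    unfolding mult.assoc by (rule integral_mult_right_zero[symmetric])
  finally show "(LINT x|lebesgue_on (interior (cube a b)). trig a b k x * multi_deriv \<alpha> \<phi> x) =
     (-1) ^ (\<Sum>i\<in>UNIV. \<alpha> i) * (LINT x|lebesgue_on (interior (cube a b)). wave_power a b \<alpha> k * trig a b k x * \<phi> x)" .
qed

lemma weak_deriv_lincomb:
  fixes f f' :: "real^'n::finite \<Rightarrow> complex"
  assumes f: "f \<in> L2_space (cube_measure a b)" "is_L2_weak_deriv a b \<alpha> f g"
    and f': "f' \<in> L2_space (cube_measure a b)" "is_L2_weak_deriv a b \<alpha> f' g'"
  shows "is_L2_weak_deriv a b \<alpha> (\<lambda>x. c * f x + f' x) (\<lambda>x. c * g x + g' x)"
  unfolding is_L2_weak_deriv_def has_weak_deriv_def L2_cube_def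
proof (intro conjI ballI)
  have g: "g \<in> L2_space (cube_measure a b)" "g' \<in> L2_space (cube_measure a b)"
    using f f' by (simp_all add: is_L2_weak_deriv_def L2_cube_def)
  have L2: "(\<lambda>x. c * f x + f' x) \<in> L2_space (cube_measure a b)" "(\<lambda>x. c * g x + g' x) \<in> L2_space (cube_measure a b)"
    using f(1) f'(1) g by (auto intro!: L2_space_add L2_space_scale)
  then show "(\<lambda>x. c * g x + g' x) \<in> L2_space (cube_measure a b)"
    "locally_integrable_on (\<lambda>x. c * f x + f' x) (interior (cube a b))"
    "locally_integrable_on (\<lambda>x. c * g x + g' x) (interior (cube a b))"
    by (auto intro: L2_locally_integrable)
  fix \<phi> :: "real^'n \<Rightarrow> complex" assume \<phi>: "\<phi> \<in> test_functions (interior (cube a b))"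
  have \<phi>L2: "\<phi> \<in> L2_space (cube_measure a b)" "multi_deriv \<alpha> \<phi> \<in> L2_space (cube_measure a b)"
    using \<phi> test_function_multi_deriv[OF \<phi>] by (auto intro: continuous_L2_cube test_function_continuous)
  have lin: "(LINT x|lebesgue_on (interior (cube a b)). (c * u x + u' x) * p x) =
     c * (LINT x|lebesgue_on (interior (cube a b)). u x * p x) + (LINT x|lebesgue_on (interior (cube a b)). u' x * p x)"
    if "u \<in> L2_space (cube_measure a b)" "u' \<in> L2_space (cube_measure a b)" "p \<in> L2_space (cube_measure a b)" for u u' p :: "real^'n \<Rightarrow> complex"
  proof -
    have i: "integrable (cube_measure a b) (\<lambda>x. u x * p x)" "integrable (cube_measure a b) (\<lambda>x. u' x * p x)"
      using that by (auto intro: L2_space_mult_integrable)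
    have "(LINT x|cube_measure a b. (c * u x + u' x) * p x) = (LINT x|cube_measure a b. c * (u x * p x) + u' x * p x)"
      by (simp add: algebra_simps)
    also have "\<dots> = c * (LINT x|cube_measure a b. u x * p x) + (LINT x|cube_measure a b. u' x * p x)"
      using i by simp
    finally have 1: "(LINT x|cube_measure a b. (c * u x + u' x) * p x) = \<dots>" .
    have m: "(\<lambda>x. (c * u x + u' x) * p x) \<in> borel_measurable (cube_measure a b)"
      using that by (auto simp: L2_space_def)
    show ?thesis
      unfolding integral_interior_cube[OF m] integral_interior_cube[OF borel_measurable_integrable[OF i(1)]]
        integral_interior_cube[OF borel_measurable_integrable[OF i(2)]] by (rule 1)
  qed
  show "(LINT x|lebesgue_on (interior (cube a b)). (c * f x + f' x) * multi_deriv \<alpha> \<phi> x) =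
     (-1) ^ (\<Sum>i\<in>UNIV. \<alpha> i) * (LINT x|lebesgue_on (interior (cube a b)). (c * g x + g' x) * \<phi> x)"
  proof -
    have 1: "(LINT x|lebesgue_on (interior (cube a b)). f x * multi_deriv \<alpha> \<phi> x) =
      (-1) ^ (\<Sum>i\<in>UNIV. \<alpha> i) * (LINT x|lebesgue_on (interior (cube a b)). g x * \<phi> x)"
     "(LINT x|lebesgue_on (interior (cube a b)). f' x * multi_deriv \<alpha> \<phi> x) =
      (-1) ^ (\<Sum>i\<in>UNIV. \<alpha> i) * (LINT x|lebesgue_on (interior (cube a b)). g' x * \<phi> x)"
      using f(2) f'(2) \<phi> by (simp_all add: is_L2_weak_deriv_def has_weak_deriv_def)
    show ?thesis
      unfolding lin[OF f(1) f'(1) \<phi>L2(2)] lin[OF g \<phi>L2(1)] 1 by (simp add: algebra_simps)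
  qed
qed

lemma weak_deriv_zero: "is_L2_weak_deriv a b \<alpha> (\<lambda>x. 0) (\<lambda>x. 0)"
proof -
  have "is_L2_weak_deriv a b \<alpha> (\<lambda>x. (-1) * trig a b (\<lambda>_. 0) x + trig a b (\<lambda>_. 0) x)
     (\<lambda>x. (-1) * (wave_power a b \<alpha> (\<lambda>_. 0) * trig a b (\<lambda>_. 0) x) + wave_power a b \<alpha> (\<lambda>_. 0) * trig a b (\<lambda>_. 0) x)"
    by (intro weak_deriv_lincomb trig_L2 trig_weak_deriv)
  then show ?thesis by simp
qed

lemma multi_deriv_0: "multi_deriv (\<lambda>_. 0) \<phi> = \<phi>"
proof -
  obtain "is" where "is": "\<And>i. count_list is i = 0" "multi_deriv (\<lambda>_. 0) \<phi> = foldr partial_deriv is \<phi>"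
    using multi_deriv_list[of "\<lambda>_. 0"] by blast
  then have "is = []" by (metis count_list_0_iff list.set_intros(1) neq_Nil_conv)
  then show ?thesis using "is" by simp
qed

lemma weak_deriv_self:
  "f \<in> L2_space (cube_measure a b) \<Longrightarrow> is_L2_weak_deriv a b (\<lambda>_. 0) f f"
  by (simp add: is_L2_weak_deriv_def has_weak_deriv_def L2_cube_def L2_locally_integrable multi_deriv_0)

section \<open>Coefficient functionals and the norm of the Sobolev space\<close>

definition mix_coeff :: "real \<Rightarrow> real \<Rightarrow> ('n::finite \<Rightarrow> nat) \<Rightarrow> (real^'n \<Rightarrow> complex) \<Rightarrow> ('n \<Rightarrow> int) \<Rightarrow> complex" where
  "mix_coeff a b \<alpha> f k = fourier a b (weak_deriv a b \<alpha> f) k"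

lemma H_mix_L2: "f \<in> H_mix a b s \<Longrightarrow> f \<in> L2_space (cube_measure a b)"
  by (simp add: H_mix_def L2_cube_def)

lemma H_mix_weak_deriv:
  "f \<in> H_mix a b s \<Longrightarrow> \<alpha> \<in> multi_indices s \<Longrightarrow> is_L2_weak_deriv a b \<alpha> f (weak_deriv a b \<alpha> f)"
  unfolding weak_deriv_def by (rule someI_ex[of "is_L2_weak_deriv a b \<alpha> f"]) (simp add: H_mix_def)

lemma weak_deriv_L2: "is_L2_weak_deriv a b \<alpha> f g \<Longrightarrow> g \<in> L2_space (cube_measure a b)"
  by (simp add: is_L2_weak_deriv_def L2_cube_def)

lemma H_mix_zero: "(\<lambda>x. 0) \<in> H_mix a b s"
  unfolding H_mix_def L2_cube_def using weak_deriv_zero by (auto simp: L2_space_zero)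

lemma H_mix_lincomb:
  assumes "f \<in> H_mix a b s" "g \<in> H_mix a b s"
  shows "(\<lambda>x. c * f x + g x) \<in> H_mix a b s"
proof -
  have "(\<lambda>x. c * f x + g x) \<in> L2_space (cube_measure a b)"
    using assms by (intro L2_space_add L2_space_scale H_mix_L2)
  moreover have "\<exists>h. is_L2_weak_deriv a b \<alpha> (\<lambda>x. c * f x + g x) h" if "\<alpha> \<in> multi_indices s" for \<alpha>
    using weak_deriv_lincomb[OF H_mix_L2[OF assms(1)] H_mix_weak_deriv[OF assms(1) that]
        H_mix_L2[OF assms(2)] H_mix_weak_deriv[OF assms(2) that]] by blast
  ultimately show ?thesis by (simp add: H_mix_def L2_cube_def)
qed

lemma fourier_lincomb:
  assumes "f \<in> L2_space (cube_measure a b)" "g \<in> L2_space (cube_measure a b)"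
  shows "fourier a b (\<lambda>x. c * f x + g x) k = c * fourier a b f k + fourier a b g k"
  unfolding fourier_def using assms
  by (simp add: L2_inner_add_left L2_space_scale trig_L2 L2_inner_scale_left)

lemma mix_coeff_eq:
  assumes "a < b" "f \<in> L2_space (cube_measure a b)" "is_L2_weak_deriv a b \<alpha> f g"
  shows "mix_coeff a b \<alpha> f k = fourier a b g k"
proof -
  have "is_L2_weak_deriv a b \<alpha> f (weak_deriv a b \<alpha> f)"
    unfolding weak_deriv_def using assms(3) by (rule someI[of "is_L2_weak_deriv a b \<alpha> f"])
  then show ?thesis unfolding mix_coeff_def
    by (rule fourier_weak_deriv_unique[OF assms(1,2)]) (rule assms(3))
qed

text \<open>The chosen derivative of a combination need not be the combination of the chosen
  derivatives, but by uniqueness their Fourier coefficients agree.\<close>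

lemma mix_coeff_lincomb:
  assumes ab: "a < b" and f: "f \<in> H_mix a b s" and g: "g \<in> H_mix a b s" and \<alpha>: "\<alpha> \<in> multi_indices s"
  shows "mix_coeff a b \<alpha> (\<lambda>x. c * f x + g x) k = c * mix_coeff a b \<alpha> f k + mix_coeff a b \<alpha> g k"
proof -
  note wd = H_mix_weak_deriv[OF f \<alpha>] H_mix_weak_deriv[OF g \<alpha>]
  have "mix_coeff a b \<alpha> (\<lambda>x. c * f x + g x) k = fourier a b (\<lambda>x. c * weak_deriv a b \<alpha> f x + weak_deriv a b \<alpha> g x) k"
    by (intro mix_coeff_eq ab H_mix_L2[OF H_mix_lincomb[OF f g]] weak_deriv_lincomb H_mix_L2[OF f] H_mix_L2[OF g] wd)
  then show ?thesis
    using wd by (simp add: fourier_lincomb weak_deriv_L2 mix_coeff_def)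
qed

lemma mix_coeff_zero_index:
  "a < b \<Longrightarrow> f \<in> L2_space (cube_measure a b) \<Longrightarrow> mix_coeff a b (\<lambda>_. 0) f k = fourier a b f k"
  by (intro mix_coeff_eq weak_deriv_self)

lemma mix_coeff_step:
  assumes ab: "a < b" and f: "f \<in> H_mix a b s" and \<alpha>: "\<alpha> \<in> multi_indices s" "\<alpha>(i := Suc (\<alpha> i)) \<in> multi_indices s"
  shows "mix_coeff a b (\<alpha>(i := Suc (\<alpha> i))) f k - mix_coeff a b (\<alpha>(i := Suc (\<alpha> i))) f (k(i := 0)) =
    wave a b (k i) * mix_coeff a b \<alpha> f k"
  unfolding mix_coeff_def
  by (rule fourier_weak_deriv_step[OF ab H_mix_L2[OF f] H_mix_weak_deriv[OF f \<alpha>(1)] H_mix_weak_deriv[OF f \<alpha>(2)]])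

lemma finite_multi_indices: "finite (multi_indices s :: ('n::finite \<Rightarrow> nat) set)"
proof -
  have "(multi_indices s :: ('n \<Rightarrow> nat) set) = PiE UNIV (\<lambda>_. {0..s})"
    by (auto simp: multi_indices_def PiE_def Pi_def)
  then show ?thesis by (simp add: finite_PiE)
qed

lemma H_mix_norm_power2:
  fixes f :: "real^'n::finite \<Rightarrow> complex"
  shows "(H_mix_norm a b s f)\<^sup>2 = (\<Sum>\<alpha>\<in>multi_indices s. (L2_norm (cube_measure a b) (weak_deriv a b \<alpha> f))\<^sup>2)"
proof -
  have "Re (H_mix_inner a b s f f) = (\<Sum>\<alpha>\<in>multi_indices s. (L2_norm (cube_measure a b) (weak_deriv a b \<alpha> f))\<^sup>2)"
    unfolding H_mix_inner_def by (simp add: L2_inner_self flip: of_real_power)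
  moreover have "0 \<le> (\<Sum>\<alpha>\<in>multi_indices s. (L2_norm (cube_measure a b) (weak_deriv a b \<alpha> f))\<^sup>2)"
    by (intro sum_nonneg) auto
  ultimately show ?thesis by (simp add: H_mix_norm_def)
qed

lemma H_mix_norm_nonneg:
  fixes f :: "real^'n::finite \<Rightarrow> complex"
  shows "0 \<le> H_mix_norm a b s f"
proof -
  have "Re (H_mix_inner a b s f f) = (\<Sum>\<alpha>\<in>multi_indices s. (L2_norm (cube_measure a b) (weak_deriv a b \<alpha> f))\<^sup>2)"
    unfolding H_mix_inner_def by (simp add: L2_inner_self flip: of_real_power)
  then show ?thesis by (simp add: H_mix_norm_def sum_nonneg)
qed

text \<open>A single \<alpha> is one summand of the squared norm, and Bessel applies to it. With a
  one-element \<open>K\<close> each coefficient is seen to be a bounded functional.\<close>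

lemma mix_coeff_Bessel:
  fixes f :: "real^'n::finite \<Rightarrow> complex"
  assumes ab: "a < b" and f: "f \<in> H_mix a b s" and \<alpha>: "\<alpha> \<in> multi_indices s" and K: "finite K"
  shows "(\<Sum>k\<in>K. (norm (mix_coeff a b \<alpha> f k))\<^sup>2) \<le> (H_mix_norm a b s f)\<^sup>2"
proof -
  have "(\<Sum>k\<in>K. (norm (mix_coeff a b \<alpha> f k))\<^sup>2) \<le> (L2_norm (cube_measure a b) (weak_deriv a b \<alpha> f))\<^sup>2"
    unfolding mix_coeff_def by (rule fourier_Bessel[OF ab weak_deriv_L2[OF H_mix_weak_deriv[OF f \<alpha>]] K])
  also have "\<dots> \<le> (H_mix_norm a b s f)\<^sup>2"
    unfolding H_mix_norm_power2 by (rule member_le_sum[OF \<alpha>]) (auto simp: finite_multi_indices)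
  finally show ?thesis .
qed

lemma norm_mix_coeff_le:
  fixes f :: "real^'n::finite \<Rightarrow> complex"
  assumes "a < b" "f \<in> H_mix a b s" "\<alpha> \<in> multi_indices s"
  shows "norm (mix_coeff a b \<alpha> f k) \<le> H_mix_norm a b s f"
  using mix_coeff_Bessel[OF assms, of "{k}"] by (auto intro: power2_le_imp_le H_mix_norm_nonneg)

lemma zero_multi_index: "(\<lambda>_. 0) \<in> multi_indices s"
  by (simp add: multi_indices_def)

text \<open>The summand for \<alpha> = 0 involves a chosen representative rather than f itself, so
  the comparison goes through Fourier coefficients.\<close>

lemma L2_norm_le_H_mix_norm:
  fixes f :: "real^'n::finite \<Rightarrow> complex"
  assumes ab: "a < b" and f: "f \<in> H_mix a b s"
  shows "L2_norm (cube_measure a b) f \<le> H_mix_norm a b s f"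
proof -
  have "(L2_norm (cube_measure a b) f)\<^sup>2 \<le> (H_mix_norm a b s f)\<^sup>2"
  proof (rule fourier_bounded_imp_norm_le[OF ab H_mix_L2[OF f]])
    fix K :: "('n \<Rightarrow> int) set" assume "finite K"
    then show "(\<Sum>k\<in>K. (norm (fourier a b f k))\<^sup>2) \<le> (H_mix_norm a b s f)\<^sup>2"
      using mix_coeff_Bessel[OF ab f zero_multi_index, of K] by (simp add: mix_coeff_zero_index[OF ab H_mix_L2[OF f]])
  qed
  then show ?thesis by (rule power2_le_imp_le) (rule H_mix_norm_nonneg)
qed

text \<open>Any family of weak derivatives computes the norm, because representatives with equal
  Fourier coefficients have equal norms.\<close>

lemma H_mix_norm_eqI:
  fixes f :: "real^'n::finite \<Rightarrow> complex"
  assumes ab: "a < b" and f: "f \<in> L2_space (cube_measure a b)"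
    and g: "\<And>\<alpha>. \<alpha> \<in> multi_indices s \<Longrightarrow> is_L2_weak_deriv a b \<alpha> f (g \<alpha>)"
  shows "(H_mix_norm a b s f)\<^sup>2 = (\<Sum>\<alpha>\<in>multi_indices s. (L2_norm (cube_measure a b) (g \<alpha>))\<^sup>2)"
  unfolding H_mix_norm_power2
proof (intro sum.cong refl arg_cong[where f = "\<lambda>x. x\<^sup>2"])
  fix \<alpha> :: "'n \<Rightarrow> nat" assume \<alpha>: "\<alpha> \<in> multi_indices s"
  have fH: "f \<in> H_mix a b s" using f g by (auto simp: H_mix_def L2_cube_def)
  show "L2_norm (cube_measure a b) (weak_deriv a b \<alpha> f) = L2_norm (cube_measure a b) (g \<alpha>)"
  proof (rule fourier_eq_imp_norm_eq(1)[OF ab])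
    show "fourier a b (weak_deriv a b \<alpha> f) k = fourier a b (g \<alpha>) k" for k
      using mix_coeff_eq[OF ab f g[OF \<alpha>]] by (simp add: mix_coeff_def)
  qed (intro weak_deriv_L2[OF g[OF \<alpha>]] weak_deriv_L2[OF H_mix_weak_deriv[OF fH \<alpha>]])+
qed

lemma H_mix_norm_scale:
  fixes f :: "real^'n::finite \<Rightarrow> complex"
  assumes ab: "a < b" and f: "f \<in> H_mix a b s"
  shows "H_mix_norm a b s (\<lambda>x. c * f x) = norm c * H_mix_norm a b s f"
proof -
  have "(H_mix_norm a b s (\<lambda>x. c * f x))\<^sup>2 = (\<Sum>\<alpha>\<in>multi_indices s. (L2_norm (cube_measure a b) (\<lambda>x. c * weak_deriv a b \<alpha> f x))\<^sup>2)"
  proof (rule H_mix_norm_eqI[OF ab])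
    show "(\<lambda>x. c * f x) \<in> L2_space (cube_measure a b)" by (intro L2_space_scale H_mix_L2[OF f])
    fix \<alpha> :: "'n \<Rightarrow> nat" assume \<alpha>: "\<alpha> \<in> multi_indices s"
    show "is_L2_weak_deriv a b \<alpha> (\<lambda>x. c * f x) (\<lambda>x. c * weak_deriv a b \<alpha> f x)"
      using weak_deriv_lincomb[OF H_mix_L2[OF f] H_mix_weak_deriv[OF f \<alpha>] L2_space_zero weak_deriv_zero, of c] by simp
  qed
  also have "\<dots> = (norm c * H_mix_norm a b s f)\<^sup>2"
    unfolding L2_norm_scale power_mult_distrib H_mix_norm_power2 sum_distrib_left ..
  finally show ?thesis
    by (rule power2_eq_imp_eq) (auto simp: H_mix_norm_nonneg)
qed

lemma trig_sum_weak_deriv: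
  assumes "finite K"
  shows "is_L2_weak_deriv a b \<alpha> (\<lambda>x. \<Sum>k\<in>K. c k * trig a b k x)
    (\<lambda>x. \<Sum>k\<in>K. (c k * wave_power a b \<alpha> k) * trig a b k x)"
  using assms
proof (induction K rule: finite_induct)
  case (insert k K)
  have "(\<lambda>x. \<Sum>k\<in>K. c k * trig a b k x) \<in> L2_space (cube_measure a b)"
    by (intro L2_space_sum L2_space_scale trig_L2)
  from weak_deriv_lincomb[OF trig_L2 trig_weak_deriv this insert.IH, of "c k"]
  show ?case using insert.hyps by (simp add: mult.assoc)
qed (simp add: weak_deriv_zero)

definition sobolev_weight :: "real \<Rightarrow> real \<Rightarrow> nat \<Rightarrow> int \<Rightarrow> real" where
  "sobolev_weight a b s k = (\<Sum>l=0..s. (norm (wave a b k))\<^sup>2 ^ l)"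

text \<open>Multiplying out the product over coordinates gives exactly the sum over multi-indices:
  the tensor product structure of the norm, seen on exponentials.\<close>

lemma sum_wave_power:
  fixes k :: "'n::finite \<Rightarrow> int"
  shows "(\<Sum>\<alpha>\<in>multi_indices s. (norm (wave_power a b \<alpha> k))\<^sup>2) = (\<Prod>i\<in>UNIV. sobolev_weight a b s (k i))"
proof -
  have "(multi_indices s :: ('n \<Rightarrow> nat) set) = PiE UNIV (\<lambda>_. {0..s})"
    by (auto simp: multi_indices_def PiE_def Pi_def)
  moreover have "(norm (wave_power a b \<alpha> k))\<^sup>2 = (\<Prod>i\<in>UNIV. (norm (wave a b (k i)))\<^sup>2 ^ \<alpha> i)" for \<alpha>
    by (simp add: wave_power_def norm_power prod_norm[symmetric] prod_power_distrib power_mult[symmetric] mult.commute)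
  ultimately show ?thesis
    unfolding sobolev_weight_def by (simp add: prod_sum_PiE)
qed

text \<open>Every derivative acts diagonally on exponentials, so they remain orthogonal in the
  Sobolev space.\<close>

lemma H_mix_norm_trig_sum:
  fixes K :: "('n::finite \<Rightarrow> int) set"
  assumes ab: "a < b" and K: "finite K"
  shows "(H_mix_norm a b s (\<lambda>x. \<Sum>k\<in>K. c k * trig a b k x))\<^sup>2 =
    (\<Sum>k\<in>K. (norm (c k))\<^sup>2 * (\<Prod>i\<in>UNIV. sobolev_weight a b s (k i)))"
proof -
  have n: "(L2_norm (cube_measure a b) (\<lambda>x. \<Sum>k\<in>K. d k * trig a b k x))\<^sup>2 = (\<Sum>k\<in>K. (norm (d k))\<^sup>2)" for d
    by (rule L2_orthonormal_expansion(1)[OF K trig_L2 trig_L2 trig_orthonormal[OF ab]])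
  have "(H_mix_norm a b s (\<lambda>x. \<Sum>k\<in>K. c k * trig a b k x))\<^sup>2 = (\<Sum>\<alpha>\<in>multi_indices s.
     (L2_norm (cube_measure a b) (\<lambda>x. \<Sum>k\<in>K. (c k * wave_power a b \<alpha> k) * trig a b k x))\<^sup>2)"
    by (rule H_mix_norm_eqI[OF ab]) (intro L2_space_sum L2_space_scale trig_L2 trig_sum_weak_deriv[OF K])+
  also have "\<dots> = (\<Sum>k\<in>K. \<Sum>\<alpha>\<in>multi_indices s. (norm (c k))\<^sup>2 * (norm (wave_power a b \<alpha> k))\<^sup>2)"
    unfolding n by (subst sum.swap) (simp add: norm_mult power_mult_distrib)
  finally show ?thesis by (simp add: sum_distrib_left[symmetric] sum_wave_power)
qed

lemma trig_H_mix: "trig a b k \<in> H_mix a b s"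
  unfolding H_mix_def L2_cube_def using trig_weak_deriv trig_L2 by blast

section \<open>Upper and lower bounds for approximation numbers of an abstract embedding\<close>

section \<open>Approximation numbers of embeddings into square integrable functions\<close>

text \<open>Gaussian elimination: an equation with a nonzero entry determines one unknown, which is
  eliminated from the remaining equations.\<close>

lemma underdetermined_system:
  fixes m :: "'k \<Rightarrow> 'g \<Rightarrow> complex"
  assumes "finite B" "finite K" "card B < card K"
  shows "\<exists>c. (\<exists>k\<in>K. c k \<noteq> 0) \<and> (\<forall>g\<in>B. (\<Sum>k\<in>K. c k * m k g) = 0)"
  using assms
proof (induction B arbitrary: K m rule: finite_induct)
  case empty
  then have "K \<noteq> {}" by auto
  then show ?case by (intro exI[of _ "\<lambda>_. 1"]) auto
next
  case (insert b B)
  show ?case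
  proof (cases "\<forall>k\<in>K. m k b = 0")
    case True
    have "card B < card K" using insert.prems insert.hyps by simp
    then obtain c where "\<exists>k\<in>K. c k \<noteq> 0" "\<forall>g\<in>B. (\<Sum>k\<in>K. c k * m k g) = 0"
      using insert.IH[OF insert.prems(1), of m] by blast
    then show ?thesis using True by (intro exI[of _ c]) auto
  next
    case False
    then obtain k0 where k0: "k0 \<in> K" "m k0 b \<noteq> 0" by blast
    define m' where "m' k g = m k g - m k b / m k0 b * m k0 g" for k g
    have K': "finite (K - {k0})" "card B < card (K - {k0})"
      using insert.prems insert.hyps k0 by auto
    obtain c where c: "\<exists>k\<in>K - {k0}. c k \<noteq> 0" "\<And>g. g \<in> B \<Longrightarrow> (\<Sum>k\<in>K - {k0}. c k * m' k g) = 0"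
      using insert.IH[OF K', of m'] by blast
    \<comment> \<open>The eliminated unknown is recovered from equation \<open>b\<close>.\<close>
    define c' where "c' = c(k0 := - (\<Sum>k\<in>K - {k0}. c k * m k b) / m k0 b)"
    have sum: "(\<Sum>k\<in>K. c' k * m k g) = (\<Sum>k\<in>K - {k0}. c k * m' k g)" for g
    proof -
      have "(\<Sum>k\<in>K. c' k * m k g) = c' k0 * m k0 g + (\<Sum>k\<in>K - {k0}. c' k * m k g)"
        using insert.prems(1) k0(1) by (rule sum.remove)
      also have "(\<Sum>k\<in>K - {k0}. c' k * m k g) = (\<Sum>k\<in>K - {k0}. c k * m k g)"
        by (intro sum.cong) (auto simp: c'_def)
      finally show ?thesis
        by (simp add: c'_def m'_def sum_subtractf right_diff_distrib sum_divide_distrib sum_distrib_right mult.assoc)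
    qed
    have "(\<Sum>k\<in>K - {k0}. c k * m' k b) = 0" using k0 by (simp add: m'_def)
    then have "\<forall>g\<in>insert b B. (\<Sum>k\<in>K. c' k * m k g) = 0" using c(2) by (simp add: sum)
    moreover have "\<exists>k\<in>K. c' k \<noteq> 0" using c(1) by (auto simp: c'_def)
    ultimately show ?thesis by blast
  qed
qed

locale L2_embedding =
  fixes X :: "('a \<Rightarrow> complex) set" and p :: "('a \<Rightarrow> complex) \<Rightarrow> real" and M :: "'a measure"
  assumes X_L2: "X \<subseteq> L2_space M"
    and X_zero: "(\<lambda>x. 0) \<in> X"
    and X_lincomb: "\<And>c f g. f \<in> X \<Longrightarrow> g \<in> X \<Longrightarrow> (\<lambda>x. c * f x + g x) \<in> X"
    and p_scale: "\<And>c f. f \<in> X \<Longrightarrow> p (\<lambda>x. c * f x) = norm c * p f"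
    and norm_le_p: "\<And>f. f \<in> X \<Longrightarrow> L2_norm M f \<le> p f"
begin

lemma X_add: "f \<in> X \<Longrightarrow> g \<in> X \<Longrightarrow> (\<lambda>x. f x + g x) \<in> X"
  using X_lincomb[of f g 1] by simp

lemma X_scale: "f \<in> X \<Longrightarrow> (\<lambda>x. c * f x) \<in> X"
  using X_lincomb[of f "\<lambda>x. 0" c] X_zero by simp

lemma X_sum: "(\<And>k. k \<in> K \<Longrightarrow> e k \<in> X) \<Longrightarrow> (\<lambda>x. \<Sum>k\<in>K. c k * e k x) \<in> X"
  by (induction K rule: infinite_finite_induct) (auto simp: X_zero X_lincomb)

lemma p_zero: "p (\<lambda>x. 0) = 0"
  using p_scale[OF X_zero, of 0] by simp

lemma p_nonneg: "f \<in> X \<Longrightarrow> 0 \<le> p f"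
  using norm_le_p L2_norm_nonneg order_trans by blast

text \<open>\<open>operator_norm\<close> is a supremum of reals and meaningful only over bounded
  sets; boundedness comes from \<open>norm_le_p\<close> and the bound of \<open>A\<close>.\<close>

lemma embedding_diff_bdd:
  assumes "bounded_linear_op X p (L2_space M) (L2_norm M) A"
  shows "bdd_above ((\<lambda>f. L2_norm M (\<lambda>y. f y - A f y)) ` {f \<in> X. p f \<le> 1})"
proof -
  obtain C where A: "\<And>f. f \<in> X \<Longrightarrow> A f \<in> L2_space M" and C: "\<And>f. f \<in> X \<Longrightarrow> L2_norm M (A f) \<le> C * p f"
    using assms unfolding bounded_linear_op_def by blast
  have "L2_norm M (\<lambda>y. f y - A f y) \<le> 1 + \<bar>C\<bar>" if f: "f \<in> X" "p f \<le> 1" for f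
  proof -
    have "L2_norm M (\<lambda>y. f y + (-1) * A f y) \<le> L2_norm M f + L2_norm M (\<lambda>y. (-1) * A f y)"
      using f A X_L2 by (intro L2_norm_triangle L2_space_scale) auto
    also have "\<dots> = L2_norm M f + L2_norm M (A f)" unfolding L2_norm_scale by simp
    also have "\<dots> \<le> 1 + \<bar>C\<bar>"
    proof (rule add_mono)
      show "L2_norm M f \<le> 1" using norm_le_p f by fastforce
      have "C * p f \<le> \<bar>C\<bar> * 1" using f p_nonneg by (intro mult_mono) auto
      then show "L2_norm M (A f) \<le> \<bar>C\<bar>" using C[OF f(1)] by simp
    qed
    finally show ?thesis by simp
  qed
  then show ?thesis by (intro bdd_aboveI2) auto
qed

lemma operator_norm_nonneg:
  assumes "bounded_linear_op X p (L2_space M) (L2_norm M) A"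
  shows "0 \<le> operator_norm X p (L2_norm M) (\<lambda>f y. f y - A f y)"
  unfolding operator_norm_def
  by (rule cSUP_upper2[OF embedding_diff_bdd[OF assms], of "\<lambda>x. 0"])
     (auto simp: X_zero p_zero L2_norm_nonneg)

text \<open>\<open>rank_less\<close> asks for spanning functions inside the range, where the
  \<open>u i\<close> need not lie. A maximal independent subset of the range spans it, and by
  elimination it has at most \<open>card I\<close> elements.\<close>

lemma rank_less_finite_combination:
  fixes \<gamma> :: "'i \<Rightarrow> ('a \<Rightarrow> complex) \<Rightarrow> complex" and u :: "'i \<Rightarrow> 'b \<Rightarrow> complex"
  assumes I: "finite I" "card I < n" and q0: "q (\<lambda>x. 0) = 0"
  shows "rank_less X q (\<lambda>f x. \<Sum>i\<in>I. \<gamma> i f * u i x) n"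
proof -
  define A where "A f x = (\<Sum>i\<in>I. \<gamma> i f * u i x)" for f x
  define ind where "ind S \<longleftrightarrow> S \<subseteq> A ` X \<and> finite S \<and> (\<forall>c. (\<forall>x. (\<Sum>g\<in>S. c g * g x) = 0) \<longrightarrow> (\<forall>g\<in>S. c g = 0))" for S
  have card_le: "card S \<le> card I" if S: "ind S" for S
  proof (rule ccontr)
    assume "\<not> ?thesis"
    then have lt: "card I < card S" by simp
    have "\<forall>g\<in>S. \<exists>f. g = A f" using S by (auto simp: ind_def)
    then obtain F where F: "\<And>g. g \<in> S \<Longrightarrow> g = A (F g)" by metis
    obtain c where c: "\<exists>g\<in>S. c g \<noteq> 0" "\<And>i. i \<in> I \<Longrightarrow> (\<Sum>g\<in>S. c g * \<gamma> i (F g)) = 0"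
      using underdetermined_system[OF I(1) _ lt, of "\<lambda>g i. \<gamma> i (F g)"] S by (auto simp: ind_def)
    have "(\<Sum>g\<in>S. c g * g x) = 0" for x
    proof -
      have "(\<Sum>g\<in>S. c g * g x) = (\<Sum>g\<in>S. c g * A (F g) x)" by (intro sum.cong refl) (metis F)
      also have "\<dots> = (\<Sum>g\<in>S. \<Sum>i\<in>I. c g * \<gamma> i (F g) * u i x)"
        by (simp add: A_def sum_distrib_left mult.assoc)
      also have "\<dots> = (\<Sum>i\<in>I. (\<Sum>g\<in>S. c g * \<gamma> i (F g)) * u i x)"
        by (subst sum.swap) (simp add: sum_distrib_right)
      finally show ?thesis using c(2) by simp
    qed
    then show False using S c(1) by (auto simp: ind_def)
  qed
  have "ind {}" by (simp add: ind_def)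
  \<comment> \<open>A maximal cardinality exists because \<open>card_le\<close> bounds all of
    them.\<close>
  then obtain S where S: "ind S" and max: "\<And>T. ind T \<Longrightarrow> card T \<le> card S"
    using ex_has_greatest_nat[of ind "{}" card "card I + 1"] card_le by (metis less_Suc_eq_le Suc_eq_plus1)
  have span: "\<exists>c. \<forall>x. A f x = (\<Sum>g\<in>S. c g * g x)" if f: "f \<in> X" for f
  proof (cases "A f \<in> S")
    case True
    have "(\<Sum>g\<in>S. (if g = A f then 1 else 0) * g x) = A f x" for x
    proof -
      have "(\<Sum>g\<in>S. (if g = A f then 1 else 0) * g x) = (\<Sum>g\<in>S. if g = A f then A f x else 0)"
        by (intro sum.cong) auto
      then show ?thesis using True S by (simp add: ind_def)
    qed
    then show ?thesis by (intro exI[of _ "\<lambda>g. if g = A f then 1 else 0"]) simp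
  next
    case False
    have "\<not> ind (insert (A f) S)" using max[of "insert (A f) S"] False S by (auto simp: ind_def)
    then obtain c where c: "\<And>x. (\<Sum>g\<in>insert (A f) S. c g * g x) = 0" "\<exists>g\<in>insert (A f) S. c g \<noteq> 0"
      using S f unfolding ind_def by auto
    have c': "c (A f) * A f x + (\<Sum>g\<in>S. c g * g x) = 0" for x
      using c(1)[of x] False S by (simp add: ind_def)
    have nz: "c (A f) \<noteq> 0"
    proof
      assume 0: "c (A f) = 0"
      then have "\<forall>x. (\<Sum>g\<in>S. c g * g x) = 0" using c' by simp
      then have "\<forall>g\<in>S. c g = 0" using S by (simp add: ind_def)
      then show False using c(2) 0 by auto
    qed
    have "A f x = (\<Sum>g\<in>S. (- c g / c (A f)) * g x)" for x
    proof -
      have "A f x = - (\<Sum>g\<in>S. c g * g x) / c (A f)"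
        using c'[of x] nz by (simp add: field_simps eq_neg_iff_add_eq_0)
      then show ?thesis by (simp add: sum_divide_distrib sum_negf)
    qed
    then show ?thesis by (intro exI[of _ "\<lambda>g. - c g / c (A f)"]) blast
  qed
  show ?thesis unfolding rank_less_def A_def[symmetric]
  proof (intro exI[of _ S] conjI ballI)
    show "S \<subseteq> (\<lambda>f x. A f x) ` X" "finite S" using S by (auto simp: ind_def)
    show "card S < n" using card_le[OF S] I by simp
    fix f assume "f \<in> X"
    then obtain c where "\<forall>x. A f x = (\<Sum>g\<in>S. c g * g x)" using span by blast
    then show "\<exists>c. q (\<lambda>y. A f y - (\<Sum>g\<in>S. c g * g y)) = 0" using q0 by (intro exI[of _ c]) simp
  qed
qed

text \<open>The finite combination of functionals is itself the competitor in the infimum; its shape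
  gives linearity, boundedness and the rank.\<close>

lemma approx_number_le:
  fixes \<gamma> :: "'i \<Rightarrow> ('a \<Rightarrow> complex) \<Rightarrow> complex"
  assumes I: "finite I" "card I < n"
    and lin: "\<And>i c f g. i \<in> I \<Longrightarrow> f \<in> X \<Longrightarrow> g \<in> X \<Longrightarrow> \<gamma> i (\<lambda>x. c * f x + g x) = c * \<gamma> i f + \<gamma> i g"
    and bd: "\<And>i f. i \<in> I \<Longrightarrow> f \<in> X \<Longrightarrow> norm (\<gamma> i f) \<le> C * p f"
    and u: "\<And>i. i \<in> I \<Longrightarrow> u i \<in> L2_space M"
    and err: "\<And>f. f \<in> X \<Longrightarrow> p f \<le> 1 \<Longrightarrow> L2_norm M (\<lambda>x. f x - (\<Sum>i\<in>I. \<gamma> i f * u i x)) \<le> c"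
  shows "approx_number X p (L2_space M) (L2_norm M) (\<lambda>f. f) n \<le> c"
proof -
  define A where "A f x = (\<Sum>i\<in>I. \<gamma> i f * u i x)" for f x
  have \<gamma>0: "\<gamma> i (\<lambda>x. 0) = 0" if "i \<in> I" for i
    using lin[OF that X_zero X_zero, of 1] by simp
  have \<gamma>_add: "\<gamma> i (\<lambda>x. f x + g x) = \<gamma> i f + \<gamma> i g" if "i \<in> I" "f \<in> X" "g \<in> X" for i f g
    using lin[OF that, of 1] by simp
  have \<gamma>_scale: "\<gamma> i (\<lambda>x. k * f x) = k * \<gamma> i f" if "i \<in> I" "f \<in> X" for i f k
    using lin[OF that X_zero, of k] \<gamma>0[OF that(1)] by simp
  have A_L2: "A f \<in> L2_space M" for f
    unfolding A_def[abs_def] using u by (intro L2_space_sum L2_space_scale)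
  have A_bd: "L2_norm M (A f) \<le> (\<Sum>i\<in>I. C * L2_norm M (u i)) * p f" if f: "f \<in> X" for f
  proof -
    have "L2_norm M (\<lambda>x. \<Sum>i\<in>J. \<gamma> i f * u i x) \<le> (\<Sum>i\<in>J. C * p f * L2_norm M (u i))" if "J \<subseteq> I" for J
      using finite_subset[OF that I(1)] that
    proof (induction J rule: finite_induct)
      case (insert j J)
      have "L2_norm M (\<lambda>x. \<gamma> j f * u j x + (\<Sum>i\<in>J. \<gamma> i f * u i x)) \<le>
        L2_norm M (\<lambda>x. \<gamma> j f * u j x) + L2_norm M (\<lambda>x. \<Sum>i\<in>J. \<gamma> i f * u i x)"
        using insert.prems u by (intro L2_norm_triangle L2_space_sum L2_space_scale) auto
      also have "\<dots> \<le> C * p f * L2_norm M (u j) + (\<Sum>i\<in>J. C * p f * L2_norm M (u i))"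
        unfolding L2_norm_scale using insert.prems f
        by (intro add_mono mult_right_mono bd insert.IH L2_norm_nonneg) auto
      finally show ?case using insert.hyps by simp
    qed (simp add: L2_norm_zero)
    from this[OF order_refl] show ?thesis unfolding A_def[abs_def] by (simp add: sum_distrib_left sum_distrib_right mult_ac)
  qed
  have op: "bounded_linear_op X p (L2_space M) (L2_norm M) A"
    unfolding bounded_linear_op_def
  proof (intro conjI ballI allI exI)
    fix f g assume "f \<in> X" "g \<in> X"
    then have "A (\<lambda>x. f x + g x) y - (A f y + A g y) = 0" for y
      by (simp add: A_def \<gamma>_add sum.distrib ring_distribs)
    then show "L2_norm M (\<lambda>y. A (\<lambda>x. f x + g x) y - (A f y + A g y)) = 0" by (simp add: L2_norm_zero)
  next
    fix k f assume "f \<in> X"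
    then have "A (\<lambda>x. k * f x) y - k * A f y = 0" for y
      by (simp add: A_def \<gamma>_scale sum_distrib_left mult.assoc)
    then show "L2_norm M (\<lambda>y. A (\<lambda>x. k * f x) y - k * A f y) = 0" by (simp add: L2_norm_zero)
  qed (use A_L2 A_bd in auto)
  have rk: "rank_less X (L2_norm M) A n"
    unfolding A_def[abs_def] by (rule rank_less_finite_combination[where q = "L2_norm M", OF I L2_norm_zero])
  have "operator_norm X p (L2_norm M) (\<lambda>f y. f y - A f y) \<le> c"
    unfolding operator_norm_def
  proof (rule cSUP_least)
    show "{f \<in> X. p f \<le> 1} \<noteq> {}" using X_zero p_zero by force
  qed (use err in \<open>auto simp: A_def\<close>)
  moreover have "approx_number X p (L2_space M) (L2_norm M) (\<lambda>f. f) n \<le>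
      operator_norm X p (L2_norm M) (\<lambda>f y. f y - A f y)"
    unfolding approx_number_def
  proof (rule cInf_lower)
    show "bdd_below {operator_norm X p (L2_norm M) (\<lambda>f y. f y - A f y) |A.
       bounded_linear_op X p (L2_space M) (L2_norm M) A \<and> rank_less X (L2_norm M) A n}"
      using operator_norm_nonneg by (intro bdd_belowI[of _ 0]) blast
  qed (use op rk in blast)
  ultimately show ?thesis by linarith
qed

text \<open>A Bernstein type argument: an operator of rank below \<open>card K\<close> annihilates,
  up to a null function, some nonzero f in the span of the \<open>e k\<close>. On that f the error
  is the whole L2 norm, which is at least \<open>p f / L\<close>.\<close>

lemma approx_number_ge:
  fixes e :: "'k \<Rightarrow> 'a \<Rightarrow> complex"
  assumes n: "1 \<le> n" and K: "finite K" "n \<le> card K" and e: "\<And>k. k \<in> K \<Longrightarrow> e k \<in> X"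
    and ind: "\<And>c. L2_norm M (\<lambda>x. \<Sum>k\<in>K. c k * e k x) = 0 \<Longrightarrow> \<forall>k\<in>K. c k = 0"
    and inv: "\<And>c. p (\<lambda>x. \<Sum>k\<in>K. c k * e k x) \<le> L * L2_norm M (\<lambda>x. \<Sum>k\<in>K. c k * e k x)" and L: "L > 0"
  shows "1 / L \<le> approx_number X p (L2_space M) (L2_norm M) (\<lambda>f. f) n"
  unfolding approx_number_def
proof (rule cInf_greatest)
  \<comment> \<open>The zero operator, of rank 0 < n, shows that the infimum runs over a nonempty
    set.\<close>
  have "bounded_linear_op X p (L2_space M) (L2_norm M) (\<lambda>f x. 0)"
    unfolding bounded_linear_op_def by (auto simp: L2_norm_zero L2_space_zero p_nonneg intro!: exI[of _ 0])
  moreover have "rank_less X (L2_norm M) (\<lambda>f x. 0) n"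
    using rank_less_finite_combination[of "{}" n "L2_norm M"] n by (simp add: L2_norm_zero)
  ultimately show "{operator_norm X p (L2_norm M) (\<lambda>f y. f y - A f y) |A.
       bounded_linear_op X p (L2_space M) (L2_norm M) A \<and> rank_less X (L2_norm M) A n} \<noteq> {}" by blast
next
  fix r assume "r \<in> {operator_norm X p (L2_norm M) (\<lambda>f y. f y - A f y) |A.
       bounded_linear_op X p (L2_space M) (L2_norm M) A \<and> rank_less X (L2_norm M) A n}"
  then obtain A where r: "r = operator_norm X p (L2_norm M) (\<lambda>f y. f y - A f y)"
    and A: "bounded_linear_op X p (L2_space M) (L2_norm M) A" and rk: "rank_less X (L2_norm M) A n" by blast
  have A_L2: "\<And>f. f \<in> X \<Longrightarrow> A f \<in> L2_space M"
    and A_add0: "\<And>f g. f \<in> X \<Longrightarrow> g \<in> X \<Longrightarrow> L2_norm M (\<lambda>y. A (\<lambda>x. f x + g x) y - (A f y + A g y)) = 0"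
    and A_scale0: "\<And>k f. f \<in> X \<Longrightarrow> L2_norm M (\<lambda>y. A (\<lambda>x. k * f x) y - k * A f y) = 0"
    using A unfolding bounded_linear_op_def by blast+
  \<comment> \<open>Linearity of \<open>A\<close> holds only up to null vectors, so its consequences
    are carried as almost everywhere statements.\<close>
  have A_add: "AE x in M. A (\<lambda>x. f x + g x) x = A f x + A g x" if "f \<in> X" "g \<in> X" for f g
  proof -
    have "(\<lambda>y. A (\<lambda>x. f x + g x) y - (A f y + A g y)) \<in> L2_space M"
      using that by (intro L2_space_diff L2_space_add A_L2 X_add)
    from L2_norm_eq_0_AE[OF this A_add0[OF that]] show ?thesis by eventually_elim simp
  qed
  have A_scale: "AE x in M. A (\<lambda>x. k * f x) x = k * A f x" if "f \<in> X" for k f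
  proof -
    have "(\<lambda>y. A (\<lambda>x. k * f x) y - k * A f y) \<in> L2_space M"
      using that by (intro L2_space_diff L2_space_scale A_L2 X_scale)
    from L2_norm_eq_0_AE[OF this A_scale0[OF that]] show ?thesis by eventually_elim simp
  qed
  obtain B where B: "B \<subseteq> A ` X" "finite B" "card B < n"
    and span: "\<And>f. f \<in> X \<Longrightarrow> \<exists>c. L2_norm M (\<lambda>y. A f y - (\<Sum>g\<in>B. c g * g y)) = 0"
    using rk unfolding rank_less_def by blast
  have "\<forall>k\<in>K. \<exists>m. L2_norm M (\<lambda>y. A (e k) y - (\<Sum>g\<in>B. m g * g y)) = 0" using span e by blast
  then obtain m where m: "\<And>k. k \<in> K \<Longrightarrow> L2_norm M (\<lambda>y. A (e k) y - (\<Sum>g\<in>B. m k g * g y)) = 0" by metis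
  have m_AE: "AE x in M. A (e k) x = (\<Sum>g\<in>B. m k g * g x)" if k: "k \<in> K" for k
  proof -
    have "g \<in> L2_space M" if "g \<in> B" for g using B(1) A_L2 that by blast
    then have "(\<lambda>y. A (e k) y - (\<Sum>g\<in>B. m k g * g y)) \<in> L2_space M"
      using k by (intro L2_space_diff L2_space_sum L2_space_scale A_L2 e)
    from L2_norm_eq_0_AE[OF this m[OF k]] show ?thesis by eventually_elim simp
  qed
  \<comment> \<open>As \<open>card B < n \<le> card K\<close>, some nontrivial combination of the
    \<open>e k\<close> has an image all of whose coefficients over \<open>B\<close> vanish.\<close>
  obtain c where c: "\<exists>k\<in>K. c k \<noteq> 0" "\<And>g. g \<in> B \<Longrightarrow> (\<Sum>k\<in>K. c k * m k g) = 0"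
    using underdetermined_system[OF B(2) K(1), of m] B(3) K(2) by auto
  have A_sum: "AE x in M. A (\<lambda>x. \<Sum>k\<in>J. c k * e k x) x = (\<Sum>k\<in>J. c k * A (e k) x)" if "J \<subseteq> K" for J
    using finite_subset[OF that K(1)] that
  proof (induction J rule: finite_induct)
    case empty
    show ?case using A_scale[OF X_zero, of 0] by simp
  next
    case (insert j J)
    have "AE x in M. A (\<lambda>x. c j * e j x + (\<Sum>k\<in>J. c k * e k x)) x = A (\<lambda>x. c j * e j x) x + A (\<lambda>x. \<Sum>k\<in>J. c k * e k x) x"
      using insert.prems e by (intro A_add X_scale X_sum) auto
    moreover have "AE x in M. A (\<lambda>x. c j * e j x) x = c j * A (e j) x"
      using insert.prems e by (intro A_scale) auto
    moreover have "AE x in M. A (\<lambda>x. \<Sum>k\<in>J. c k * e k x) x = (\<Sum>k\<in>J. c k * A (e k) x)"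
      using insert by auto
    ultimately show ?case by eventually_elim (simp add: insert.hyps)
  qed
  define f where "f x = (\<Sum>k\<in>K. c k * e k x)" for x
  have fX: "f \<in> X" unfolding f_def[abs_def] using e by (rule X_sum)
  have "AE x in M. \<forall>k\<in>K. A (e k) x = (\<Sum>g\<in>B. m k g * g x)"
    using K(1) m_AE by (intro AE_finite_allI) auto
  then have Af: "AE x in M. A f x = 0"
    using A_sum[OF order_refl]
  proof eventually_elim
    case (elim x)
    have "A f x = (\<Sum>k\<in>K. \<Sum>g\<in>B. c k * m k g * g x)"
      using elim by (simp add: f_def[abs_def] sum_distrib_left mult.assoc)
    also have "\<dots> = (\<Sum>g\<in>B. (\<Sum>k\<in>K. c k * m k g) * g x)"
      by (subst sum.swap) (simp add: sum_distrib_right)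
    finally show ?case using c(2) by simp
  qed
  have f_pos: "L2_norm M f > 0"
  proof -
    have "L2_norm M f \<noteq> 0" using ind[of c] c(1) unfolding f_def[abs_def] by blast
    then show ?thesis using L2_norm_nonneg[of M f] by simp
  qed
  then have p_pos: "p f > 0" using norm_le_p[OF fX] by simp
  define f' where "f' x = complex_of_real (1 / p f) * f x" for x
  have f'X: "f' \<in> X" unfolding f'_def[abs_def] using fX by (rule X_scale)
  have "p f' = norm (complex_of_real (1 / p f)) * p f" unfolding f'_def[abs_def] by (rule p_scale[OF fX])
  then have "p f' = 1" using p_pos unfolding norm_of_real by simp
  have "AE x in M. A f' x = of_real (1 / p f) * A f x"
    unfolding f'_def[abs_def] by (rule A_scale[OF fX])
  then have Af': "AE x in M. A f' x = 0" using Af by eventually_elim simp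
  have "1 / L \<le> L2_norm M f / p f"
    using inv[of c] L p_pos unfolding f_def[abs_def, symmetric] by (simp add: field_simps)
  also have "\<dots> = L2_norm M f'"
    unfolding f'_def[abs_def] L2_norm_scale norm_of_real using p_pos by simp
  also have "\<dots> = L2_norm M (\<lambda>y. f' y - A f' y)"
  proof -
    have "(LINT x|M. (norm (f' x))\<^sup>2) = (LINT x|M. (norm (f' x - A f' x))\<^sup>2)"
      using Af' f'X A_L2[OF f'X] X_L2
      by (intro integral_cong_AE) (auto elim!: eventually_mono simp: L2_space_def)
    then show ?thesis by (simp add: L2_norm_altdef)
  qed
  also have "\<dots> \<le> r"
    unfolding r operator_norm_def using f'X \<open>p f' = 1\<close>
    by (intro cSUP_upper embedding_diff_bdd A) auto
  finally show "1 / L \<le> r" .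
qed

end

section \<open>Expansion of Fourier coefficients into main and boundary terms\<close>

section \<open>Truncated expansions\<close>

text \<open>In the expansion a map \<open>t\<close> records how each coordinate is treated: \<open>t i \<le> s\<close> is the boundary term
  with \<open>t i\<close> derivatives and frequency zero, \<open>t i = s + 1\<close> the main term with \<open>s\<close> derivatives and frequency
  \<open>k i\<close>, and \<open>t i = s + 2\<close> a coordinate that has not been expanded yet.\<close>

definition expansion_coeff :: "real \<Rightarrow> real \<Rightarrow> nat \<Rightarrow> nat \<Rightarrow> int \<Rightarrow> complex" where
  "expansion_coeff a b s v k =
     (if v = 0 then (if k = 0 then 1 else 0)
      else if k = 0 then 0
      else if v \<le> s then - (1 / wave a b k ^ v)
      else 1 / wave a b k ^ s)"

definition deriv_index :: "nat \<Rightarrow> ('n \<Rightarrow> nat) \<Rightarrow> 'n \<Rightarrow> nat" where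
  "deriv_index s t i = (if t i \<le> s then t i else if t i = Suc s then s else 0)"

definition freq_part :: "nat \<Rightarrow> ('n \<Rightarrow> nat) \<Rightarrow> ('n \<Rightarrow> int) \<Rightarrow> 'n \<Rightarrow> int" where
  "freq_part s t k i = (if t i \<le> s then 0 else k i)"

text \<open>\<open>freq_part\<close> is the frequency of the functional applied to f, whereas
  \<open>rest_part\<close> holds the frequencies of the boundary coordinates, which enter numerical
  coefficients only.\<close>

definition rest_part :: "nat \<Rightarrow> ('n \<Rightarrow> nat) \<Rightarrow> ('n \<Rightarrow> int) \<Rightarrow> 'n \<Rightarrow> int" where
  "rest_part s t k i = (if t i \<le> s then k i else 0)"

lemma deriv_index_multi: "deriv_index s t \<in> multi_indices s"
  by (simp add: deriv_index_def multi_indices_def)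

text \<open>\<open>mix_coeff_step\<close> is solved for the lower derivative and iterated s times.
  At \<open>k i = 0\<close> no division is possible, but there the coefficient already is a
  functional at frequency zero and takes the slot v = 0, which is empty for all other
  frequencies.\<close>

lemma mix_coeff_expand_coordinate:
  assumes ab: "a < b" and f: "f \<in> H_mix a b s" and \<alpha>: "\<alpha> \<in> multi_indices s" "\<alpha> i = 0"
  shows "mix_coeff a b \<alpha> f k =
    (\<Sum>v\<le>s. expansion_coeff a b s v (k i) * mix_coeff a b (\<alpha>(i := v)) f (k(i := 0)))
    + expansion_coeff a b s (Suc s) (k i) * mix_coeff a b (\<alpha>(i := s)) f k"
proof (cases "k i = 0")
  case True
  have "(\<Sum>v\<le>s. expansion_coeff a b s v (k i) * mix_coeff a b (\<alpha>(i := v)) f (k(i := 0))) =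
     (\<Sum>v\<le>s. if v = 0 then mix_coeff a b \<alpha> f k else 0)"
  proof (intro sum.cong refl)
    fix v
    have "\<alpha>(i := 0) = \<alpha>" "k(i := 0) = k" using \<alpha> True by auto
    then show "expansion_coeff a b s v (k i) * mix_coeff a b (\<alpha>(i := v)) f (k(i := 0)) = (if v = 0 then mix_coeff a b \<alpha> f k else 0)"
      using True by (auto simp: expansion_coeff_def)
  qed
  then show ?thesis using True by (simp add: expansion_coeff_def)
next
  case False
  define w where "w = wave a b (k i)"
  have w: "w \<noteq> 0" using False ab by (simp add: w_def wave_def)
  have "mix_coeff a b \<alpha> f k = mix_coeff a b (\<alpha>(i := l)) f k / w ^ l
      + (\<Sum>v=1..l. - (1 / w ^ v) * mix_coeff a b (\<alpha>(i := v)) f (k(i := 0)))" if "l \<le> s" for l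
    using that
  proof (induction l)
    case 0
    have "\<alpha>(i := 0) = \<alpha>" using \<alpha> by auto
    then show ?case by simp
  next
    case (Suc l)
    have m: "\<alpha>(i := l) \<in> multi_indices s" "(\<alpha>(i := l))(i := Suc ((\<alpha>(i := l)) i)) \<in> multi_indices s"
      using \<alpha> Suc.prems by (auto simp: multi_indices_def)
    have "mix_coeff a b (\<alpha>(i := Suc l)) f k - mix_coeff a b (\<alpha>(i := Suc l)) f (k(i := 0)) = w * mix_coeff a b (\<alpha>(i := l)) f k"
      using mix_coeff_step[OF ab f m, of k] by (simp add: w_def)
    then have eq: "mix_coeff a b (\<alpha>(i := l)) f k = (mix_coeff a b (\<alpha>(i := Suc l)) f k - mix_coeff a b (\<alpha>(i := Suc l)) f (k(i := 0))) / w"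
      using w by (simp add: field_simps)
    have IH: "mix_coeff a b \<alpha> f k = mix_coeff a b (\<alpha>(i := l)) f k / w ^ l
      + (\<Sum>v=1..l. - (1 / w ^ v) * mix_coeff a b (\<alpha>(i := v)) f (k(i := 0)))"
      by (rule Suc.IH) (use Suc.prems in simp)
    have split: "(\<Sum>v=1..Suc l. - (1 / w ^ v) * mix_coeff a b (\<alpha>(i := v)) f (k(i := 0))) =
      (\<Sum>v=1..l. - (1 / w ^ v) * mix_coeff a b (\<alpha>(i := v)) f (k(i := 0)))
      + - (1 / w ^ Suc l) * mix_coeff a b (\<alpha>(i := Suc l)) f (k(i := 0))"
      by (rule sum.cl_ivl_Suc[THEN trans]) simp
    have div: "(y - z) / w / w ^ l + S = y / w ^ Suc l + (S + - (1 / w ^ Suc l) * z)" for y z S :: complex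
      by (simp add: diff_divide_distrib)
    show ?case unfolding IH split eq by (rule div)
  qed
  from this[OF order_refl] have 1: "mix_coeff a b \<alpha> f k = mix_coeff a b (\<alpha>(i := s)) f k / w ^ s
      + (\<Sum>v=1..s. - (1 / w ^ v) * mix_coeff a b (\<alpha>(i := v)) f (k(i := 0)))" .
  have "{..s} = insert 0 {1..s}" by auto
  then have "(\<Sum>v\<le>s. expansion_coeff a b s v (k i) * mix_coeff a b (\<alpha>(i := v)) f (k(i := 0))) =
     (\<Sum>v=1..s. expansion_coeff a b s v (k i) * mix_coeff a b (\<alpha>(i := v)) f (k(i := 0)))"
    using False by (simp add: expansion_coeff_def)
  also have "\<dots> = (\<Sum>v=1..s. - (1 / w ^ v) * mix_coeff a b (\<alpha>(i := v)) f (k(i := 0)))"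
    using False by (intro sum.cong) (auto simp: expansion_coeff_def w_def)
  finally show ?thesis using 1 False by (simp add: expansion_coeff_def w_def)
qed

text \<open>\<open>J\<close> holds the coordinates already expanded, so that it can grow from the
  empty set to all coordinates by induction.\<close>

definition type_maps :: "nat \<Rightarrow> 'n set \<Rightarrow> ('n \<Rightarrow> nat) set" where
  "type_maps s J = {t. (\<forall>i\<in>J. t i \<le> Suc s) \<and> (\<forall>i. i \<notin> J \<longrightarrow> t i = Suc (Suc s))}"

text \<open>Expanding coordinate \<open>j\<close> replaces its marker s + 2 by one of the values up
  to s + 1.\<close>

lemma sum_type_maps_insert:
  assumes "j \<notin> J"
  shows "(\<Sum>t\<in>type_maps s (insert j J). g t) = (\<Sum>t\<in>type_maps s J. \<Sum>v\<le>Suc s. g (t(j := v)))"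
proof -
  have "bij_betw (\<lambda>(t, v). t(j := v)) (type_maps s J \<times> {..Suc s}) (type_maps s (insert j J))"
  proof (rule bij_betwI[where g = "\<lambda>t. (t(j := Suc (Suc s)), t j)"])
    show "(\<lambda>(t, v). t(j := v)) \<in> type_maps s J \<times> {..Suc s} \<rightarrow> type_maps s (insert j J)"
      using assms by (auto simp: type_maps_def)
    show "(\<lambda>t. (t(j := Suc (Suc s)), t j)) \<in> type_maps s (insert j J) \<rightarrow> type_maps s J \<times> {..Suc s}"
      using assms by (auto simp: type_maps_def)
    show "\<And>x. x \<in> type_maps s J \<times> {..Suc s} \<Longrightarrow>
         ((case x of (t, v) \<Rightarrow> t(j := v))(j := Suc (Suc s)), (case x of (t, v) \<Rightarrow> t(j := v)) j) = x"
      using assms by (auto simp: type_maps_def fun_eq_iff)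
  qed auto
  from sum.reindex_bij_betw[OF this, of g] show ?thesis
    unfolding sum.cartesian_product by (simp only: case_prod_unfold)
qed

lemma finite_type_maps:
  fixes J :: "'n set"
  shows "finite J \<Longrightarrow> finite (type_maps s J)"
proof (induction J rule: finite_induct)
  case empty
  have "type_maps s ({} :: 'n set) = {\<lambda>_. Suc (Suc s)}" by (auto simp: type_maps_def)
  then show ?case by simp
next
  case (insert j J)
  have "type_maps s (insert j J) \<subseteq> (\<lambda>(t, v). t(j := v)) ` (type_maps s J \<times> {..Suc s})"
  proof
    fix t assume t: "t \<in> type_maps s (insert j J)"
    have "t(j := Suc (Suc s)) \<in> type_maps s J" "t j \<in> {..Suc s}" using t insert.hyps by (auto simp: type_maps_def)
    moreover have "t = (\<lambda>(t, v). t(j := v)) (t(j := Suc (Suc s)), t j)" by simp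
    ultimately show "t \<in> (\<lambda>(t, v). t(j := v)) ` (type_maps s J \<times> {..Suc s})" by blast
  qed
  then show ?case using insert.IH finite_subset by (metis finite_SigmaI finite_atMost finite_imageI)
qed

text \<open>The one-coordinate expansion is applied along each axis in turn; a step alters a single
  coordinate of the index and of the frequency, so the coefficients multiply.\<close>

lemma fourier_expand:
  fixes f :: "real^'n::finite \<Rightarrow> complex"
  assumes ab: "a < b" and f: "f \<in> H_mix a b s"
  shows "fourier a b f k = (\<Sum>t\<in>type_maps s UNIV. (\<Prod>i\<in>UNIV. expansion_coeff a b s (t i) (k i)) *
     mix_coeff a b (deriv_index s t) f (freq_part s t k))"
proof -
  have "finite J \<Longrightarrow> fourier a b f k = (\<Sum>t\<in>type_maps s J. (\<Prod>i\<in>J. expansion_coeff a b s (t i) (k i)) *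
     mix_coeff a b (deriv_index s t) f (freq_part s t k))" for J
  proof (induction J rule: finite_induct)
    case empty
    have "type_maps s ({} :: 'n set) = {\<lambda>_. Suc (Suc s)}" by (auto simp: type_maps_def)
    moreover have "deriv_index s (\<lambda>_. Suc (Suc s)) = (\<lambda>_::'n. 0)" "freq_part s (\<lambda>_. Suc (Suc s)) k = k"
      by (auto simp: deriv_index_def freq_part_def)
    ultimately show ?case by (simp add: mix_coeff_zero_index[OF ab H_mix_L2[OF f]])
  next
    case (insert j J)
    have "mix_coeff a b (deriv_index s t) f (freq_part s t k) =
       (\<Sum>v\<le>Suc s. expansion_coeff a b s v (k j) * mix_coeff a b (deriv_index s (t(j := v))) f (freq_part s (t(j := v)) k))"
      if t: "t \<in> type_maps s J" for t
    proof -
      have tj: "t j = Suc (Suc s)" using t insert.hyps by (simp add: type_maps_def)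
      have d0: "deriv_index s t j = 0" and kj: "freq_part s t k j = k j" using tj by (simp_all add: deriv_index_def freq_part_def)
      have 1: "(deriv_index s t)(j := v) = deriv_index s (t(j := v))" "(freq_part s t k)(j := 0) = freq_part s (t(j := v)) k"
        if "v \<le> s" for v using that by (auto simp: deriv_index_def freq_part_def)
      have 2: "(deriv_index s t)(j := s) = deriv_index s (t(j := Suc s))" "freq_part s t k = freq_part s (t(j := Suc s)) k"
        using tj by (auto simp: deriv_index_def freq_part_def)
      have "mix_coeff a b (deriv_index s t) f (freq_part s t k) =
        (\<Sum>v\<le>s. expansion_coeff a b s v (k j) * mix_coeff a b ((deriv_index s t)(j := v)) f ((freq_part s t k)(j := 0)))
        + expansion_coeff a b s (Suc s) (k j) * mix_coeff a b ((deriv_index s t)(j := s)) f (freq_part s t k)"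
        using mix_coeff_expand_coordinate[OF ab f deriv_index_multi d0, of "freq_part s t k"] unfolding kj .
      also have "(\<Sum>v\<le>s. expansion_coeff a b s v (k j) * mix_coeff a b ((deriv_index s t)(j := v)) f ((freq_part s t k)(j := 0))) =
         (\<Sum>v\<le>s. expansion_coeff a b s v (k j) * mix_coeff a b (deriv_index s (t(j := v))) f (freq_part s (t(j := v)) k))"
        by (intro sum.cong refl) (metis 1 atMost_iff)
      finally show ?thesis unfolding sum.atMost_Suc using 2 by simp
    qed
    then have "fourier a b f k = (\<Sum>t\<in>type_maps s J. \<Sum>v\<le>Suc s. (\<Prod>i\<in>J. expansion_coeff a b s (t i) (k i)) *
       (expansion_coeff a b s v (k j) * mix_coeff a b (deriv_index s (t(j := v))) f (freq_part s (t(j := v)) k)))"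
      unfolding insert.IH by (intro sum.cong refl) (simp only: sum_distrib_left)
    also have "\<dots> = (\<Sum>t\<in>type_maps s J. \<Sum>v\<le>Suc s. (\<Prod>i\<in>insert j J. expansion_coeff a b s ((t(j := v)) i) (k i)) *
       mix_coeff a b (deriv_index s (t(j := v))) f (freq_part s (t(j := v)) k))"
    proof (intro sum.cong refl)
      fix t v
      have "(\<Prod>i\<in>J. expansion_coeff a b s ((t(j := v)) i) (k i)) = (\<Prod>i\<in>J. expansion_coeff a b s (t i) (k i))"
        using insert.hyps by (intro prod.cong) auto
      then show "(\<Prod>i\<in>J. expansion_coeff a b s (t i) (k i)) *
         (expansion_coeff a b s v (k j) * mix_coeff a b (deriv_index s (t(j := v))) f (freq_part s (t(j := v)) k)) =
         (\<Prod>i\<in>insert j J. expansion_coeff a b s ((t(j := v)) i) (k i)) *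
         mix_coeff a b (deriv_index s (t(j := v))) f (freq_part s (t(j := v)) k)"
        using insert.hyps by simp
    qed
    also have "\<dots> = (\<Sum>t\<in>type_maps s (insert j J). (\<Prod>i\<in>insert j J. expansion_coeff a b s (t i) (k i)) *
       mix_coeff a b (deriv_index s t) f (freq_part s t k))"
      by (rule sum_type_maps_insert[OF insert.hyps(2), symmetric])
    finally show ?case .
  qed
  then show ?thesis by simp
qed

section \<open>Decay of the main and boundary factors\<close>

definition main_axes :: "nat \<Rightarrow> ('n \<Rightarrow> nat) \<Rightarrow> 'n set" where
  "main_axes s t = {i. t i = Suc s}"

definition main_factor :: "real \<Rightarrow> real \<Rightarrow> nat \<Rightarrow> ('n::finite \<Rightarrow> nat) \<Rightarrow> ('n \<Rightarrow> int) \<Rightarrow> complex" where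
  "main_factor a b s t \<kappa> = (\<Prod>i\<in>main_axes s t. expansion_coeff a b s (Suc s) (\<kappa> i))"

definition rest_factor :: "real \<Rightarrow> real \<Rightarrow> nat \<Rightarrow> ('n::finite \<Rightarrow> nat) \<Rightarrow> ('n \<Rightarrow> int) \<Rightarrow> complex" where
  "rest_factor a b s t j = (\<Prod>i\<in>- main_axes s t. expansion_coeff a b s (t i) (j i))"

definition freqs :: "nat \<Rightarrow> ('n \<Rightarrow> nat) \<Rightarrow> ('n \<Rightarrow> int) set" where
  "freqs s t = {\<kappa>. \<forall>i. i \<notin> main_axes s t \<longrightarrow> \<kappa> i = 0}"

definition rests :: "nat \<Rightarrow> ('n \<Rightarrow> nat) \<Rightarrow> ('n \<Rightarrow> int) set" where
  "rests s t = {j. \<forall>i\<in>main_axes s t. j i = 0}"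

lemma type_maps_UNIV: "t \<in> type_maps s UNIV \<Longrightarrow> t i \<le> s \<or> i \<in> main_axes s t"
  using le_Suc_eq by (auto simp: type_maps_def main_axes_def)

lemma freq_rest_parts:
  assumes "t \<in> type_maps s UNIV"
  shows "freq_part s t k \<in> freqs s t" "rest_part s t k \<in> rests s t"
    "(\<lambda>i. freq_part s t k i + rest_part s t k i) = k"
  using type_maps_UNIV[OF assms]
  by (auto simp: freqs_def rests_def freq_part_def rest_part_def main_axes_def fun_eq_iff)

lemma freq_rest_unique:
  assumes t: "t \<in> type_maps s UNIV" and "\<kappa> \<in> freqs s t" "j \<in> rests s t"
  shows "freq_part s t (\<lambda>i. \<kappa> i + j i) = \<kappa>" "rest_part s t (\<lambda>i. \<kappa> i + j i) = j"
  using type_maps_UNIV[OF t] assms(2,3)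
  by (auto simp: freqs_def rests_def freq_part_def rest_part_def main_axes_def fun_eq_iff)

text \<open>Separation of variables: one factor depends on the frequency of the functional, the
  other on the rest, so the two can be truncated independently.\<close>

lemma expansion_prod_split:
  fixes t :: "'n::finite \<Rightarrow> nat"
  assumes t: "t \<in> type_maps s UNIV"
  shows "(\<Prod>i\<in>UNIV. expansion_coeff a b s (t i) (k i)) =
    main_factor a b s t (freq_part s t k) * rest_factor a b s t (rest_part s t k)"
proof -
  have "(\<Prod>i\<in>UNIV. expansion_coeff a b s (t i) (k i)) =
     (\<Prod>i\<in>main_axes s t. expansion_coeff a b s (t i) (k i)) * (\<Prod>i\<in>- main_axes s t. expansion_coeff a b s (t i) (k i))"
    by (subst prod.union_disjoint[symmetric]) (auto simp: Compl_partition)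
  also have "(\<Prod>i\<in>main_axes s t. expansion_coeff a b s (t i) (k i)) = main_factor a b s t (freq_part s t k)"
    unfolding main_factor_def by (intro prod.cong) (auto simp: main_axes_def freq_part_def)
  also have "(\<Prod>i\<in>- main_axes s t. expansion_coeff a b s (t i) (k i)) = rest_factor a b s t (rest_part s t k)"
    unfolding rest_factor_def using type_maps_UNIV[OF t] by (intro prod.cong) (auto simp: rest_part_def)
  finally show ?thesis .
qed

lemma norm_main_coeff:
  assumes "a < b" "k \<noteq> 0"
  shows "norm (expansion_coeff a b s (Suc s) k) = 1 / (2 * pi / (b - a) * real_of_int \<bar>k\<bar>) ^ s"
  using assms by (simp add: expansion_coeff_def norm_divide norm_power norm_wave del: of_int_abs)

text \<open>The uniform bound is for frequencies inside the cross, where only the rest is truncated.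
  A main coefficient is 0 at frequency zero and otherwise largest at |k| = 1.\<close>

lemma norm_main_factor_le:
  fixes t :: "'n::finite \<Rightarrow> nat"
  assumes ab: "a < b"
  shows "norm (main_factor a b s t \<kappa>) \<le> 1 / (2 * pi / (b - a)) ^ (s * card (main_axes s t))"
proof -
  define \<theta> where "\<theta> = 2 * pi / (b - a)"
  have \<theta>: "\<theta> > 0" using ab by (simp add: \<theta>_def)
  have "norm (expansion_coeff a b s (Suc s) k) \<le> 1 / \<theta> ^ s" for k
  proof (cases "k = 0")
    case False
    have "\<theta> * 1 \<le> \<theta> * real_of_int \<bar>k\<bar>" using \<theta> False by (intro mult_left_mono) auto
    then have "\<theta> ^ s \<le> (\<theta> * real_of_int \<bar>k\<bar>) ^ s" using \<theta> by (intro power_mono) auto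
    then show ?thesis
      unfolding norm_main_coeff[OF ab False] \<theta>_def[symmetric] using \<theta> by (intro divide_left_mono) (auto simp: False)
  qed (use \<theta> in \<open>simp add: expansion_coeff_def\<close>)
  then have "norm (main_factor a b s t \<kappa>) \<le> (\<Prod>i\<in>main_axes s t. 1 / \<theta> ^ s)"
    unfolding main_factor_def prod_norm[symmetric] by (intro prod_mono) auto
  then show ?thesis by (simp add: \<theta>_def power_divide power_mult)
qed

text \<open>The size depends only on the product of the moduli of the main frequencies, which is
  what makes the hyperbolic cross the right set. A zero frequency on a main axis kills the
  factor.\<close>

lemma norm_main_factor_outside:
  fixes t :: "'n::finite \<Rightarrow> nat"
  assumes ab: "a < b" and N: "N > 0" and \<kappa>: "\<kappa> \<in> freqs s t" "\<kappa> \<notin> hyp_cross (main_axes s t) N"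
  shows "norm (main_factor a b s t \<kappa>) \<le> 1 / ((2 * pi / (b - a)) ^ card (main_axes s t) * N) ^ s"
proof (cases "\<exists>i\<in>main_axes s t. \<kappa> i = 0")
  case True
  then have "main_factor a b s t \<kappa> = 0" unfolding main_factor_def
    by (auto intro!: prod_zero simp: expansion_coeff_def)
  then show ?thesis using ab N by simp
next
  case False
  define \<theta> where "\<theta> = 2 * pi / (b - a)"
  have \<theta>: "\<theta> > 0" using ab by (simp add: \<theta>_def)
  let ?P = "\<Prod>i\<in>main_axes s t. real_of_int \<bar>\<kappa> i\<bar>"
  have P: "N < ?P" using \<kappa> False by (auto simp: freqs_def hyp_cross_def)
  have "norm (main_factor a b s t \<kappa>) = (\<Prod>i\<in>main_axes s t. 1 / (\<theta> * real_of_int \<bar>\<kappa> i\<bar>) ^ s)"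
    unfolding main_factor_def prod_norm[symmetric] \<theta>_def
    using False by (intro prod.cong refl norm_main_coeff[OF ab]) auto
  also have "\<dots> = 1 / (\<theta> ^ card (main_axes s t) * ?P) ^ s"
    by (simp add: prod_dividef prod_power_distrib[symmetric] prod.distrib power_mult_distrib del: of_int_abs)
       (simp add: power_mult[symmetric] mult.commute)
  also have "\<dots> \<le> 1 / (\<theta> ^ card (main_axes s t) * N) ^ s"
    using P N \<theta> by (intro divide_left_mono power_mono mult_left_mono mult_pos_pos zero_less_power) auto
  finally show ?thesis by (simp add: \<theta>_def)
qed

text \<open>Telescoping 1/k^2 \<le> 1/(k - 1) - 1/k bounds each half by 2; the central term adds
  1.\<close>

lemma sum_inverse_squares_bound: "(\<Sum>k=-int m..int m. 1 / (real_of_int (max 1 \<bar>k\<bar>))\<^sup>2) \<le> 5"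
proof -
  have tail: "(\<Sum>k=1..m. 1 / (real k)\<^sup>2) \<le> 2 - 1 / real (max 1 m)" for m
  proof (induction m)
    case (Suc m)
    show ?case
    proof (cases "m = 0")
      case False
      have "1 / (real (Suc m))\<^sup>2 \<le> 1 / real m - 1 / real (Suc m)"
      proof -
        have "1 / (real (Suc m))\<^sup>2 \<le> 1 / (real m * real (Suc m))"
          using False by (intro divide_left_mono) (auto simp: power2_eq_square intro!: mult_right_mono)
        also have "\<dots> = 1 / real m - 1 / real (Suc m)" using False by (simp add: field_simps)
        finally show ?thesis .
      qed
      then show ?thesis using Suc False by simp
    qed simp
  qed simp
  have set: "{-int m..int m} = insert 0 (int ` {1..m} \<union> (\<lambda>k. - int k) ` {1..m})"
  proof (intro equalityI subsetI)
    fix k assume k: "k \<in> {-int m..int m}"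
    show "k \<in> insert 0 (int ` {1..m} \<union> (\<lambda>k. - int k) ` {1..m})"
    proof (cases "k = 0")
      case False
      then have "nat \<bar>k\<bar> \<in> {1..m}" using k by auto
      moreover have "k = int (nat \<bar>k\<bar>) \<or> k = - int (nat \<bar>k\<bar>)" by auto
      ultimately show ?thesis by blast
    qed simp
  qed auto
  have "(\<Sum>k=-int m..int m. 1 / (real_of_int (max 1 \<bar>k\<bar>))\<^sup>2) =
     1 + ((\<Sum>k\<in>int ` {1..m}. 1 / (real_of_int (max 1 \<bar>k\<bar>))\<^sup>2) + (\<Sum>k\<in>(\<lambda>k. - int k) ` {1..m}. 1 / (real_of_int (max 1 \<bar>k\<bar>))\<^sup>2))"
    unfolding set by (subst sum.insert) (auto intro!: sum.union_disjoint)
  also have "\<dots> = 1 + 2 * (\<Sum>k=1..m. 1 / (real k)\<^sup>2)"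
    by (subst (1 2) sum.reindex) (auto simp: inj_on_def intro!: sum.cong)
  also have "\<dots> \<le> 1 + 2 * (2 - 1 / real (max 1 m))" using tail[of m] by (intro add_left_mono mult_left_mono) auto
  also have "\<dots> \<le> 5" by simp
  finally show ?thesis .
qed

text \<open>A boundary coefficient with v \<ge> 1 derivatives is O(1/|k|), and v = 0 lives at k = 0
  only. Each coordinate is therefore square summable, and the sum over a box of frequencies
  factorises.\<close>

lemma rest_factor_sum_bounded:
  fixes t :: "'n::finite \<Rightarrow> nat"
  assumes ab: "a < b" and t: "t \<in> type_maps s UNIV"
  shows "\<exists>R\<ge>0. \<forall>Q. finite Q \<and> Q \<subseteq> rests s t \<longrightarrow> (\<Sum>j\<in>Q. (norm (rest_factor a b s t j))\<^sup>2) \<le> R"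
proof -
  define \<theta> where "\<theta> = 2 * pi / (b - a)"
  have \<theta>: "\<theta> > 0" using ab by (simp add: \<theta>_def)
  \<comment> \<open>The summand v = 0 equals 1, so \<open>C\<close> also covers the coefficient 1 at
    frequency zero.\<close>
  define C where "C = (\<Sum>v\<le>s. (1 / \<theta> ^ v)\<^sup>2)"
  have Cge: "(1 / \<theta> ^ v)\<^sup>2 \<le> C" if "v \<le> s" for v
    unfolding C_def using that by (intro member_le_sum) auto
  have C0: "C \<ge> 0" unfolding C_def by (intro sum_nonneg) auto
  define h where "h k = C * (1 / (real_of_int (max 1 \<bar>k\<bar>))\<^sup>2)" for k
  have h: "(norm (expansion_coeff a b s v k))\<^sup>2 \<le> h k" if v: "v \<le> s" for v k
  proof (cases "k = 0")
    case True
    then show ?thesis using Cge[of 0] by (auto simp: h_def expansion_coeff_def intro: order_trans[OF _ Cge[of 0]])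
  next
    case False
    show ?thesis
    proof (cases "v = 0")
      case True
      then show ?thesis using False C0 by (simp add: h_def expansion_coeff_def)
    next
      case v0: False
      have k1: "1 \<le> real_of_int \<bar>k\<bar>" using False by linarith
      have "norm (wave a b k) = \<theta> * real_of_int \<bar>k\<bar>" unfolding \<theta>_def by (rule norm_wave[OF ab])
      then have "norm (expansion_coeff a b s v k) = 1 / \<theta> ^ v * (1 / real_of_int \<bar>k\<bar> ^ v)"
        using v v0 False by (simp add: expansion_coeff_def norm_divide norm_power power_mult_distrib del: of_int_abs)
      also have "\<dots> \<le> 1 / \<theta> ^ v * (1 / real_of_int \<bar>k\<bar>)"
        using \<theta> k1 v0 self_le_power[OF k1, of v] by (intro mult_left_mono divide_left_mono) auto
      finally have "(norm (expansion_coeff a b s v k))\<^sup>2 \<le> (1 / \<theta> ^ v * (1 / real_of_int \<bar>k\<bar>))\<^sup>2"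
        by (intro power_mono) auto
      also have "\<dots> = (1 / \<theta> ^ v)\<^sup>2 * (1 / (real_of_int \<bar>k\<bar>)\<^sup>2)" by (simp add: power_mult_distrib power_divide)
      also have "\<dots> \<le> C * (1 / (real_of_int \<bar>k\<bar>)\<^sup>2)" using Cge[OF v] by (intro mult_right_mono) auto
      also have "\<dots> = h k" using False by (simp add: h_def max_def)
      finally show ?thesis .
    qed
  qed
  have h0: "0 \<le> h k" for k using C0 by (simp add: h_def)
  let ?S = "- main_axes s t"
  have "(\<Sum>j\<in>Q. (norm (rest_factor a b s t j))\<^sup>2) \<le> (C * 5) ^ card ?S" if Q: "finite Q" "Q \<subseteq> rests s t" for Q
  proof -
    obtain m :: nat where m: "\<And>j i. j \<in> Q \<Longrightarrow> \<bar>j i\<bar> \<le> int m"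
    proof -
      define m where "m = Max (insert 0 ((\<lambda>(j, i). nat \<bar>j i\<bar>) ` (Q \<times> UNIV)))"
      have "nat \<bar>j i\<bar> \<le> m" if "j \<in> Q" for j i
        unfolding m_def using Q(1) that by (intro Max_ge) (auto intro!: finite_imageI finite_cartesian_product)
      then have "\<bar>j i\<bar> \<le> int m" if "j \<in> Q" for j i using that by (simp add: nat_le_iff)
      then show ?thesis by (rule that)
    qed
    \<comment> \<open>Elements of \<open>rests\<close> vanish on the main axes and are determined by
      the other coordinates.\<close>
    have inj: "inj_on (\<lambda>j. restrict j ?S) Q"
    proof (rule inj_onI)
      fix j j' assume jj: "j \<in> Q" "j' \<in> Q" "restrict j ?S = restrict j' ?S"
      have "j i = j' i" for i
      proof (cases "i \<in> main_axes s t")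
        case True
        have "j \<in> rests s t" "j' \<in> rests s t" using jj Q by auto
        then show ?thesis using True by (simp add: rests_def)
      next
        case False
        then show ?thesis using fun_cong[OF jj(3), of i] by simp
      qed
      then show "j = j'" by blast
    qed
    have "(\<Sum>j\<in>Q. (norm (rest_factor a b s t j))\<^sup>2) \<le> (\<Sum>j\<in>Q. \<Prod>i\<in>?S. h (restrict j ?S i))"
    proof (rule sum_mono)
      fix j
      have "(norm (rest_factor a b s t j))\<^sup>2 = (\<Prod>i\<in>?S. (norm (expansion_coeff a b s (t i) (j i)))\<^sup>2)"
        by (simp add: rest_factor_def prod_norm[symmetric] prod_power_distrib)
      also have "\<dots> \<le> (\<Prod>i\<in>?S. h (j i))"
        using type_maps_UNIV[OF t] by (intro prod_mono) (auto intro!: h)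
      finally show "(norm (rest_factor a b s t j))\<^sup>2 \<le> (\<Prod>i\<in>?S. h (restrict j ?S i))" by simp
    qed
    also have "\<dots> = (\<Sum>g\<in>(\<lambda>j. restrict j ?S) ` Q. \<Prod>i\<in>?S. h (g i))"
      by (subst sum.reindex[OF inj]) simp
    also have "\<dots> \<le> (\<Sum>g\<in>PiE ?S (\<lambda>_. {-int m..int m}). \<Prod>i\<in>?S. h (g i))"
    proof (rule sum_mono2)
      show "(\<lambda>j. restrict j ?S) ` Q \<subseteq> PiE ?S (\<lambda>_. {-int m..int m})"
      proof (rule image_subsetI)
        fix j assume j: "j \<in> Q"
        have "j i \<in> {-int m..int m}" for i using m[OF j, of i] by auto
        then show "restrict j ?S \<in> PiE ?S (\<lambda>_. {-int m..int m})" by simp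
      qed
    qed (auto intro!: finite_PiE prod_nonneg h0)
    also have "\<dots> = (\<Prod>i\<in>?S. \<Sum>k=-int m..int m. h k)" by (rule prod_sum_PiE[symmetric]) auto
    also have "\<dots> \<le> (\<Prod>i\<in>?S. C * 5)"
    proof (intro prod_mono conjI sum_nonneg h0)
      show "(\<Sum>k=-int m..int m. h k) \<le> C * 5"
        unfolding h_def sum_distrib_left[symmetric] by (rule mult_left_mono[OF sum_inverse_squares_bound C0])
    qed
    finally show ?thesis by simp
  qed
  then show ?thesis using C0 by (intro exI[of _ "(C * 5) ^ card ?S"]) auto
qed

text \<open>Unordered summability: a finite set nearly attaining the supremum of the finite sums
  leaves only small sums disjoint from it.\<close>

lemma bounded_sums_small_tail:
  fixes G :: "'i \<Rightarrow> real"
  assumes G: "\<And>j. 0 \<le> G j" and R: "\<And>Q. finite Q \<Longrightarrow> Q \<subseteq> D \<Longrightarrow> sum G Q \<le> R" and e: "\<epsilon> > 0"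
  shows "\<exists>J. finite J \<and> J \<subseteq> D \<and> (\<forall>Q. finite Q \<and> Q \<subseteq> D - J \<longrightarrow> sum G Q \<le> \<epsilon>)"
proof -
  let ?F = "{Q. finite Q \<and> Q \<subseteq> D}"
  have ne: "?F \<noteq> {}" and bd: "bdd_above (sum G ` ?F)" using R by (auto intro!: bdd_aboveI2)
  have "(SUP Q\<in>?F. sum G Q) - \<epsilon> < (SUP Q\<in>?F. sum G Q)" using e by simp
  then obtain J where J: "J \<in> ?F" "(SUP Q\<in>?F. sum G Q) - \<epsilon> < sum G J"
    using less_cSUP_iff[OF ne bd] by auto
  have "sum G Q \<le> \<epsilon>" if Q: "finite Q" "Q \<subseteq> D - J" for Q
  proof -
    have "sum G (J \<union> Q) \<le> (SUP Q\<in>?F. sum G Q)" using J Q by (intro cSUP_upper bd) auto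
    moreover have "sum G (J \<union> Q) = sum G J + sum G Q" using J Q by (intro sum.union_disjoint) auto
    ultimately show ?thesis using J(2) by linarith
  qed
  then show ?thesis using J by blast
qed

section \<open>Error of the truncated expansion\<close>

lemma fourier_sum:
  assumes "\<And>i. i \<in> I \<Longrightarrow> u i \<in> L2_space (cube_measure a b)"
  shows "fourier a b (\<lambda>x. \<Sum>i\<in>I. c i * u i x) k = (\<Sum>i\<in>I. c i * fourier a b (u i) k)"
  unfolding fourier_def
  using assms by (subst L2_inner_sum_left) (auto intro: L2_space_scale trig_L2 simp: L2_inner_scale_left)

text \<open>The output function attached to one functional; the size of \<open>J\<close> does not
  affect the rank.\<close>

definition approx_term ::
    "real \<Rightarrow> real \<Rightarrow> nat \<Rightarrow> ('n::finite \<Rightarrow> nat) \<Rightarrow> ('n \<Rightarrow> int) set \<Rightarrow> ('n \<Rightarrow> int) \<Rightarrow> real^'n \<Rightarrow> complex" where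
  "approx_term a b s t J \<kappa> x =
     (\<Sum>j\<in>J. (main_factor a b s t \<kappa> * rest_factor a b s t j) * trig a b (\<lambda>i. \<kappa> i + j i) x)"

lemma approx_term_L2: "approx_term a b s t J \<kappa> \<in> L2_space (cube_measure a b)"
  unfolding approx_term_def[abs_def] by (intro L2_space_sum L2_space_scale trig_L2)

text \<open>Every k decomposes uniquely into a functional frequency and a rest, so at most one
  exponential of the sum contributes.\<close>

lemma fourier_approx_term:
  assumes ab: "a < b" and t: "t \<in> type_maps s UNIV" and \<kappa>: "\<kappa> \<in> freqs s t" and J: "finite J" "J \<subseteq> rests s t"
  shows "fourier a b (approx_term a b s t J \<kappa>) k =
    (if freq_part s t k = \<kappa> \<and> rest_part s t k \<in> J
     then main_factor a b s t (freq_part s t k) * rest_factor a b s t (rest_part s t k) else 0)"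
proof -
  have "fourier a b (approx_term a b s t J \<kappa>) k =
     (\<Sum>j\<in>J. (main_factor a b s t \<kappa> * rest_factor a b s t j) * fourier a b (trig a b (\<lambda>i. \<kappa> i + j i)) k)"
    unfolding approx_term_def[abs_def] by (rule fourier_sum) (rule trig_L2)
  also have "\<dots> = (\<Sum>j\<in>J. if j = rest_part s t k then
     (if freq_part s t k = \<kappa> then main_factor a b s t \<kappa> * rest_factor a b s t (rest_part s t k) else 0) else 0)"
  proof (intro sum.cong refl)
    fix j assume j: "j \<in> J"
    have "(\<lambda>i. \<kappa> i + j i) = k \<longleftrightarrow> freq_part s t k = \<kappa> \<and> j = rest_part s t k"
      using freq_rest_unique[OF t \<kappa>, of j] freq_rest_parts(3)[OF t, of k] j J by auto
    then show "(main_factor a b s t \<kappa> * rest_factor a b s t j) * fourier a b (trig a b (\<lambda>i. \<kappa> i + j i)) k =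
      (if j = rest_part s t k then
        (if freq_part s t k = \<kappa> then main_factor a b s t \<kappa> * rest_factor a b s t (rest_part s t k) else 0) else 0)"
      by (auto simp: fourier_def trig_orthonormal[OF ab])
  qed
  also have "\<dots> = (if freq_part s t k = \<kappa> \<and> rest_part s t k \<in> J
     then main_factor a b s t (freq_part s t k) * rest_factor a b s t (rest_part s t k) else 0)"
    using J by simp
  finally show ?thesis .
qed

text \<open>The share of type \<open>t\<close> in the Fourier coefficient of the approximation
  error.\<close>

definition residual ::
    "real \<Rightarrow> real \<Rightarrow> nat \<Rightarrow> ('n::finite \<Rightarrow> nat) \<Rightarrow> ('n \<Rightarrow> int) set \<Rightarrow> ('n \<Rightarrow> int) set \<Rightarrow> (real^'n \<Rightarrow> complex) \<Rightarrow> ('n \<Rightarrow> int) \<Rightarrow> complex" where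
  "residual a b s t K J f k =
     (if freq_part s t k \<in> K \<and> rest_part s t k \<in> J then 0
      else main_factor a b s t (freq_part s t k) * rest_factor a b s t (rest_part s t k) *
        mix_coeff a b (deriv_index s t) f (freq_part s t k))"

lemma residual_bound:
  fixes f :: "real^'n::finite \<Rightarrow> complex" and t :: "'n \<Rightarrow> nat"
  assumes ab: "a < b" and t: "t \<in> type_maps s UNIV" and N: "N > 0" and f: "f \<in> H_mix a b s"
    and R: "\<And>Q. finite Q \<Longrightarrow> Q \<subseteq> rests s t \<Longrightarrow> (\<Sum>j\<in>Q. (norm (rest_factor a b s t j))\<^sup>2) \<le> R"
    and \<tau>: "\<And>Q. finite Q \<Longrightarrow> Q \<subseteq> rests s t - J \<Longrightarrow> (\<Sum>j\<in>Q. (norm (rest_factor a b s t j))\<^sup>2) \<le> \<tau>"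
    and Q: "finite Q"
  defines "c \<equiv> card (main_axes s t)" and "\<theta> \<equiv> 2 * pi / (b - a)"
  shows "(\<Sum>k\<in>Q. (norm (residual a b s t (hyp_cross (main_axes s t) N) J f k))\<^sup>2) \<le>
    ((1 / (\<theta> ^ c * N) ^ s)\<^sup>2 * R + (1 / \<theta> ^ (s * c))\<^sup>2 * \<tau>) * (H_mix_norm a b s f)\<^sup>2"
proof -
  let ?K = "hyp_cross (main_axes s t) N"
  define m where "m \<kappa> = (norm (main_factor a b s t \<kappa>))\<^sup>2" for \<kappa>
  define \<rho> where "\<rho> j = (norm (rest_factor a b s t j))\<^sup>2" for j
  define F where "F \<kappa> = (norm (mix_coeff a b (deriv_index s t) f \<kappa>))\<^sup>2" for \<kappa>
  define g where "g \<kappa> j = (if \<kappa> \<in> ?K \<and> j \<in> J then 0 else m \<kappa> * \<rho> j * F \<kappa>)" for \<kappa> j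
  define D where "D = (1 / (\<theta> ^ c * N) ^ s)\<^sup>2 * R + (1 / \<theta> ^ (s * c))\<^sup>2 * \<tau>"
  have nn: "0 \<le> m \<kappa>" "0 \<le> \<rho> j" "0 \<le> F \<kappa>" for \<kappa> j by (simp_all add: m_def \<rho>_def F_def)
  have R0: "0 \<le> R" using R[of "{}"] by simp
  have \<tau>0: "0 \<le> \<tau>" using \<tau>[of "{}"] by simp
  have inj: "inj_on (\<lambda>k. (freq_part s t k, rest_part s t k)) Q"
    by (rule inj_on_inverseI[where g = "\<lambda>(\<kappa>, j) i. \<kappa> i + j i"]) (simp add: freq_rest_parts(3)[OF t])
  let ?A = "freq_part s t ` Q" and ?B = "rest_part s t ` Q"
  have subA: "?A \<subseteq> freqs s t" and subB: "?B \<subseteq> rests s t" using freq_rest_parts[OF t] by auto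
  have "(\<Sum>k\<in>Q. (norm (residual a b s t ?K J f k))\<^sup>2) = (\<Sum>k\<in>Q. g (freq_part s t k) (rest_part s t k))"
    by (intro sum.cong refl) (simp add: residual_def g_def m_def \<rho>_def F_def norm_mult power_mult_distrib)
  also have "\<dots> = (\<Sum>(\<kappa>, j)\<in>(\<lambda>k. (freq_part s t k, rest_part s t k)) ` Q. g \<kappa> j)"
    by (subst sum.reindex[OF inj]) simp
  \<comment> \<open>Enlarging the pairs to a full product set decouples the two sums; all terms are
    nonnegative.\<close>
  also have "\<dots> \<le> (\<Sum>(\<kappa>, j)\<in>?A \<times> ?B. g \<kappa> j)"
    using Q nn by (intro sum_mono2) (auto simp: g_def)
  also have "\<dots> = (\<Sum>\<kappa>\<in>?A. \<Sum>j\<in>?B. g \<kappa> j)" by (rule sum.cartesian_product[symmetric])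
  also have "\<dots> \<le> (\<Sum>\<kappa>\<in>?A. D * F \<kappa>)"
  proof (rule sum_mono)
    fix \<kappa> assume \<kappa>: "\<kappa> \<in> ?A"
    show "(\<Sum>j\<in>?B. g \<kappa> j) \<le> D * F \<kappa>"
    proof (cases "\<kappa> \<in> ?K")
      case False
      have "m \<kappa> \<le> (1 / (\<theta> ^ c * N) ^ s)\<^sup>2"
        unfolding m_def c_def \<theta>_def using \<kappa> subA False
        by (intro power_mono norm_main_factor_outside[OF ab N]) auto
      moreover have "(\<Sum>j\<in>?B. \<rho> j) \<le> R" unfolding \<rho>_def using Q subB by (intro R) auto
      moreover have "0 \<le> (\<Sum>j\<in>?B. \<rho> j)" using nn by (intro sum_nonneg)
      ultimately have "m \<kappa> * (\<Sum>j\<in>?B. \<rho> j) \<le> (1 / (\<theta> ^ c * N) ^ s)\<^sup>2 * R"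
        by (intro mult_mono) auto
      also have "\<dots> \<le> D" unfolding D_def using \<tau>0 by simp
      finally have "m \<kappa> * (\<Sum>j\<in>?B. \<rho> j) * F \<kappa> \<le> D * F \<kappa>" using nn by (intro mult_right_mono)
      then show ?thesis using False by (simp add: g_def sum_distrib_left sum_distrib_right mult_ac)
    next
      case True
      have "(\<Sum>j\<in>?B. g \<kappa> j) = (\<Sum>j\<in>?B - J. m \<kappa> * \<rho> j * F \<kappa>)"
        using Q True by (intro sum.mono_neutral_cong_right) (auto simp: g_def)
      also have "\<dots> = m \<kappa> * (\<Sum>j\<in>?B - J. \<rho> j) * F \<kappa>"
        by (simp add: sum_distrib_left sum_distrib_right mult_ac)
      also have "\<dots> \<le> D * F \<kappa>"
      proof (rule mult_right_mono[OF _ nn(3)])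
        have "m \<kappa> \<le> (1 / \<theta> ^ (s * c))\<^sup>2"
          unfolding m_def c_def \<theta>_def by (intro power_mono norm_main_factor_le[OF ab]) auto
        moreover have "(\<Sum>j\<in>?B - J. \<rho> j) \<le> \<tau>" unfolding \<rho>_def using Q subB by (intro \<tau>) auto
        moreover have "0 \<le> (\<Sum>j\<in>?B - J. \<rho> j)" using nn by (intro sum_nonneg)
        ultimately have "m \<kappa> * (\<Sum>j\<in>?B - J. \<rho> j) \<le> (1 / \<theta> ^ (s * c))\<^sup>2 * \<tau>"
          by (intro mult_mono) auto
        also have "\<dots> \<le> D" unfolding D_def using R0 by simp
        finally show "m \<kappa> * (\<Sum>j\<in>?B - J. \<rho> j) \<le> D" .
      qed
      finally show ?thesis .
    qed
  qed
  also have "\<dots> = D * (\<Sum>\<kappa>\<in>?A. F \<kappa>)" by (simp add: sum_distrib_left)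
  also have "\<dots> \<le> D * (H_mix_norm a b s f)\<^sup>2"
  proof (rule mult_left_mono)
    show "(\<Sum>\<kappa>\<in>?A. F \<kappa>) \<le> (H_mix_norm a b s f)\<^sup>2"
      unfolding F_def using Q by (intro mix_coeff_Bessel[OF ab f deriv_index_multi]) auto
    show "0 \<le> D" unfolding D_def using R0 \<tau>0 by (intro add_nonneg_nonneg mult_nonneg_nonneg) auto
  qed
  finally show ?thesis unfolding D_def .
qed

lemma L2_set_sum_le:
  fixes e :: "'t \<Rightarrow> 'k \<Rightarrow> complex"
  assumes "finite T"
  shows "L2_set (\<lambda>k. norm (\<Sum>t\<in>T. e t k)) Q \<le> (\<Sum>t\<in>T. L2_set (\<lambda>k. norm (e t k)) Q)"
  using assms
proof (induction T rule: finite_induct)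
  case (insert t T)
  have "L2_set (\<lambda>k. norm (\<Sum>t\<in>insert t T. e t k)) Q \<le> L2_set (\<lambda>k. norm (e t k) + norm (\<Sum>t\<in>T. e t k)) Q"
    using insert.hyps by (intro L2_set_mono) (auto intro: norm_triangle_ineq)
  also have "\<dots> \<le> L2_set (\<lambda>k. norm (e t k)) Q + L2_set (\<lambda>k. norm (\<Sum>t\<in>T. e t k)) Q"
    by (rule L2_set_triangle_ineq)
  finally show ?case using insert by simp
qed (simp add: L2_set_def)

text \<open>Different types reach the same frequency, so their errors are not orthogonal and are
  added by Minkowski's inequality for coefficients. A sharp total then requires that all types but
  one have small \<open>\<delta> t\<close>.\<close>

lemma approximation_error:
  fixes f :: "real^'n::finite \<Rightarrow> complex" and Nt :: "('n \<Rightarrow> nat) \<Rightarrow> real" and s :: nat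
  defines "T \<equiv> type_maps s (UNIV :: 'n set)"
  assumes ab: "a < b" and f: "f \<in> H_mix a b s" and J: "\<And>t. t \<in> T \<Longrightarrow> finite (J t) \<and> J t \<subseteq> rests s t"
    and \<delta>: "\<And>t Q. t \<in> T \<Longrightarrow> finite Q \<Longrightarrow>
      (\<Sum>k\<in>Q. (norm (residual a b s t (hyp_cross (main_axes s t) (Nt t)) (J t) f k))\<^sup>2) \<le> (\<delta> t)\<^sup>2 * (H_mix_norm a b s f)\<^sup>2"
    and \<delta>0: "\<And>t. t \<in> T \<Longrightarrow> 0 \<le> \<delta> t"
  shows "L2_norm (cube_measure a b) (\<lambda>x. f x -
      (\<Sum>(t, \<kappa>)\<in>Sigma T (\<lambda>t. hyp_cross (main_axes s t) (Nt t)). mix_coeff a b (deriv_index s t) f \<kappa> * approx_term a b s t (J t) \<kappa> x))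
    \<le> (\<Sum>t\<in>T. \<delta> t) * H_mix_norm a b s f"
proof -
  let ?K = "\<lambda>t. hyp_cross (main_axes s t) (Nt t)"
  let ?I = "Sigma T ?K"
  let ?A = "\<lambda>x. \<Sum>(t, \<kappa>)\<in>?I. mix_coeff a b (deriv_index s t) f \<kappa> * approx_term a b s t (J t) \<kappa> x"
  have finT: "finite T" unfolding T_def by (rule finite_type_maps) simp
  have finK: "finite (?K t)" for t using hyp_cross_card[of "main_axes s t"] by simp
  have Kfreq: "?K t \<subseteq> freqs s t" for t by (auto simp: hyp_cross_def freqs_def)
  have A_L2: "?A \<in> L2_space (cube_measure a b)"
    unfolding case_prod_unfold by (intro L2_space_sum L2_space_scale approx_term_L2)
  have "fourier a b ?A k = (\<Sum>(t, \<kappa>)\<in>?I. mix_coeff a b (deriv_index s t) f \<kappa> * fourier a b (approx_term a b s t (J t) \<kappa>) k)" for k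
    unfolding case_prod_unfold by (rule fourier_sum) (rule approx_term_L2)
  also have "(\<Sum>(t, \<kappa>)\<in>?I. mix_coeff a b (deriv_index s t) f \<kappa> * fourier a b (approx_term a b s t (J t) \<kappa>) k) =
     (\<Sum>t\<in>T. \<Sum>\<kappa>\<in>?K t. mix_coeff a b (deriv_index s t) f \<kappa> * fourier a b (approx_term a b s t (J t) \<kappa>) k)" for k
    using finT finK by (subst sum.Sigma) auto
  also have "\<dots> k = (\<Sum>t\<in>T. if freq_part s t k \<in> ?K t \<and> rest_part s t k \<in> J t
     then main_factor a b s t (freq_part s t k) * rest_factor a b s t (rest_part s t k) *
        mix_coeff a b (deriv_index s t) f (freq_part s t k) else 0)" for k
  proof (intro sum.cong refl)
    fix t assume t: "t \<in> T"
    have "(\<Sum>\<kappa>\<in>?K t. mix_coeff a b (deriv_index s t) f \<kappa> * fourier a b (approx_term a b s t (J t) \<kappa>) k) =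
       (\<Sum>\<kappa>\<in>?K t. if \<kappa> = freq_part s t k then (if rest_part s t k \<in> J t
         then main_factor a b s t (freq_part s t k) * rest_factor a b s t (rest_part s t k) *
        mix_coeff a b (deriv_index s t) f (freq_part s t k) else 0) else 0)"
    proof (intro sum.cong refl)
      fix \<kappa> assume "\<kappa> \<in> ?K t"
      then have \<kappa>: "\<kappa> \<in> freqs s t" using Kfreq by blast
      show "mix_coeff a b (deriv_index s t) f \<kappa> * fourier a b (approx_term a b s t (J t) \<kappa>) k =
        (if \<kappa> = freq_part s t k then (if rest_part s t k \<in> J t
         then main_factor a b s t (freq_part s t k) * rest_factor a b s t (rest_part s t k) *
        mix_coeff a b (deriv_index s t) f (freq_part s t k) else 0) else 0)"
        using J[OF t] t unfolding T_def by (subst fourier_approx_term[OF ab _ \<kappa>]) (auto simp: mult.commute)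
    qed
    then show "(\<Sum>\<kappa>\<in>?K t. mix_coeff a b (deriv_index s t) f \<kappa> * fourier a b (approx_term a b s t (J t) \<kappa>) k) =
       (if freq_part s t k \<in> ?K t \<and> rest_part s t k \<in> J t
     then main_factor a b s t (freq_part s t k) * rest_factor a b s t (rest_part s t k) *
        mix_coeff a b (deriv_index s t) f (freq_part s t k) else 0)"
      using finK[of t] by simp
  qed
  finally have FA: "fourier a b ?A k = (\<Sum>t\<in>T. if freq_part s t k \<in> ?K t \<and> rest_part s t k \<in> J t
     then main_factor a b s t (freq_part s t k) * rest_factor a b s t (rest_part s t k) *
        mix_coeff a b (deriv_index s t) f (freq_part s t k) else 0)" for k .
  have FD: "fourier a b (\<lambda>x. f x - ?A x) k = (\<Sum>t\<in>T. residual a b s t (?K t) (J t) f k)" for k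
  proof -
    have "fourier a b (\<lambda>x. f x - ?A x) k = fourier a b f k - fourier a b ?A k"
      unfolding fourier_def by (rule L2_inner_diff_left[OF H_mix_L2[OF f] A_L2 trig_L2])
    also have "fourier a b f k = (\<Sum>t\<in>T. main_factor a b s t (freq_part s t k) * rest_factor a b s t (rest_part s t k) *
        mix_coeff a b (deriv_index s t) f (freq_part s t k))"
      unfolding T_def by (subst fourier_expand[OF ab f]) (intro sum.cong refl, simp add: expansion_prod_split)
    finally show ?thesis unfolding FA sum_subtractf[symmetric] residual_def
      by (auto intro!: sum.cong)
  qed
  have "(L2_norm (cube_measure a b) (\<lambda>x. f x - ?A x))\<^sup>2 \<le> ((\<Sum>t\<in>T. \<delta> t) * H_mix_norm a b s f)\<^sup>2"
  proof (rule fourier_bounded_imp_norm_le[OF ab L2_space_diff[OF H_mix_L2[OF f] A_L2]])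
    fix Q :: "('n \<Rightarrow> int) set" assume Q: "finite Q"
    have "L2_set (\<lambda>k. norm (\<Sum>t\<in>T. residual a b s t (?K t) (J t) f k)) Q \<le>
      (\<Sum>t\<in>T. L2_set (\<lambda>k. norm (residual a b s t (?K t) (J t) f k)) Q)"
      by (rule L2_set_sum_le[OF finT])
    also have "\<dots> \<le> (\<Sum>t\<in>T. \<delta> t * H_mix_norm a b s f)"
    proof (rule sum_mono)
      fix t assume t: "t \<in> T"
      have "L2_set (\<lambda>k. norm (residual a b s t (?K t) (J t) f k)) Q \<le> sqrt ((\<delta> t)\<^sup>2 * (H_mix_norm a b s f)\<^sup>2)"
        unfolding L2_set_def using \<delta>[OF t Q] by simp
      also have "\<dots> = \<delta> t * H_mix_norm a b s f"
        using \<delta>0[OF t] by (simp add: real_sqrt_mult H_mix_norm_nonneg)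
      finally show "L2_set (\<lambda>k. norm (residual a b s t (?K t) (J t) f k)) Q \<le> \<delta> t * H_mix_norm a b s f" .
    qed
    also have "\<dots> = (\<Sum>t\<in>T. \<delta> t) * H_mix_norm a b s f" by (simp add: sum_distrib_right)
    finally have le: "L2_set (\<lambda>k. norm (\<Sum>t\<in>T. residual a b s t (?K t) (J t) f k)) Q \<le> (\<Sum>t\<in>T. \<delta> t) * H_mix_norm a b s f" .
    have "(\<Sum>k\<in>Q. (norm (fourier a b (\<lambda>x. f x - ?A x) k))\<^sup>2) =
       (L2_set (\<lambda>k. norm (\<Sum>t\<in>T. residual a b s t (?K t) (J t) f k)) Q)\<^sup>2"
      unfolding FD by (simp add: L2_set_def sum_nonneg)
    also have "\<dots> \<le> ((\<Sum>t\<in>T. \<delta> t) * H_mix_norm a b s f)\<^sup>2"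
      using le by (intro power_mono) auto
    finally show "(\<Sum>k\<in>Q. (norm (fourier a b (\<lambda>x. f x - ?A x) k))\<^sup>2) \<le> ((\<Sum>t\<in>T. \<delta> t) * H_mix_norm a b s f)\<^sup>2" .
  qed
  then show ?thesis
    by (rule power2_le_imp_le) (intro mult_nonneg_nonneg sum_nonneg \<delta>0 H_mix_norm_nonneg)
qed

section \<open>Two-sided bounds for the Sobolev embedding and the limit\<close>

lemma L2_embedding_H_mix:
  assumes "a < b"
  shows "L2_embedding (H_mix a b s :: (real^'n::finite \<Rightarrow> complex) set) (H_mix_norm a b s) (cube_measure a b)"
proof
  show "H_mix a b s \<subseteq> L2_space (cube_measure a b :: (real^'n) measure)" by (auto intro: H_mix_L2)
  show "(\<lambda>x. 0) \<in> H_mix a b s" by (rule H_mix_zero)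
qed (auto intro: H_mix_lincomb H_mix_norm_scale[OF assms] L2_norm_le_H_mix_norm[OF assms])

lemma embedding_approx_number_eq:
  "embedding_approx_number TYPE('n::finite) a b s n =
     approx_number (H_mix a b s :: (real^'n \<Rightarrow> complex) set) (H_mix_norm a b s)
       (L2_space (cube_measure a b)) (L2_norm (cube_measure a b)) (\<lambda>f. f) n"
  by (simp add: embedding_approx_number_def L2_cube_def L2_cube_norm_def[abs_def])

text \<open>\<open>B\<close> and \<open>C\<close> must be independent of N, whereas the truncation
  sets of the rests may depend on it, since they cost no rank. The pure main type \<open>tm\<close>
  carries the constant, and all other types share \<epsilon>.\<close>

lemma embedding_upper:
  fixes a b \<epsilon> :: real and s :: nat
  assumes ab: "a < b" and s: "s \<ge> 1" and \<epsilon>: "\<epsilon> > 0"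
  defines "d \<equiv> CARD('n::finite)" and "\<theta> \<equiv> 2 * pi / (b - a)"
  shows "\<exists>B\<ge>1. \<exists>C. \<forall>N>0. \<forall>n. 2 ^ d * div_count d N + C * div_count (d - 1) (B * N) < real n \<longrightarrow>
    embedding_approx_number TYPE('n) a b s n \<le> (1 / \<theta> ^ (s * d) + \<epsilon>) / N ^ s"
proof -
  define T where "T = type_maps s (UNIV :: 'n set)"
  define tm where "tm = (\<lambda>_::'n. Suc s)"
  define P where "P = real (card T)"
  \<comment> \<open>Each of the fewer than \<open>P\<close> other types is allowed an error
    \<open>2 * e0 / N ^ s\<close>.\<close>
  define e0 where "e0 = \<epsilon> / (2 * P)"
  define c where "c t = card (main_axes s t)" for t :: "'n \<Rightarrow> nat"
  have \<theta>: "\<theta> > 0" using ab by (simp add: \<theta>_def)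
  have finT: "finite T" unfolding T_def by (rule finite_type_maps) simp
  have tmT: "tm \<in> T" by (simp add: T_def tm_def type_maps_def)
  have P: "P \<ge> 1" unfolding P_def using finT tmT by (metis One_nat_def Suc_leI card_gt_0_iff empty_iff of_nat_1 of_nat_mono)
  have e0: "e0 > 0" using \<epsilon> P by (simp add: e0_def)
  have tm_axes: "main_axes s tm = UNIV" by (simp add: main_axes_def tm_def)
  then have c_tm: "c tm = d" by (simp add: c_def d_def)
  have c_le: "c t \<le> d - 1" if "t \<in> T" "t \<noteq> tm" for t
  proof -
    have "main_axes s t \<noteq> UNIV" using that by (auto simp: main_axes_def tm_def)
    then have "main_axes s t \<subset> UNIV" by blast
    then have "c t < d" unfolding c_def d_def by (intro psubset_card_mono) auto
    then show ?thesis by simp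
  qed
  have "\<forall>t\<in>T. \<exists>R\<ge>0. \<forall>Q. finite Q \<and> Q \<subseteq> rests s t \<longrightarrow> (\<Sum>j\<in>Q. (norm (rest_factor a b s t j))\<^sup>2) \<le> R"
    unfolding T_def by (intro ballI rest_factor_sum_bounded[OF ab])
  then obtain R where R0: "\<And>t. t \<in> T \<Longrightarrow> 0 \<le> R t"
    and R: "\<And>t Q. t \<in> T \<Longrightarrow> finite Q \<Longrightarrow> Q \<subseteq> rests s t \<Longrightarrow> (\<Sum>j\<in>Q. (norm (rest_factor a b s t j))\<^sup>2) \<le> R t"
    by metis
  \<comment> \<open>Chosen so that \<open>Bt t \<le> (B ^ s)\<^sup>2\<close> makes the contribution
    from outside the enlarged cross at most \<open>e0 / N ^ s\<close>.\<close>
  define Bt where "Bt t = (1 / (\<theta> ^ c t) ^ s)\<^sup>2 * R t / e0\<^sup>2" for t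
  define B where "B = 1 + (\<Sum>t\<in>T. Bt t)"
  have Bt0: "0 \<le> Bt t" if "t \<in> T" for t using R0[OF that] by (simp add: Bt_def)
  have B1: "B \<ge> 1" unfolding B_def using Bt0 by (simp add: sum_nonneg)
  have Bt_le: "Bt t \<le> (B ^ s)\<^sup>2" if "t \<in> T" for t
  proof -
    have "Bt t \<le> (\<Sum>t\<in>T. Bt t)" using that finT Bt0 by (intro member_le_sum) auto
    then have "Bt t \<le> B" by (simp add: B_def)
    also have "B \<le> B ^ (s * 2)" using B1 s by (intro self_le_power) auto
    finally show ?thesis by (simp add: power_mult)
  qed
  define C where "C = P * 2 ^ d"
  have "embedding_approx_number TYPE('n) a b s n \<le> (1 / \<theta> ^ (s * d) + \<epsilon>) / N ^ s"
    if N: "N > 0" and n: "2 ^ d * div_count d N + C * div_count (d - 1) (B * N) < real n" for N n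
  proof -
    define Nt where "Nt t = (if t = tm then N else B * N)" for t
    have Nt0: "Nt t > 0" for t using N B1 by (simp add: Nt_def)
    \<comment> \<open>Cancels the uniform bound of the main factor, so that the discarded rests also
      contribute at most \<open>e0 / N ^ s\<close>.\<close>
    define \<tau> where "\<tau> t = (e0 / N ^ s)\<^sup>2 / (1 / \<theta> ^ (s * c t))\<^sup>2" for t
    define \<delta> where "\<delta> t = (if t = tm then 1 / \<theta> ^ (s * d) / N ^ s else 2 * e0 / N ^ s)" for t
    have "\<tau> t > 0" for t unfolding \<tau>_def using e0 N \<theta> by (intro divide_pos_pos zero_less_power) auto
    then have "\<forall>t\<in>T. \<exists>J. finite J \<and> J \<subseteq> rests s t \<and>
       (\<forall>Q. finite Q \<and> Q \<subseteq> rests s t - J \<longrightarrow> (\<Sum>j\<in>Q. (norm (rest_factor a b s t j))\<^sup>2) \<le> \<tau> t)"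
      using R by (intro ballI bounded_sums_small_tail) auto
    then obtain J' where J': "\<And>t. t \<in> T \<Longrightarrow> finite (J' t) \<and> J' t \<subseteq> rests s t"
      "\<And>t Q. t \<in> T \<Longrightarrow> finite Q \<Longrightarrow> Q \<subseteq> rests s t - J' t \<Longrightarrow> (\<Sum>j\<in>Q. (norm (rest_factor a b s t j))\<^sup>2) \<le> \<tau> t"
      by metis
    \<comment> \<open>For the pure main type the only rest is 0, and nothing is discarded.\<close>
    define J where "J t = (if t = tm then {\<lambda>_. 0} else J' t)" for t
    have rests_tm: "rests s tm = {\<lambda>_. 0}" by (auto simp: rests_def tm_axes)
    have J: "finite (J t) \<and> J t \<subseteq> rests s t" if "t \<in> T" for t
      using J'(1)[OF that] by (simp add: J_def rests_tm)
    have res: "(\<Sum>k\<in>Q. (norm (residual a b s t (hyp_cross (main_axes s t) (Nt t)) (J t) f k))\<^sup>2) \<le>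
        (\<delta> t)\<^sup>2 * (H_mix_norm a b s f)\<^sup>2"
      if t: "t \<in> T" and Q: "finite Q" and f: "f \<in> H_mix a b s" for t Q f
    proof (cases "t = tm")
      case True
      have rf: "rest_factor a b s tm j = 1" for j by (simp add: rest_factor_def tm_axes)
      have "(\<Sum>j\<in>Q. (norm (rest_factor a b s tm j))\<^sup>2) \<le> 1" if "finite Q" "Q \<subseteq> rests s tm" for Q
        using card_mono[OF _ that(2)] by (simp add: rf rests_tm)
      moreover have "(\<Sum>j\<in>Q. (norm (rest_factor a b s tm j))\<^sup>2) \<le> 0" if "finite Q" "Q \<subseteq> rests s tm - J tm" for Q
        using that by (simp add: rests_tm J_def)
      ultimately have "(\<Sum>k\<in>Q. (norm (residual a b s tm (hyp_cross (main_axes s tm) (Nt tm)) (J tm) f k))\<^sup>2) \<le>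
        ((1 / (\<theta> ^ c tm * Nt tm) ^ s)\<^sup>2 * 1 + (1 / \<theta> ^ (s * c tm))\<^sup>2 * 0) * (H_mix_norm a b s f)\<^sup>2"
        unfolding c_def \<theta>_def using tmT Nt0 f Q unfolding T_def by (intro residual_bound[OF ab]) auto
      also have "(1 / (\<theta> ^ c tm * Nt tm) ^ s)\<^sup>2 * 1 + (1 / \<theta> ^ (s * c tm))\<^sup>2 * 0 = (\<delta> tm)\<^sup>2"
        by (simp add: \<delta>_def Nt_def c_tm power_mult_distrib power_mult[symmetric] mult.commute)
      finally show ?thesis using True by simp
    next
      case False
      have "(\<Sum>k\<in>Q. (norm (residual a b s t (hyp_cross (main_axes s t) (Nt t)) (J t) f k))\<^sup>2) \<le>
        ((1 / (\<theta> ^ c t * Nt t) ^ s)\<^sup>2 * R t + (1 / \<theta> ^ (s * c t))\<^sup>2 * \<tau> t) * (H_mix_norm a b s f)\<^sup>2"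
        unfolding c_def \<theta>_def
        by (rule residual_bound[OF ab]) (use t Nt0 f Q R J'(2) False in \<open>auto simp: T_def J_def\<close>)
      also have "\<dots> \<le> (\<delta> t)\<^sup>2 * (H_mix_norm a b s f)\<^sup>2"
      proof (rule mult_right_mono)
        have "(1 / (\<theta> ^ c t * Nt t) ^ s)\<^sup>2 * R t = Bt t / (B ^ s)\<^sup>2 * (e0 / N ^ s)\<^sup>2"
          using False e0 B1 N by (simp add: Bt_def Nt_def power_mult_distrib power_divide)
        also have "\<dots> \<le> 1 * (e0 / N ^ s)\<^sup>2"
          using Bt_le[OF t] B1 by (intro mult_right_mono) (auto simp: divide_le_eq_1)
        finally have 1: "(1 / (\<theta> ^ c t * Nt t) ^ s)\<^sup>2 * R t \<le> (e0 / N ^ s)\<^sup>2" by simp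
        have 2: "(1 / \<theta> ^ (s * c t))\<^sup>2 * \<tau> t = (e0 / N ^ s)\<^sup>2"
          using \<theta> by (simp add: \<tau>_def)
        have 3: "(\<delta> t)\<^sup>2 = 4 * (e0 / N ^ s)\<^sup>2" using False by (simp add: \<delta>_def power_mult_distrib power_divide)
        have 4: "0 \<le> (e0 / N ^ s)\<^sup>2" by simp
        show "(1 / (\<theta> ^ c t * Nt t) ^ s)\<^sup>2 * R t + (1 / \<theta> ^ (s * c t))\<^sup>2 * \<tau> t \<le> (\<delta> t)\<^sup>2"
          using 1 4 unfolding 2 3 by linarith
      qed simp
      finally show ?thesis .
    qed
    have \<delta>0: "0 \<le> \<delta> t" for t using e0 N \<theta> by (simp add: \<delta>_def)
    have sum_\<delta>: "(\<Sum>t\<in>T. \<delta> t) \<le> (1 / \<theta> ^ (s * d) + \<epsilon>) / N ^ s"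
    proof -
      have "(\<Sum>t\<in>T. \<delta> t) = \<delta> tm + (\<Sum>t\<in>T - {tm}. \<delta> t)" using finT tmT by (rule sum.remove)
      also have "(\<Sum>t\<in>T - {tm}. \<delta> t) = (\<Sum>t\<in>T - {tm}. 2 * e0 / N ^ s)" by (intro sum.cong) (auto simp: \<delta>_def)
      also have "\<dots> \<le> (\<Sum>t\<in>T. 2 * e0 / N ^ s)" using finT e0 N by (intro sum_mono2) auto
      also have "\<dots> = \<epsilon> / N ^ s" using P by (simp add: e0_def flip: P_def)
      also have "\<delta> tm = 1 / \<theta> ^ (s * d) / N ^ s" by (simp add: \<delta>_def)
      finally show ?thesis by (simp add: add_divide_distrib)
    qed
    let ?K = "\<lambda>t. hyp_cross (main_axes s t) (Nt t)"
    let ?I = "Sigma T ?K"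
    have finK: "finite (?K t)" and cardK: "real (card (?K t)) = 2 ^ c t * div_count (c t) (Nt t)" for t
      using hyp_cross_card[of "main_axes s t"] by (simp_all add: c_def)
    have "real (card ?I) = (\<Sum>t\<in>T. real (card (?K t)))"
      using finT finK by (simp add: card_SigmaI)
    also have "\<dots> = real (card (?K tm)) + (\<Sum>t\<in>T - {tm}. real (card (?K t)))" using finT tmT by (rule sum.remove)
    also have "real (card (?K tm)) = 2 ^ d * div_count d N" unfolding cardK by (simp add: c_tm Nt_def)
    \<comment> \<open>The other crosses have dimension at most d - 1 and size \<open>B * N\<close>;
      their number and their sign factors go into \<open>C\<close>.\<close>
    also have "(\<Sum>t\<in>T - {tm}. real (card (?K t))) \<le> (\<Sum>t\<in>T - {tm}. 2 ^ d * div_count (d - 1) (B * N))"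
    proof (rule sum_mono)
      fix t assume t: "t \<in> T - {tm}"
      then have "c t \<le> d - 1" using c_le by simp
      then have "2 ^ c t * div_count (c t) (B * N) \<le> 2 ^ d * div_count (d - 1) (B * N)"
        by (intro mult_mono div_count_mono power_increasing) (auto simp: div_count_nonneg)
      then show "real (card (?K t)) \<le> 2 ^ d * div_count (d - 1) (B * N)" unfolding cardK using t by (simp add: Nt_def)
    qed
    also have "\<dots> \<le> (\<Sum>t\<in>T. 2 ^ d * div_count (d - 1) (B * N))"
      using finT by (intro sum_mono2) (auto simp: div_count_nonneg)
    also have "\<dots> = C * div_count (d - 1) (B * N)" by (simp add: C_def P_def)
    finally have "real (card ?I) < real n" using n by linarith
    then have cardI: "card ?I < n" by simp
    have finI: "finite ?I" using finT finK by blast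
    interpret L2_embedding "H_mix a b s :: (real^'n \<Rightarrow> complex) set" "H_mix_norm a b s" "cube_measure a b"
      by (rule L2_embedding_H_mix[OF ab])
    have "approx_number (H_mix a b s :: (real^'n \<Rightarrow> complex) set) (H_mix_norm a b s)
       (L2_space (cube_measure a b)) (L2_norm (cube_measure a b)) (\<lambda>f. f) n \<le> (1 / \<theta> ^ (s * d) + \<epsilon>) / N ^ s"
    proof (rule approx_number_le[OF finI cardI, where \<gamma> = "\<lambda>(t, \<kappa>) f. mix_coeff a b (deriv_index s t) f \<kappa>"
          and u = "\<lambda>(t, \<kappa>). approx_term a b s t (J t) \<kappa>" and C = 1])
      fix i :: "('n \<Rightarrow> nat) \<times> ('n \<Rightarrow> int)" and k :: complex and f g :: "real^'n \<Rightarrow> complex"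
      assume "f \<in> H_mix a b s" "g \<in> H_mix a b s"
      then show "(case i of (t, \<kappa>) \<Rightarrow> \<lambda>f. mix_coeff a b (deriv_index s t) f \<kappa>) (\<lambda>x. k * f x + g x) =
        k * (case i of (t, \<kappa>) \<Rightarrow> \<lambda>f. mix_coeff a b (deriv_index s t) f \<kappa>) f +
        (case i of (t, \<kappa>) \<Rightarrow> \<lambda>f. mix_coeff a b (deriv_index s t) f \<kappa>) g"
        by (auto simp: case_prod_unfold intro!: mix_coeff_lincomb[OF ab _ _ deriv_index_multi])
    next
      fix i :: "('n \<Rightarrow> nat) \<times> ('n \<Rightarrow> int)" and f :: "real^'n \<Rightarrow> complex"
      assume "f \<in> H_mix a b s"
      then show "norm ((case i of (t, \<kappa>) \<Rightarrow> \<lambda>f. mix_coeff a b (deriv_index s t) f \<kappa>) f) \<le> 1 * H_mix_norm a b s f"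
        by (auto simp: case_prod_unfold intro!: norm_mix_coeff_le[OF ab _ deriv_index_multi])
    next
      fix i :: "('n \<Rightarrow> nat) \<times> ('n \<Rightarrow> int)"
      show "(case i of (t, \<kappa>) \<Rightarrow> approx_term a b s t (J t) \<kappa>) \<in> L2_space (cube_measure a b)"
        by (simp add: case_prod_unfold approx_term_L2)
    next
      fix f :: "real^'n \<Rightarrow> complex" assume f: "f \<in> H_mix a b s" "H_mix_norm a b s f \<le> 1"
      have "L2_norm (cube_measure a b) (\<lambda>x. f x - (\<Sum>i\<in>?I. (case i of (t, \<kappa>) \<Rightarrow> \<lambda>f. mix_coeff a b (deriv_index s t) f \<kappa>) f *
           (case i of (t, \<kappa>) \<Rightarrow> approx_term a b s t (J t) \<kappa>) x)) \<le> (\<Sum>t\<in>T. \<delta> t) * H_mix_norm a b s f"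
        using approximation_error[OF ab f(1), of J Nt \<delta>] J res[OF _ _ f(1)] \<delta>0
        unfolding T_def by (simp add: case_prod_unfold)
      also have "\<dots> \<le> (\<Sum>t\<in>T. \<delta> t) * 1" using f(2) \<delta>0 by (intro mult_left_mono sum_nonneg) auto
      also have "\<dots> \<le> (1 / \<theta> ^ (s * d) + \<epsilon>) / N ^ s" using sum_\<delta> by simp
      finally show "L2_norm (cube_measure a b) (\<lambda>x. f x - (\<Sum>i\<in>?I. (case i of (t, \<kappa>) \<Rightarrow> \<lambda>f. mix_coeff a b (deriv_index s t) f \<kappa>) f *
           (case i of (t, \<kappa>) \<Rightarrow> approx_term a b s t (J t) \<kappa>) x)) \<le> (1 / \<theta> ^ (s * d) + \<epsilon>) / N ^ s" .
    qed
    then show ?thesis unfolding embedding_approx_number_eq .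
  qed
  then show ?thesis using B1 by blast
qed

text \<open>Frequencies with a small coordinate lie on d (2 k0 + 1) slices. Dropping that coordinate
  embeds a slice into a cross of dimension d - 1, so the loss is of lower order.\<close>

lemma hyp_cross_large_card:
  fixes N :: real and k0 :: nat
  defines "d \<equiv> CARD('n::finite)"
  shows "2 ^ d * div_count d N - real (d * (2 * k0 + 1)) * 2 ^ (d - 1) * div_count (d - 1) N \<le>
    real (card {k \<in> hyp_cross (UNIV :: 'n set) N. \<forall>i. int k0 \<le> \<bar>k i\<bar>})"
proof -
  let ?H = "hyp_cross (UNIV :: 'n set) N"
  let ?L = "{k \<in> ?H. \<forall>i. int k0 \<le> \<bar>k i\<bar>}"
  let ?S = "\<lambda>i m. {k \<in> ?H. k i = m}"
  have finH: "finite ?H" and cardH: "real (card ?H) = 2 ^ d * div_count d N"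
    using hyp_cross_card[of "UNIV :: 'n set" N] by (simp_all add: d_def)
  have slice: "real (card (?S i m)) \<le> 2 ^ (d - 1) * div_count (d - 1) N" for i m
  proof (cases "m = 0")
    case True
    then have empty: "?S i m = {}" by (auto simp: hyp_cross_def)
    show ?thesis unfolding empty by (simp add: div_count_nonneg)
  next
    case False
    have inj: "inj_on (\<lambda>k. k(i := 0)) (?S i m)"
    proof (rule inj_onI)
      fix k k' assume k: "k \<in> ?S i m" "k' \<in> ?S i m" "k(i := 0) = k'(i := 0)"
      have "k j = k' j" for j
        using k(1,2) fun_cong[OF k(3), of j] by (cases "j = i") simp_all
      then show "k = k'" by blast
    qed
    have sub: "(\<lambda>k. k(i := 0)) ` ?S i m \<subseteq> hyp_cross (UNIV - {i}) N"
    proof (rule image_subsetI)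
      fix k assume k: "k \<in> ?S i m"
      have nz: "k j \<noteq> 0" for j using k by (auto simp: hyp_cross_def)
      have "(\<Prod>j\<in>UNIV - {i}. real_of_int \<bar>(k(i := 0)) j\<bar>) = (\<Prod>j\<in>UNIV - {i}. real_of_int \<bar>k j\<bar>)"
        by (intro prod.cong) auto
      \<comment> \<open>A nonzero integer has modulus at least 1, so deleting it does not increase
        the product.\<close>
      also have "\<dots> \<le> real_of_int \<bar>k i\<bar> * (\<Prod>j\<in>UNIV - {i}. real_of_int \<bar>k j\<bar>)"
      proof -
        have "1 \<le> real_of_int \<bar>k i\<bar>" using nz[of i] by linarith
        moreover have "0 \<le> (\<Prod>j\<in>UNIV - {i}. real_of_int \<bar>k j\<bar>)" by (intro prod_nonneg) auto
        ultimately show ?thesis using mult_right_mono[of 1] by fastforce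
      qed
      also have "\<dots> = (\<Prod>j\<in>UNIV. real_of_int \<bar>k j\<bar>)" by (rule prod.remove[symmetric]) auto
      also have "\<dots> \<le> N" using k by (auto simp: hyp_cross_def)
      finally show "k(i := 0) \<in> hyp_cross (UNIV - {i}) N"
        using nz unfolding hyp_cross_def by auto
    qed
    have "finite (hyp_cross (UNIV - {i}) N)" using hyp_cross_card[of "UNIV - {i}" N] by simp
    from card_mono[OF this sub] have "card (?S i m) \<le> card (hyp_cross (UNIV - {i}) N)"
      by (simp only: card_image[OF inj])
    then have "real (card (?S i m)) \<le> real (card (hyp_cross (UNIV - {i}) N))" by simp
    also have "\<dots> = 2 ^ (d - 1) * div_count (d - 1) N"
      using hyp_cross_card[of "UNIV - {i}" N] by (simp add: d_def card_Diff_singleton)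
    finally show ?thesis .
  qed
  let ?Y = "(UNIV :: 'n set) \<times> {- int k0..int k0}"
  have "?H \<subseteq> ?L \<union> (\<Union>(i, m)\<in>?Y. ?S i m)"
  proof
    fix k assume k: "k \<in> ?H"
    show "k \<in> ?L \<union> (\<Union>(i, m)\<in>?Y. ?S i m)"
    proof (cases "\<forall>i. int k0 \<le> \<bar>k i\<bar>")
      case False
      then obtain i where "\<bar>k i\<bar> < int k0" unfolding not_all not_le by blast
      then have "(i, k i) \<in> ?Y" by auto
      then show ?thesis using k by blast
    qed (use k in simp)
  qed
  then have "card ?H \<le> card (?L \<union> (\<Union>(i, m)\<in>?Y. ?S i m))"
    using finH by (intro card_mono) (auto intro: finite_subset)
  also have "\<dots> \<le> card ?L + card (\<Union>(i, m)\<in>?Y. ?S i m)" by (rule card_Un_le)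
  also have "card (\<Union>(i, m)\<in>?Y. ?S i m) \<le> (\<Sum>y\<in>?Y. card (case y of (i, m) \<Rightarrow> ?S i m))"
    by (rule card_UN_le) simp
  finally have "card ?H \<le> card ?L + (\<Sum>y\<in>?Y. card (case y of (i, m) \<Rightarrow> ?S i m))" by simp
  then have "real (card ?H) \<le> real (card ?L + (\<Sum>y\<in>?Y. card (case y of (i, m) \<Rightarrow> ?S i m)))"
    by (rule of_nat_mono)
  also have "\<dots> = real (card ?L) + (\<Sum>y\<in>?Y. real (card (case y of (i, m) \<Rightarrow> ?S i m)))"
    by (simp only: of_nat_add of_nat_sum)
  also have "(\<Sum>y\<in>?Y. real (card (case y of (i, m) \<Rightarrow> ?S i m))) \<le> (\<Sum>y\<in>?Y. 2 ^ (d - 1) * div_count (d - 1) N)"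
    by (rule sum_mono) (simp only: case_prod_unfold slice)
  also have "\<dots> = real (d * (2 * k0 + 1)) * 2 ^ (d - 1) * div_count (d - 1) N"
    by (simp add: d_def algebra_simps)
  finally show ?thesis unfolding cardH by linarith
qed

text \<open>The top derivative dominates: with y = (\<theta> |k|)^2 \<ge> s / \<eta> the s lower
  powers add up to at most \<eta> y^s. The factor 1 + \<eta> is enlarged to its square because
  squared norms are compared.\<close>

lemma sobolev_weight_le:
  assumes ab: "a < b" and s: "s \<ge> 1" and \<eta>: "\<eta> > 0"
  defines "\<theta> \<equiv> 2 * pi / (b - a)"
  shows "\<exists>k0::nat. \<forall>k::int. int k0 \<le> \<bar>k\<bar> \<longrightarrow>
    sobolev_weight a b s k \<le> ((1 + \<eta>) * (\<theta> * real_of_int \<bar>k\<bar>) ^ s)\<^sup>2"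
proof -
  have \<theta>: "\<theta> > 0" using ab by (simp add: \<theta>_def)
  \<comment> \<open>From here on \<theta> |k| is at least 1 and at least s / \<eta>, hence so is its
    square.\<close>
  obtain k0 :: nat where k0: "max 1 (real s / \<eta>) / \<theta> \<le> real k0" using real_arch_simple by blast
  have "sobolev_weight a b s k \<le> ((1 + \<eta>) * (\<theta> * real_of_int \<bar>k\<bar>) ^ s)\<^sup>2" if k: "int k0 \<le> \<bar>k\<bar>" for k :: int
  proof -
    define y where "y = (\<theta> * real_of_int \<bar>k\<bar>)\<^sup>2"
    have "real k0 \<le> real_of_int \<bar>k\<bar>" using k by linarith
    then have "max 1 (real s / \<eta>) / \<theta> \<le> real_of_int \<bar>k\<bar>" using k0 by linarith
    then have ge: "max 1 (real s / \<eta>) \<le> \<theta> * real_of_int \<bar>k\<bar>" using \<theta> by (simp add: pos_divide_le_eq mult.commute)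
    also have "\<dots> \<le> y" unfolding y_def using ge by (intro self_le_power) auto
    finally have y: "1 \<le> y" "real s / \<eta> \<le> y" by auto
    have "norm (wave a b k) = \<theta> * real_of_int \<bar>k\<bar>" unfolding \<theta>_def by (rule norm_wave[OF ab])
    then have "sobolev_weight a b s k = (\<Sum>l=0..s. y ^ l)" by (simp add: sobolev_weight_def y_def)
    also have "\<dots> = (\<Sum>l<s. y ^ l) + y ^ s"
      by (simp add: atLeast0AtMost lessThan_Suc_atMost[symmetric])
    also have "(\<Sum>l<s. y ^ l) \<le> (\<Sum>l<s. y ^ (s - 1))"
      using y by (intro sum_mono power_increasing) auto
    also have "\<dots> = real s * y ^ (s - 1)" by simp
    also have "\<dots> \<le> (\<eta> * y) * y ^ (s - 1)"
      using y \<eta> by (intro mult_right_mono) (auto simp: pos_divide_le_eq mult.commute)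
    also have "\<dots> = \<eta> * y ^ s" using s by (simp add: power_eq_if)
    also have "\<eta> * y ^ s + y ^ s = (1 + \<eta>) * y ^ s" by (simp add: algebra_simps)
    also have "\<dots> \<le> (1 + \<eta>)\<^sup>2 * y ^ s"
      using \<eta> y by (intro mult_right_mono self_le_power) auto
    also have "\<dots> = ((1 + \<eta>) * (\<theta> * real_of_int \<bar>k\<bar>) ^ s)\<^sup>2"
    proof -
      have "(1 + \<eta>)\<^sup>2 * (r\<^sup>2) ^ s = ((1 + \<eta>) * r ^ s)\<^sup>2" for r :: real
        by (simp add: power_mult_distrib power_mult[symmetric] mult.commute)
      then show ?thesis unfolding y_def .
    qed
    finally show ?thesis by simp
  qed
  then show ?thesis by blast
qed

text \<open>On the span of the remaining exponentials both norms are diagonal, so their ratio is at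
  most the largest weight \<open>L\<close>; the factor 1 + \<eta> per coordinate is the price of the
  lower derivatives.\<close>

lemma embedding_lower:
  fixes a b \<eta> :: real and s :: nat
  assumes ab: "a < b" and s: "s \<ge> 1" and \<eta>: "\<eta> > 0"
  defines "d \<equiv> CARD('n::finite)" and "\<theta> \<equiv> 2 * pi / (b - a)"
  shows "\<exists>C. \<forall>N>0. \<forall>n\<ge>1. real n \<le> 2 ^ d * div_count d N - C * div_count (d - 1) N \<longrightarrow>
    1 / ((1 + \<eta>) ^ d * (\<theta> ^ (s * d) * N ^ s)) \<le> embedding_approx_number TYPE('n) a b s n"
proof -
  have \<theta>: "\<theta> > 0" using ab by (simp add: \<theta>_def)
  obtain k0 :: nat where k0: "\<And>k::int. int k0 \<le> \<bar>k\<bar> \<Longrightarrow>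
    sobolev_weight a b s k \<le> ((1 + \<eta>) * (\<theta> * real_of_int \<bar>k\<bar>) ^ s)\<^sup>2"
    using sobolev_weight_le[OF ab s \<eta>] unfolding \<theta>_def by blast
  define C where "C = real (d * (2 * k0 + 1)) * 2 ^ (d - 1)"
  have "1 / ((1 + \<eta>) ^ d * (\<theta> ^ (s * d) * N ^ s)) \<le> embedding_approx_number TYPE('n) a b s n"
    if N: "N > 0" and n: "n \<ge> 1" "real n \<le> 2 ^ d * div_count d N - C * div_count (d - 1) N" for N n
  proof -
    define K where "K = {k \<in> hyp_cross (UNIV :: 'n set) N. \<forall>i. int k0 \<le> \<bar>k i\<bar>}"
    define L where "L = (1 + \<eta>) ^ d * (\<theta> ^ (s * d) * N ^ s)"
    have L: "L > 0" unfolding L_def using \<eta> \<theta> N by (intro mult_pos_pos zero_less_power) auto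
    have finK: "finite K" unfolding K_def using hyp_cross_card[of "UNIV :: 'n set" N] by simp
    have "real n \<le> real (card K)"
      using n(2) hyp_cross_large_card[where 'n = 'n, of N k0] unfolding C_def K_def d_def by linarith
    then have cardK: "n \<le> card K" by simp
    have weight: "(\<Prod>i\<in>UNIV. sobolev_weight a b s (k i)) \<le> L\<^sup>2" if k: "k \<in> K" for k
    proof -
      have "(\<Prod>i\<in>UNIV. sobolev_weight a b s (k i)) \<le> (\<Prod>i\<in>UNIV. ((1 + \<eta>) * (\<theta> * real_of_int \<bar>k i\<bar>) ^ s)\<^sup>2)"
        using k by (intro prod_mono conjI k0) (auto simp: K_def sobolev_weight_def intro!: sum_nonneg)
      also have "\<dots> = ((1 + \<eta>) ^ d * (\<theta> ^ (s * d) * (\<Prod>i\<in>UNIV. real_of_int \<bar>k i\<bar>) ^ s))\<^sup>2"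
        by (simp add: prod_power_distrib[symmetric] prod.distrib d_def power_mult power_mult_distrib del: of_int_abs)
           (simp add: power_mult[symmetric] mult.commute mult.left_commute)
      also have "\<dots> \<le> L\<^sup>2"
      proof (rule power_mono)
        have "(\<Prod>i\<in>UNIV. real_of_int \<bar>k i\<bar>) ^ s \<le> N ^ s"
          using k by (intro power_mono prod_nonneg) (auto simp: K_def hyp_cross_def)
        then show "(1 + \<eta>) ^ d * (\<theta> ^ (s * d) * (\<Prod>i\<in>UNIV. real_of_int \<bar>k i\<bar>) ^ s) \<le> L"
          unfolding L_def using \<eta> \<theta> by (intro mult_left_mono) auto
        show "0 \<le> (1 + \<eta>) ^ d * (\<theta> ^ (s * d) * (\<Prod>i\<in>UNIV. real_of_int \<bar>k i\<bar>) ^ s)"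
          using \<eta> \<theta> by (intro mult_nonneg_nonneg zero_le_power prod_nonneg) auto
      qed
      finally show ?thesis .
    qed
    interpret L2_embedding "H_mix a b s :: (real^'n \<Rightarrow> complex) set" "H_mix_norm a b s" "cube_measure a b"
      by (rule L2_embedding_H_mix[OF ab])
    have nrm: "(L2_norm (cube_measure a b) (\<lambda>x. \<Sum>k\<in>K. c k * trig a b k x))\<^sup>2 = (\<Sum>k\<in>K. (norm (c k))\<^sup>2)" for c
      by (rule L2_orthonormal_expansion(1)[OF finK trig_L2 trig_L2 trig_orthonormal[OF ab]])
    have "1 / L \<le> approx_number (H_mix a b s :: (real^'n \<Rightarrow> complex) set) (H_mix_norm a b s)
       (L2_space (cube_measure a b)) (L2_norm (cube_measure a b)) (\<lambda>f. f) n"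
    proof (rule approx_number_ge[OF n(1) finK cardK trig_H_mix _ _ L])
      fix c :: "('n \<Rightarrow> int) \<Rightarrow> complex"
      show "\<forall>k\<in>K. c k = 0" if "L2_norm (cube_measure a b) (\<lambda>x. \<Sum>k\<in>K. c k * trig a b k x) = 0"
        using nrm[of c] finK unfolding that by (simp add: sum_nonneg_eq_0_iff)
      have "(H_mix_norm a b s (\<lambda>x. \<Sum>k\<in>K. c k * trig a b k x))\<^sup>2 =
        (\<Sum>k\<in>K. (norm (c k))\<^sup>2 * (\<Prod>i\<in>UNIV. sobolev_weight a b s (k i)))"
        by (rule H_mix_norm_trig_sum[OF ab finK])
      also have "\<dots> \<le> (\<Sum>k\<in>K. (norm (c k))\<^sup>2 * L\<^sup>2)"
        using weight by (intro sum_mono mult_left_mono) auto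
      also have "\<dots> = (L * L2_norm (cube_measure a b) (\<lambda>x. \<Sum>k\<in>K. c k * trig a b k x))\<^sup>2"
        unfolding power_mult_distrib nrm by (simp add: sum_distrib_left mult.commute)
      finally show "H_mix_norm a b s (\<lambda>x. \<Sum>k\<in>K. c k * trig a b k x) \<le> L * L2_norm (cube_measure a b) (\<lambda>x. \<Sum>k\<in>K. c k * trig a b k x)"
        by (rule power2_le_imp_le) (intro mult_nonneg_nonneg L2_norm_nonneg less_imp_le[OF L])
    qed
    then show ?thesis unfolding embedding_approx_number_eq L_def .
  qed
  then show ?thesis unfolding C_def by blast
qed

theorem corollary5:
  fixes a b :: real and s :: nat
  assumes "a < b" and "s \<ge> 1"
  shows "(\<lambda>n. embedding_approx_number TYPE('n::finite) a b s n * real n ^ s *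
              ln (real n) powi (- int (s * (CARD('n) - 1))))
         \<longlonglongrightarrow> ((b - a) ^ CARD('n) / (pi ^ CARD('n) * fact (CARD('n) - 1))) ^ s"
proof -
  define e where "e = CARD('n) - 1"
  have d: "CARD('n) = Suc e" by (simp add: e_def)
  define \<theta> where "\<theta> = 2 * pi / (b - a)"
  have \<theta>: "\<theta> > 0" using assms by (simp add: \<theta>_def)
  define G where "G = 1 / \<theta> ^ (s * Suc e)"
  define A where "A n = embedding_approx_number TYPE('n) a b s n" for n
  have "(\<lambda>n. A n * log_scale e n ^ s) \<longlonglongrightarrow> G * (2 ^ Suc e / fact e) ^ s"
  proof (rule limit_from_counting_bounds)
    show "G > 0" using \<theta> by (simp add: G_def)
    show "\<exists>B\<ge>1. \<exists>C. \<forall>N>0. \<forall>n. 2 ^ Suc e * div_count (Suc e) N + C * div_count e (B * N) < real n \<longrightarrow>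
       A n \<le> (G + \<epsilon>) / N ^ s" if "\<epsilon> > 0" for \<epsilon>
      using embedding_upper[where 'n = 'n, OF assms that] unfolding d diff_Suc_1 A_def G_def \<theta>_def .
    show "\<exists>C. \<forall>N>0. \<forall>n\<ge>1. real n \<le> 2 ^ Suc e * div_count (Suc e) N - C * div_count e N \<longrightarrow>
       G / ((1 + \<eta>) ^ Suc e * N ^ s) \<le> A n" if "\<eta> > 0" for \<eta>
    proof -
      have "G / ((1 + \<eta>) ^ Suc e * N ^ s) = 1 / ((1 + \<eta>) ^ Suc e * (\<theta> ^ (s * Suc e) * N ^ s))" for N
        by (simp add: G_def mult_ac)
      then show ?thesis
        using embedding_lower[where 'n = 'n, OF assms that] unfolding d diff_Suc_1 A_def \<theta>_def by (simp only:)
    qed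
  qed
  \<comment> \<open>Valid for every n, also where the logarithm is 0, since both sides are formed
    with the same inverse.\<close>
  moreover have "A n * log_scale e n ^ s = A n * real n ^ s * ln (real n) powi (- int (s * e))" for n
  proof -
    have pw: "(ln (real n) ^ e) ^ s = ln (real n) ^ (s * e)" by (simp only: power_mult[symmetric] mult.commute)
    then show ?thesis
      by (simp only: log_scale_def divide_inverse power_mult_distrib power_inverse pw
          power_int_minus power_int_of_nat mult.assoc)
  qed
  \<comment> \<open>The powers of 2 from the sign patterns cancel those in
    \<open>\<theta>\<close>.\<close>
  moreover have "G * (2 ^ Suc e / fact e) ^ s = ((b - a) ^ Suc e / (pi ^ Suc e * fact e)) ^ s"
  proof -
    have "G = (1 / \<theta> ^ Suc e) ^ s" unfolding G_def by (simp only: power_one_over mult.commute[of s] power_mult)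
    then have "G * (2 ^ Suc e / fact e) ^ s = (1 / \<theta> ^ Suc e * (2 ^ Suc e / fact e)) ^ s"
      by (simp only: power_mult_distrib)
    also have "1 / \<theta> ^ Suc e * (2 ^ Suc e / fact e) = (b - a) ^ Suc e / (pi ^ Suc e * fact e)"
      unfolding \<theta>_def power_divide power_mult_distrib by simp
    finally show ?thesis .
  qed
  ultimately show ?thesis unfolding A_def d diff_Suc_1 by (simp only:)
qed

end
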